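(* Let $\mathfrak A$ be a measurable relation algebra such that, for each measurable atom $x$ of $\mathfrak A$, the group $G_x$ is finite and cyclic. Then $\mathfrak A$ is essentially isomorphic to a cyclic group relation algebra; that is, there are an index set $I$, an equivalence relation $\mathcal E$ on $I$, a system $G=\langle G_x:x\in I\rangle$ of pairwise disjoint finite cyclic groups, and a system $m=\langle m_{xy}:(x,y)\in\mathcal E\rangle$ of positive integers satisfying the index conditions, such that the completion of $\mathfrak A$ is isomorphic to the cyclic group relation algebra determined by $G$, $\mathcal E$ and $m$. Hence, $\mathfrak A$ is completely representable.
   Context: A relation algebra is an algebra $\mathfrak A=(A,+,-,;,{}^{\smile},1')$ such that $(A,+,-)$ is a Boolean algebra (with unit $1$, zero $0$, meet $\cdot$ and order $\le$) and, for all $r,s,t\in A$: $r;(s;t)=(r;s);t$, $r;1'=r$, $r^{\smile\smile}=r$, $(r;s)^{\smile}=s^{\smile};r^{\smile}$, $(r+s);t=r;t+s;t$, $(r+s)^{\smile}=r^{\smile}+s^{\smile}$, and $r^{\smile};-(r;s)\le -s$. "Sum" of a set of elements means its supremum. An element $f$ is functional if $f^{\smile};f\le 1'$. A subidentity atom is an atom $x\le 1'$. A subidentity atom $x$ is measurable (a measurable atom) if $x;1;x$ is the sum of a set of functional elements. $\mathfrak A$ is measurable if $1'$ is the sum of measurable atoms. For a measurable atom $x$, $G_x$ denotes the set of non-zero functional elements below $x;1;x$; these are atoms and form a group under $;$, with inverse ${}^{\smile}$ and identity element $x$. The completion of $\mathfrak A$ is its minimal complete extension (the complete relation algebra containing $\mathfrak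 A$ as a dense regular subalgebra). A set relation algebra is a relation algebra whose elements are binary relations contained in some equivalence relation $E$ on a set $U$ (the largest element being $E$), with union, complement relative to $E$, relational composition, relational converse, and the identity relation on $U$ as its operations. A relation algebra is completely representable if it is isomorphic to a set relation algebra via an isomorphism under which all existing suprema become unions. Index conditions. Let $G=\langle G_x:x\in I\rangle$ be a system of pairwise disjoint finite cyclic groups, and $\mathcal E$ an equivalence relation on $I$. A system $m=\langle m_{xy}:(x,y)\in\mathcal E\rangle$ of positive integers satisfies the index conditions if, for all $(x,y),(y,z)\in\mathcal E$: (i) $m_{xy}$ is a common divisor of the orders of $G_x$ and $G_y$; (ii) $m_{xx}=|G_x|$; (iii) $m_{yx}=m_{xy}$; (iv) $\gcd(m_{xy},m_{yz})=\gcd(m_{xy},m_{xz})=\gcd(m_{xz},m_{yz})$. Cyclic group relation algebra determined by $G,\mathcal E,m$. Identify each $G_x$ with (a copy of) $\mathbb Z_{n_x}$, $n_x=|G_x|$, written additively. For $(x,y)\in\mathcal E$ let $H_{xy}$ be the subgroup of $G_x$ consisting of the multiples of $m_{xy}$, let $K_{xy}$ be the subgroup of $G_y$ consisting of the multiples of $m_{xy}$, and let $\varphi_{xy}:G_x/H_{xy}\to G_y/K_{xy}$ be the isomorphism with $\varphi_{xy}(H_{xy}+\ell)=K_{xy}+\ell$ for $0\le \ell<m_{xy}$. Let $(H_{xy,\alpha}:\alpha<\kappa_{xy})$ list the cosets of $H_{xy}$ in $G_x$, and put $$R_{xy,\alpha}=\bigcup_{\gamma<\kappa_{xy}}H_{xy,\gamma}\times\varphi_{xy}(H_{xy,\gamma}\circ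 H_{xy,\alpha}),$$ where $\circ$ is the group operation on cosets. The cyclic group relation algebra is the set relation algebra on $\bigcup_{x\in I}G_x$ whose universe is the set of all binary relations of the form $\bigcup\{R_{xy,\alpha}:(x,y,\alpha)\in X\}$ with $X\subseteq\{(x,y,\alpha):(x,y)\in\mathcal E,\ \alpha<\kappa_{xy}\}$. *)

theory Defs
  imports "HOL-Algebra.Elementary_Groups"
begin

section \<open>Relation algebras\<close>

record 'a ra = "'a partial_object" +
  rsum   :: "['a, 'a] \<Rightarrow> 'a"  (infixl \<open>\<^bold>+\<index>\<close> 65)
  rcompl :: "'a \<Rightarrow> 'a"        (\<open>\<^bold>-\<index> _\<close> [81] 80)
  rcomp  :: "['a, 'a] \<Rightarrow> 'a"  (infixl \<open>\<Zsemi>\<index>\<close> 70)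
  rconv  :: "'a \<Rightarrow> 'a"        (\<open>_\<smile>\<index>\<close> [1000] 999)
  rident :: "'a"

definition rmeet :: "('a, 'm) ra_scheme \<Rightarrow> 'a \<Rightarrow> 'a \<Rightarrow> 'a"  (infixl \<open>\<^bold>\<cdot>\<index>\<close> 68)
  where "r \<^bold>\<cdot>\<^bsub>A\<^esub> s = \<^bold>-\<^bsub>A\<^esub> (\<^bold>-\<^bsub>A\<^esub> r \<^bold>+\<^bsub>A\<^esub> \<^bold>-\<^bsub>A\<^esub> s)"

definition rle :: "('a, 'm) ra_scheme \<Rightarrow> 'a \<Rightarrow> 'a \<Rightarrow> bool"  (infix \<open>\<^bold>\<le>\<index>\<close> 50)
  where "r \<^bold>\<le>\<^bsub>A\<^esub> s \<longleftrightarrow> r \<^bold>+\<^bsub>A\<^esub> s = s"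

definition runit :: "('a, 'm) ra_scheme \<Rightarrow> 'a"
  where "runit A = rident A \<^bold>+\<^bsub>A\<^esub> \<^bold>-\<^bsub>A\<^esub> rident A"

definition rzero :: "('a, 'm) ra_scheme \<Rightarrow> 'a"
  where "rzero A = \<^bold>-\<^bsub>A\<^esub> runit A"

text \<open>A Boolean algebra is presented by its join and complement only; the meet is
  the De Morgan dual of the join. The dual forms of absorption, distributivity and
  the complement law follow from the double complement law.\<close>

locale boolean_alg =
  fixes A :: "('a, 'm) ra_scheme" (structure)
  assumes carrier_nonempty: "carrier A \<noteq> {}"
    and sum_closed: "\<lbrakk>r \<in> carrier A; s \<in> carrier A\<rbrakk> \<Longrightarrow> r \<^bold>+ s \<in> carrier A"
    and compl_closed: "r \<in> carrier A \<Longrightarrow> \<^bold>- r \<in> carrier A"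
    and sum_assoc: "\<lbrakk>r \<in> carrier A; s \<in> carrier A; t \<in> carrier A\<rbrakk>
          \<Longrightarrow> r \<^bold>+ (s \<^bold>+ t) = (r \<^bold>+ s) \<^bold>+ t"
    and sum_commute: "\<lbrakk>r \<in> carrier A; s \<in> carrier A\<rbrakk> \<Longrightarrow> r \<^bold>+ s = s \<^bold>+ r"
    and double_compl: "r \<in> carrier A \<Longrightarrow> \<^bold>- (\<^bold>- r) = r"
    and absorption: "\<lbrakk>r \<in> carrier A; s \<in> carrier A\<rbrakk> \<Longrightarrow> r \<^bold>+ (r \<^bold>\<cdot> s) = r"
    and distrib: "\<lbrakk>r \<in> carrier A; s \<in> carrier A; t \<in> carrier A\<rbrakk>
          \<Longrightarrow> r \<^bold>\<cdot> (s \<^bold>+ t) = (r \<^bold>\<cdot> s) \<^bold>+ (r \<^bold>\<cdot> t)"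
    and meet_compl: "\<lbrakk>r \<in> carrier A; s \<in> carrier A\<rbrakk> \<Longrightarrow> (r \<^bold>\<cdot> \<^bold>- r) \<^bold>+ s = s"

locale relation_algebra = boolean_alg A for A :: "('a, 'm) ra_scheme" (structure) +
  assumes comp_closed: "\<lbrakk>r \<in> carrier A; s \<in> carrier A\<rbrakk> \<Longrightarrow> r \<Zsemi> s \<in> carrier A"
    and conv_closed: "r \<in> carrier A \<Longrightarrow> r\<smile> \<in> carrier A"
    and ident_closed: "rident A \<in> carrier A"
    and comp_assoc: "\<lbrakk>r \<in> carrier A; s \<in> carrier A; t \<in> carrier A\<rbrakk>
          \<Longrightarrow> r \<Zsemi> (s \<Zsemi> t) = (r \<Zsemi> s) \<Zsemi> t"
    and comp_ident: "r \<in> carrier A \<Longrightarrow> r \<Zsemi> rident A = r"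
    and conv_conv: "r \<in> carrier A \<Longrightarrow> (r\<smile>)\<smile> = r"
    and conv_comp: "\<lbrakk>r \<in> carrier A; s \<in> carrier A\<rbrakk> \<Longrightarrow> (r \<Zsemi> s)\<smile> = s\<smile> \<Zsemi> r\<smile>"
    and sum_comp: "\<lbrakk>r \<in> carrier A; s \<in> carrier A; t \<in> carrier A\<rbrakk>
          \<Longrightarrow> (r \<^bold>+ s) \<Zsemi> t = (r \<Zsemi> t) \<^bold>+ (s \<Zsemi> t)"
    and conv_sum: "\<lbrakk>r \<in> carrier A; s \<in> carrier A\<rbrakk> \<Longrightarrow> (r \<^bold>+ s)\<smile> = r\<smile> \<^bold>+ s\<smile>"
    and conv_comp_compl: "\<lbrakk>r \<in> carrier A; s \<in> carrier A\<rbrakk>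
          \<Longrightarrow> r\<smile> \<Zsemi> (\<^bold>- (r \<Zsemi> s)) \<^bold>\<le> \<^bold>- s"

definition is_sum :: "('a, 'm) ra_scheme \<Rightarrow> 'a set \<Rightarrow> 'a \<Rightarrow> bool"
  where "is_sum A X s \<longleftrightarrow>
    s \<in> carrier A \<and> (\<forall>x\<in>X. x \<^bold>\<le>\<^bsub>A\<^esub> s) \<and>
    (\<forall>u\<in>carrier A. (\<forall>x\<in>X. x \<^bold>\<le>\<^bsub>A\<^esub> u) \<longrightarrow> s \<^bold>\<le>\<^bsub>A\<^esub> u)"

section \<open>Measurable relation algebras\<close>

definition functional :: "('a, 'm) ra_scheme \<Rightarrow> 'a \<Rightarrow> bool"
  where "functional A f \<longleftrightarrow> f \<in> carrier A \<and> f\<smile>\<^bsub>A\<^esub> \<Zsemi>\<^bsub>A\<^esub> f \<^bold>\<le>\<^bsub>A\<^esub> rident A"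

definition ra_atom :: "('a, 'm) ra_scheme \<Rightarrow> 'a \<Rightarrow> bool"
  where "ra_atom A x \<longleftrightarrow>
    x \<in> carrier A \<and> x \<noteq> rzero A \<and>
    (\<forall>y\<in>carrier A. y \<^bold>\<le>\<^bsub>A\<^esub> x \<longrightarrow> y = rzero A \<or> y = x)"

definition subidentity_atom :: "('a, 'm) ra_scheme \<Rightarrow> 'a \<Rightarrow> bool"
  where "subidentity_atom A x \<longleftrightarrow> ra_atom A x \<and> x \<^bold>\<le>\<^bsub>A\<^esub> rident A"

definition measurable_atom :: "('a, 'm) ra_scheme \<Rightarrow> 'a \<Rightarrow> bool"
  where "measurable_atom A x \<longleftrightarrow>
    subidentity_atom A x \<and>
    (\<exists>F. (\<forall>f\<in>F. functional A f) \<and> is_sum A F (x \<Zsemi>\<^bsub>A\<^esub> runit A \<Zsemi>\<^bsub>A\<^esub> x))"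

definition measurable_ra :: "('a, 'm) ra_scheme \<Rightarrow> bool"
  where "measurable_ra A \<longleftrightarrow>
    relation_algebra A \<and> (\<exists>M. (\<forall>x\<in>M. measurable_atom A x) \<and> is_sum A M (rident A))"

definition atom_group :: "('a, 'm) ra_scheme \<Rightarrow> 'a \<Rightarrow> 'a monoid"
  where "atom_group A x =
    \<lparr>carrier = {f. functional A f \<and> f \<noteq> rzero A \<and> f \<^bold>\<le>\<^bsub>A\<^esub> x \<Zsemi>\<^bsub>A\<^esub> runit A \<Zsemi>\<^bsub>A\<^esub> x},
     mult = rcomp A, one = x\<rparr>"

section \<open>Isomorphisms and completions\<close>

definition ra_hom :: "('a, 'm) ra_scheme \<Rightarrow> ('b, 'n) ra_scheme \<Rightarrow> ('a \<Rightarrow> 'b) set"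
  where "ra_hom A B = {f. f \<in> carrier A \<rightarrow> carrier B \<and>
    (\<forall>r\<in>carrier A. \<forall>s\<in>carrier A. f (r \<^bold>+\<^bsub>A\<^esub> s) = f r \<^bold>+\<^bsub>B\<^esub> f s) \<and>
    (\<forall>r\<in>carrier A. f (\<^bold>-\<^bsub>A\<^esub> r) = \<^bold>-\<^bsub>B\<^esub> f r) \<and>
    (\<forall>r\<in>carrier A. \<forall>s\<in>carrier A. f (r \<Zsemi>\<^bsub>A\<^esub> s) = f r \<Zsemi>\<^bsub>B\<^esub> f s) \<and>
    (\<forall>r\<in>carrier A. f (r\<smile>\<^bsub>A\<^esub>) = (f r)\<smile>\<^bsub>B\<^esub>) \<and>
    f (rident A) = rident B}"

definition ra_iso :: "('a, 'm) ra_scheme \<Rightarrow> ('b, 'n) ra_scheme \<Rightarrow> ('a \<Rightarrow> 'b) set"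
  where "ra_iso A B = {f \<in> ra_hom A B. bij_betw f (carrier A) (carrier B)}"

definition ra_isomorphic :: "('a, 'm) ra_scheme \<Rightarrow> ('b, 'n) ra_scheme \<Rightarrow> bool"
  where "ra_isomorphic A B \<longleftrightarrow> ra_iso A B \<noteq> {}"

definition complete_ra :: "('a, 'm) ra_scheme \<Rightarrow> bool"
  where "complete_ra A \<longleftrightarrow>
    relation_algebra A \<and> (\<forall>X. X \<subseteq> carrier A \<longrightarrow> (\<exists>s. is_sum A X s))"

text \<open>The algebra \<open>B\<close> together with the embedding \<open>e\<close> is a completion of \<open>A\<close>: the last two
  clauses say that the image of \<open>A\<close> is a regular subalgebra of \<open>B\<close> and is dense in \<open>B\<close>.\<close>

definition is_completion ::
    "('a, 'm) ra_scheme \<Rightarrow> ('b, 'n) ra_scheme \<Rightarrow> ('a \<Rightarrow> 'b) \<Rightarrow> bool"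
  where "is_completion A B e \<longleftrightarrow>
    complete_ra B \<and> e \<in> ra_hom A B \<and> inj_on e (carrier A) \<and>
    (\<forall>X s. X \<subseteq> carrier A \<longrightarrow> is_sum A X s \<longrightarrow> is_sum B (e ` X) (e s)) \<and>
    (\<forall>b\<in>carrier B. b \<noteq> rzero B \<longrightarrow>
       (\<exists>a\<in>carrier A. a \<noteq> rzero A \<and> e a \<^bold>\<le>\<^bsub>B\<^esub> b))"

section \<open>Set relation algebras and complete representations\<close>

definition set_relation_algebra :: "('u \<times> 'u) set ra \<Rightarrow> bool"
  where "set_relation_algebra S \<longleftrightarrow>
    relation_algebra S \<and>
    (\<exists>U E. equiv U E \<and> E \<in> carrier S \<and> (\<forall>r\<in>carrier S. r \<subseteq> E) \<and>
       (\<forall>r\<in>carrier S. \<forall>s\<in>carrier S. r \<^bold>+\<^bsub>S\<^esub> s = r \<union> s) \<and>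
       (\<forall>r\<in>carrier S. \<^bold>-\<^bsub>S\<^esub> r = E - r) \<and>
       (\<forall>r\<in>carrier S. \<forall>s\<in>carrier S. r \<Zsemi>\<^bsub>S\<^esub> s = r O s) \<and>
       (\<forall>r\<in>carrier S. r\<smile>\<^bsub>S\<^esub> = r\<inverse>) \<and>
       rident S = Id_on U)"

definition complete_representation ::
    "('a, 'm) ra_scheme \<Rightarrow> ('u \<times> 'u) set ra \<Rightarrow> ('a \<Rightarrow> ('u \<times> 'u) set) \<Rightarrow> bool"
  where "complete_representation A S f \<longleftrightarrow>
    set_relation_algebra S \<and> f \<in> ra_iso A S \<and>
    (\<forall>X s. X \<subseteq> carrier A \<longrightarrow> is_sum A X s \<longrightarrow> f s = \<Union> (f ` X))"

section \<open>Cyclic group relation algebras\<close>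

text \<open>The identification of a cyclic group \<open>G x\<close> with the integers modulo its order is
  recorded by a generator \<open>g x\<close>: the residue \<open>l\<close> corresponds to the power of \<open>g x\<close> with
  exponent \<open>l\<close>. Accordingly the groups are written multiplicatively, as in HOL-Algebra.\<close>

definition cyclic_group_system ::
    "'i set \<Rightarrow> ('i \<Rightarrow> 'g monoid) \<Rightarrow> ('i \<Rightarrow> 'g) \<Rightarrow> bool"
  where "cyclic_group_system I G g \<longleftrightarrow>
    (\<forall>x\<in>I. group (G x) \<and> finite (carrier (G x)) \<and> cyclic_group (G x) \<and>
       g x \<in> carrier (G x) \<and> subgroup_generated (G x) {g x} = G x) \<and>
    (\<forall>x\<in>I. \<forall>y\<in>I. x \<noteq> y \<longrightarrow> carrier (G x) \<inter> carrier (G y) = {})"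

definition index_conditions ::
    "('i \<times> 'i) set \<Rightarrow> ('i \<Rightarrow> 'g monoid) \<Rightarrow> ('i \<Rightarrow> 'i \<Rightarrow> nat) \<Rightarrow> bool"
  where "index_conditions E G m \<longleftrightarrow>
    (\<forall>x y z. (x, y) \<in> E \<and> (y, z) \<in> E \<longrightarrow>
       m x y > 0 \<and>
       (m x y dvd order (G x) \<and> m x y dvd order (G y)) \<and>
       m x x = order (G x) \<and>
       m y x = m x y \<and>
       gcd (m x y) (m y z) = gcd (m x y) (m x z) \<and>
       gcd (m x y) (m x z) = gcd (m x z) (m y z))"

definition multiples :: "'g monoid \<Rightarrow> nat \<Rightarrow> 'g set"
  where "multiples H k = (\<lambda>a. a [^]\<^bsub>H\<^esub> k) ` carrier H"

definition coset_map ::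
    "('i \<Rightarrow> 'g monoid) \<Rightarrow> ('i \<Rightarrow> 'g) \<Rightarrow> ('i \<Rightarrow> 'i \<Rightarrow> nat) \<Rightarrow> 'i \<Rightarrow> 'i \<Rightarrow> 'g set \<Rightarrow> 'g set"
  where "coset_map G g m x y C = (THE D. \<exists>l < m x y.
    C = multiples (G x) (m x y) #>\<^bsub>G x\<^esub> (g x [^]\<^bsub>G x\<^esub> l) \<and>
    D = multiples (G y) (m x y) #>\<^bsub>G y\<^esub> (g y [^]\<^bsub>G y\<^esub> l))"

text \<open>The atomic relations are indexed by the cosets themselves rather than by an
  enumeration of them.\<close>

definition coset_rel ::
    "('i \<Rightarrow> 'g monoid) \<Rightarrow> ('i \<Rightarrow> 'g) \<Rightarrow> ('i \<Rightarrow> 'i \<Rightarrow> nat) \<Rightarrow> 'i \<Rightarrow> 'i \<Rightarrow> 'g set \<Rightarrow> ('g \<times> 'g) set"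
  where "coset_rel G g m x y D =
    (\<Union>C \<in> rcosets\<^bsub>G x\<^esub> (multiples (G x) (m x y)).
       C \<times> coset_map G g m x y (C <#>\<^bsub>G x\<^esub> D))"

definition cyclic_group_ra ::
    "'i set \<Rightarrow> ('i \<times> 'i) set \<Rightarrow> ('i \<Rightarrow> 'g monoid) \<Rightarrow> ('i \<Rightarrow> 'g) \<Rightarrow> ('i \<Rightarrow> 'i \<Rightarrow> nat)
      \<Rightarrow> ('g \<times> 'g) set ra"
  where "cyclic_group_ra I E G g m =
    \<lparr>carrier = {\<Union>(x, y, D)\<in>X. coset_rel G g m x y D | X.
        X \<subseteq> {(x, y, D). (x, y) \<in> E \<and> D \<in> rcosets\<^bsub>G x\<^esub> (multiples (G x) (m x y))}},
     rsum = (\<union>),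
     rcompl = (\<lambda>r. (\<Union>(x, y)\<in>E. carrier (G x) \<times> carrier (G y)) - r),
     rcomp = (O),
     rconv = converse,
     rident = Id_on (\<Union>x\<in>I. carrier (G x))\<rparr>"

end

theory Submission
  imports Defs "HOL-Number_Theory.Cong"
begin

text \<open>
  A measurable relation algebra with finite groups is atomic, so it is determined by the
  products of its atoms. The proof introduces coordinates on the atoms and then reads every
  atom as a binary relation on the disjoint union of the groups.

  Non-zero functional elements below \<open>x;1;x\<close> are atoms
  (\<open>functional_in_square_atom\<close>). Below a rectangle \<open>x;1;y\<close> one takes a non-zero \<open>a\<close> for which
  the finite set of all \<open>f\<close> in the group of \<open>x\<close> with \<open>f \<le> a;a\<smile>\<close> is as small as possible.
  If \<open>a\<close> split into disjoint non-zero parts \<open>c\<close> and \<open>d\<close>, some \<open>f\<close> would lie below \<open>c;d\<smile>\<close>,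
  and the set belonging to the part \<open>(f;d)\<cdot>c\<close> would no longer contain \<open>f\<smile>\<close>, which moves
  that part into \<open>d\<close>; so \<open>a\<close> is an atom (\<open>rectangle_atomic\<close>).

  Let \<open>hom x y\<close> be the set of atoms below \<open>x;1;y\<close>. The group of \<open>x\<close> acts on it
  transitively from the left and the group of \<open>y\<close> from the right. Once a generator of every
  group is fixed, \<open>hom x y\<close> is a single orbit of the integers, whose period \<open>m\<^sub>x\<^sub>y\<close> is the number
  of its elements. If \<open>c\<close> is an atom below \<open>a;b\<close>, all others arise from \<open>c\<close> by shifts
  with the multiples of \<open>gcd m\<^sub>x\<^sub>y m\<^sub>x\<^sub>z\<close> (\<open>comp_eq\<close>), and the comparison of this with the shifts
  that visibly fix \<open>a;b\<close> yields the index conditions (\<open>index_gcds\<close>).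

  Two coherent choices are needed: generators \<open>g\<^sub>x\<close> with \<open>g\<^sub>x;a = a;g\<^sub>y\<close> for all
  atoms \<open>a\<close> in \<open>hom x y\<close> (\<open>compatible_generators\<close>), and one atom \<open>a\<^sub>x\<^sub>y\<close> in every \<open>hom x y\<close> such
  that \<open>a\<^sub>x\<^sub>z \<le> a\<^sub>x\<^sub>y;a\<^sub>y\<^sub>z\<close> (\<open>network_exists\<close>). Both are made by recursion along a
  well-ordering of the index set. When \<open>x\<close> is added, the demands of all earlier \<open>y\<close> become
  congruences modulo the numbers \<open>m\<^sub>x\<^sub>y\<close>. There may be infinitely many of them, but every \<open>m\<^sub>x\<^sub>y\<close>
  divides the order of the group of \<open>x\<close>. Hence the system can be solved one prime at a time:
  for a power of a single prime, a \<open>y\<close> with the largest \<open>m\<^sub>x\<^sub>y\<close> decides, because the congruences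
  are consistent in pairs, and the Chinese remainder theorem glues the solutions
  (\<open>solve_congruences_coprime\<close>, \<open>trivialize_cocycle\<close>).

  The atom that is \<open>a\<^sub>x\<^sub>y\<close> shifted by \<open>k\<close> becomes the set of all pairs of powers of
  \<open>g\<^sub>x\<close> and \<open>g\<^sub>y\<close> whose exponents differ by \<open>k\<close> modulo \<open>m\<^sub>x\<^sub>y\<close>. These sets are exactly the
  relations from which the cyclic group relation algebra is built (\<open>coset_rel_eq_rel\<close>), and
  they compose as the atoms do (\<open>rel_comp\<close>). Sending an element to the union of the relations
  of the atoms below it represents the algebra. A completion has the same atoms, so
  the same map is defined on it; there it is onto, because all sums of atoms exist.
\<close>

section \<open>Arithmetic of relation algebras\<close>

context relation_algebra
begin

abbreviation zero (\<open>\<zero>\<close>) where "\<zero> \<equiv> rzero A"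
abbreviation top_elem (\<open>\<U>\<close>) where "\<U> \<equiv> runit A"

lemma meet_closed: "\<lbrakk>r \<in> carrier A; s \<in> carrier A\<rbrakk> \<Longrightarrow> r \<^bold>\<cdot> s \<in> carrier A"
  by (simp add: rmeet_def sum_closed compl_closed)

lemma unit_closed: "\<U> \<in> carrier A"
  by (simp add: runit_def ident_closed sum_closed compl_closed)

lemma zero_closed: "\<zero> \<in> carrier A"
  by (simp add: rzero_def unit_closed compl_closed)

lemmas closed = sum_closed compl_closed meet_closed unit_closed zero_closed
  comp_closed conv_closed ident_closed

lemma meet_commute: "\<lbrakk>r \<in> carrier A; s \<in> carrier A\<rbrakk> \<Longrightarrow> r \<^bold>\<cdot> s = s \<^bold>\<cdot> r"
  by (simp add: rmeet_def sum_commute closed)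

lemma compl_sum: "\<lbrakk>r \<in> carrier A; s \<in> carrier A\<rbrakk> \<Longrightarrow> \<^bold>- (r \<^bold>+ s) = \<^bold>- r \<^bold>\<cdot> \<^bold>- s"
  by (simp add: rmeet_def double_compl)

lemma meet_sum_absorb: "\<lbrakk>r \<in> carrier A; s \<in> carrier A\<rbrakk> \<Longrightarrow> r \<^bold>\<cdot> (r \<^bold>+ s) = r"
  using absorption[of "\<^bold>- r" "\<^bold>- s"]
  by (simp add: rmeet_def double_compl closed)

lemma sum_idem: "r \<in> carrier A \<Longrightarrow> r \<^bold>+ r = r"
  by (metis absorption meet_sum_absorb sum_closed)

lemma le_refl: "r \<in> carrier A \<Longrightarrow> r \<^bold>\<le> r"
  by (simp add: rle_def sum_idem)

lemma le_antisym: "\<lbrakk>r \<^bold>\<le> s; s \<^bold>\<le> r; r \<in> carrier A; s \<in> carrier A\<rbrakk> \<Longrightarrow> r = s"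
  by (metis rle_def sum_commute)

lemma le_trans:
  "\<lbrakk>r \<^bold>\<le> s; s \<^bold>\<le> t; r \<in> carrier A; s \<in> carrier A; t \<in> carrier A\<rbrakk> \<Longrightarrow> r \<^bold>\<le> t"
  by (metis rle_def sum_assoc)

lemma sum_upper1: "\<lbrakk>r \<in> carrier A; s \<in> carrier A\<rbrakk> \<Longrightarrow> r \<^bold>\<le> r \<^bold>+ s"
  by (simp add: rle_def sum_assoc sum_idem)

lemma sum_upper2: "\<lbrakk>r \<in> carrier A; s \<in> carrier A\<rbrakk> \<Longrightarrow> s \<^bold>\<le> r \<^bold>+ s"
  by (metis sum_upper1 sum_commute)

lemma sum_least:
  "\<lbrakk>r \<^bold>\<le> t; s \<^bold>\<le> t; r \<in> carrier A; s \<in> carrier A; t \<in> carrier A\<rbrakk> \<Longrightarrow> r \<^bold>+ s \<^bold>\<le> t"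
  by (metis rle_def sum_assoc)

lemma compl_antimono: "\<lbrakk>r \<^bold>\<le> s; r \<in> carrier A; s \<in> carrier A\<rbrakk> \<Longrightarrow> \<^bold>- s \<^bold>\<le> \<^bold>- r"
  by (metis absorption compl_closed compl_sum rle_def sum_commute meet_closed)

lemma meet_lower1: "\<lbrakk>r \<in> carrier A; s \<in> carrier A\<rbrakk> \<Longrightarrow> r \<^bold>\<cdot> s \<^bold>\<le> r"
  by (metis absorption meet_closed rle_def sum_commute)

lemma meet_lower2: "\<lbrakk>r \<in> carrier A; s \<in> carrier A\<rbrakk> \<Longrightarrow> r \<^bold>\<cdot> s \<^bold>\<le> s"
  by (metis meet_lower1 meet_commute)

lemma meet_greatest:
  "\<lbrakk>t \<^bold>\<le> r; t \<^bold>\<le> s; r \<in> carrier A; s \<in> carrier A; t \<in> carrier A\<rbrakk> \<Longrightarrow> t \<^bold>\<le> r \<^bold>\<cdot> s"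
  unfolding rmeet_def
  by (metis compl_antimono compl_closed double_compl sum_closed sum_least)

lemma meet_compl_zero: "r \<in> carrier A \<Longrightarrow> r \<^bold>\<cdot> \<^bold>- r = \<zero>"
proof -
  assume r: "r \<in> carrier A"
  have "\<zero> = rident A \<^bold>\<cdot> \<^bold>- rident A"
    by (simp add: rzero_def runit_def compl_sum closed double_compl meet_commute)
  then show ?thesis
    by (metis r meet_compl sum_commute closed(3) ident_closed compl_closed)
qed

lemma zero_sum: "r \<in> carrier A \<Longrightarrow> \<zero> \<^bold>+ r = r"
  by (metis meet_compl meet_compl_zero)

lemma zero_le: "r \<in> carrier A \<Longrightarrow> \<zero> \<^bold>\<le> r"
  by (simp add: rle_def zero_sum)

lemma le_zero: "\<lbrakk>r \<^bold>\<le> \<zero>; r \<in> carrier A\<rbrakk> \<Longrightarrow> r = \<zero>"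
  by (simp add: le_antisym zero_le zero_closed)

lemma le_unit: "r \<in> carrier A \<Longrightarrow> r \<^bold>\<le> \<U>"
  by (metis compl_closed compl_antimono double_compl zero_le rzero_def unit_closed)

lemma meet_zero_iff:
  assumes "r \<in> carrier A" "s \<in> carrier A"
  shows "r \<^bold>\<cdot> s = \<zero> \<longleftrightarrow> r \<^bold>\<le> \<^bold>- s"
proof
  assume z: "r \<^bold>\<cdot> s = \<zero>"
  have "s \<^bold>+ \<^bold>- s = \<U>"
    by (metis assms(2) closed(2,1,4) compl_sum double_compl meet_commute meet_compl_zero rzero_def)
  then have "r \<^bold>\<cdot> (s \<^bold>+ \<^bold>- s) = r"
    by (simp add: assms closed le_antisym le_refl le_unit meet_greatest meet_lower1)
  then have "r = r \<^bold>\<cdot> \<^bold>- s"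
    by (simp add: z assms distrib closed zero_sum)
  then show "r \<^bold>\<le> \<^bold>- s" by (metis assms compl_closed meet_lower2)
next
  assume "r \<^bold>\<le> \<^bold>- s"
  then have "r \<^bold>\<cdot> s \<^bold>\<le> \<^bold>- s" "r \<^bold>\<cdot> s \<^bold>\<le> s"
    by (meson assms closed le_trans meet_lower1 meet_lower2)+
  then have "r \<^bold>\<cdot> s \<^bold>\<le> s \<^bold>\<cdot> \<^bold>- s" by (simp add: assms closed meet_greatest)
  then show "r \<^bold>\<cdot> s = \<zero>" by (simp add: assms closed le_zero meet_compl_zero)
qed

lemma not_le_iff: "\<lbrakk>r \<in> carrier A; s \<in> carrier A\<rbrakk> \<Longrightarrow> \<not> r \<^bold>\<le> s \<longleftrightarrow> r \<^bold>\<cdot> \<^bold>- s \<noteq> \<zero>"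
  by (simp add: meet_zero_iff closed double_compl)

lemma meet_mono_zero:
  assumes "r \<^bold>\<le> r'" "s \<^bold>\<le> s'" "r' \<^bold>\<cdot> s' = \<zero>"
    "r \<in> carrier A" "s \<in> carrier A" "r' \<in> carrier A" "s' \<in> carrier A"
  shows "r \<^bold>\<cdot> s = \<zero>"
proof -
  have "r \<^bold>\<cdot> s \<^bold>\<le> r'" "r \<^bold>\<cdot> s \<^bold>\<le> s'"
    using assms by (meson closed le_trans meet_lower1 meet_lower2)+
  then have "r \<^bold>\<cdot> s \<^bold>\<le> r' \<^bold>\<cdot> s'"
      using assms(4-7) by (intro meet_greatest meet_closed)
  then show ?thesis using assms by (simp add: closed le_zero)
qed

lemma comp_mono_left:
  "\<lbrakk>r \<^bold>\<le> s; r \<in> carrier A; s \<in> carrier A; t \<in> carrier A\<rbrakk> \<Longrightarrow> r \<Zsemi> t \<^bold>\<le> s \<Zsemi> t"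
  by (metis rle_def sum_comp)

lemma conv_mono: "\<lbrakk>r \<^bold>\<le> s; r \<in> carrier A; s \<in> carrier A\<rbrakk> \<Longrightarrow> r\<smile> \<^bold>\<le> s\<smile>"
  by (metis rle_def conv_sum)

lemma conv_le_iff: "\<lbrakk>r \<in> carrier A; s \<in> carrier A\<rbrakk> \<Longrightarrow> r\<smile> \<^bold>\<le> s\<smile> \<longleftrightarrow> r \<^bold>\<le> s"
  by (metis conv_mono conv_conv conv_closed)

lemma comp_mono_right:
  assumes "r \<^bold>\<le> s" "r \<in> carrier A" "s \<in> carrier A" "t \<in> carrier A"
  shows "t \<Zsemi> r \<^bold>\<le> t \<Zsemi> s"
  using comp_mono_left[OF conv_mono[OF assms(1-3)], of "t\<smile>"] assms
  by (simp add: closed conv_comp[symmetric] conv_le_iff)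

lemma comp_mono:
  "\<lbrakk>r \<^bold>\<le> r'; s \<^bold>\<le> s'; r \<in> carrier A; s \<in> carrier A; r' \<in> carrier A; s' \<in> carrier A\<rbrakk>
    \<Longrightarrow> r \<Zsemi> s \<^bold>\<le> r' \<Zsemi> s'"
  by (meson closed comp_mono_left comp_mono_right le_trans)

lemma conv_zero: "\<zero>\<smile> = \<zero>"
  by (metis closed(5) closed(7) conv_conv conv_le_iff le_zero zero_le)

lemma conv_eq_zero: "r \<in> carrier A \<Longrightarrow> r\<smile> = \<zero> \<longleftrightarrow> r = \<zero>"
  by (metis conv_conv conv_zero)

lemma conv_unit: "\<U>\<smile> = \<U>"
  by (metis closed(4) closed(7) conv_conv conv_le_iff le_antisym le_unit)

lemma conv_meet_zero:
  assumes "r \<in> carrier A" "s \<in> carrier A"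
  shows "r\<smile> \<^bold>\<cdot> s\<smile> = \<zero> \<longleftrightarrow> r \<^bold>\<cdot> s = \<zero>"
proof -
  have *: "r \<^bold>\<cdot> s = \<zero>" if "r\<smile> \<^bold>\<cdot> s\<smile> = \<zero>" "r \<in> carrier A" "s \<in> carrier A" for r s
  proof -
    have "(r \<^bold>\<cdot> s)\<smile> \<^bold>\<le> r\<smile> \<^bold>\<cdot> s\<smile>"
      using that(2,3)
      by (intro meet_greatest conv_mono meet_lower1 meet_lower2 meet_closed conv_closed)
    then have "(r \<^bold>\<cdot> s)\<smile> = \<zero>" using that by (simp add: closed le_zero)
    then show ?thesis using that by (simp add: closed conv_eq_zero)
  qed
  show ?thesis using *[of r s] *[of "r\<smile>" "s\<smile>"] assms by (auto simp: closed conv_conv)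
qed

lemma conv_ident: "(rident A)\<smile> = rident A"
  by (metis comp_ident conv_closed conv_comp conv_conv ident_closed)

lemma ident_comp: "r \<in> carrier A \<Longrightarrow> rident A \<Zsemi> r = r"
  by (metis comp_ident conv_closed conv_comp conv_conv conv_ident ident_closed)

lemma conv_le_swap:
  assumes "r \<in> carrier A" "s \<in> carrier A"
  shows "r\<smile> \<^bold>\<le> s \<longleftrightarrow> r \<^bold>\<le> s\<smile>"
  by (metis assms conv_closed conv_conv conv_le_iff)

text \<open>One direction is the axiom \<open>conv_comp_compl\<close> read through complements; the other is the same
  statement for the converse of \<open>r\<close>. Together with its mirror image this is the only form in
  which the axiom is used: whether a product meets an element can be decided at any of the three
  sides of the triangle.\<close>

lemma cycle_law:
  assumes "r \<in> carrier A" "s \<in> carrier A" "t \<in> carrier A"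
  shows "(r \<Zsemi> s) \<^bold>\<cdot> t = \<zero> \<longleftrightarrow> (r\<smile> \<Zsemi> t) \<^bold>\<cdot> s = \<zero>"
proof -
  have *: "(r\<smile> \<Zsemi> t) \<^bold>\<cdot> s = \<zero>" if "(r \<Zsemi> s) \<^bold>\<cdot> t = \<zero>"
    "r \<in> carrier A" "s \<in> carrier A" "t \<in> carrier A" for r s t
  proof -
    have "t \<^bold>\<le> \<^bold>- (r \<Zsemi> s)"
      using that by (metis closed(6) meet_commute meet_zero_iff)
    then have "r\<smile> \<Zsemi> t \<^bold>\<le> r\<smile> \<Zsemi> \<^bold>- (r \<Zsemi> s)"
      using that by (simp add: closed comp_mono_right)
    then have "r\<smile> \<Zsemi> t \<^bold>\<le> \<^bold>- s"
      using that conv_comp_compl[of r s] by (meson closed le_trans)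
    then show ?thesis using that by (simp add: closed meet_zero_iff)
  qed
  show ?thesis using *[of r s t] *[of "r\<smile>" t s] assms by (auto simp: closed conv_conv)
qed

lemma cycle_law':
  assumes "r \<in> carrier A" "s \<in> carrier A" "t \<in> carrier A"
  shows "(r \<Zsemi> s) \<^bold>\<cdot> t = \<zero> \<longleftrightarrow> (t \<Zsemi> s\<smile>) \<^bold>\<cdot> r = \<zero>"
proof -
  have "(r \<Zsemi> s) \<^bold>\<cdot> t = \<zero> \<longleftrightarrow> (s\<smile> \<Zsemi> r\<smile>) \<^bold>\<cdot> t\<smile> = \<zero>"
    using assms by (metis closed(6) conv_comp conv_meet_zero)
  also have "\<dots> \<longleftrightarrow> (s \<Zsemi> t\<smile>) \<^bold>\<cdot> r\<smile> = \<zero>"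
    using assms cycle_law[of "s\<smile>" "r\<smile>" "t\<smile>"] by (simp add: closed conv_conv)
  also have "\<dots> \<longleftrightarrow> (t \<Zsemi> s\<smile>) \<^bold>\<cdot> r = \<zero>"
    using assms by (metis closed(6,7) conv_comp conv_conv conv_meet_zero)
  finally show ?thesis .
qed

lemma comp_zero_iff:
  assumes "r \<in> carrier A" "s \<in> carrier A"
  shows "r \<Zsemi> s = \<zero> \<longleftrightarrow> (r\<smile> \<Zsemi> \<U>) \<^bold>\<cdot> s = \<zero>"
proof -
  have "(r \<Zsemi> s) \<^bold>\<cdot> \<U> = r \<Zsemi> s"
    using assms by (simp add: closed le_antisym le_refl le_unit meet_greatest meet_lower1)
  then show ?thesis using cycle_law[of r s \<U>] assms closed by simp
qed

lemma atom_closed: "ra_atom A x \<Longrightarrow> x \<in> carrier A"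
  by (simp add: ra_atom_def)

lemma atom_nonzero: "ra_atom A x \<Longrightarrow> x \<noteq> \<zero>"
  by (simp add: ra_atom_def)

lemma atom_le_cases:
  assumes "ra_atom A x" "r \<in> carrier A"
  shows "x \<^bold>\<cdot> r = \<zero> \<or> x \<^bold>\<le> r"
  using assms unfolding ra_atom_def by (metis closed(3) meet_lower1 meet_lower2)

lemma atom_le_iff:
  assumes "ra_atom A x" "r \<in> carrier A"
  shows "x \<^bold>\<le> r \<longleftrightarrow> x \<^bold>\<cdot> r \<noteq> \<zero>"
  using atom_le_cases[OF assms] assms atom_closed atom_nonzero
  by (metis le_refl le_zero meet_greatest)

lemma atom_le_iff': "\<lbrakk>ra_atom A x; r \<in> carrier A\<rbrakk> \<Longrightarrow> x \<^bold>\<le> r \<longleftrightarrow> r \<^bold>\<cdot> x \<noteq> \<zero>"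
  using atom_le_iff atom_closed meet_commute by metis

lemma atom_le_atom: "\<lbrakk>ra_atom A x; ra_atom A y; x \<^bold>\<le> y\<rbrakk> \<Longrightarrow> x = y"
  by (metis ra_atom_def)

lemma atom_le_compl: "\<lbrakk>ra_atom A x; r \<in> carrier A\<rbrakk> \<Longrightarrow> x \<^bold>\<le> \<^bold>- r \<longleftrightarrow> \<not> x \<^bold>\<le> r"
  using atom_le_iff meet_zero_iff atom_closed by metis

lemma atom_le_sum:
  assumes "ra_atom A x" "r \<in> carrier A" "s \<in> carrier A"
  shows "x \<^bold>\<le> r \<^bold>+ s \<longleftrightarrow> x \<^bold>\<le> r \<or> x \<^bold>\<le> s"
proof
  assume *: "x \<^bold>\<le> r \<^bold>+ s"
  show "x \<^bold>\<le> r \<or> x \<^bold>\<le> s"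
  proof (rule ccontr)
    assume "\<not> (x \<^bold>\<le> r \<or> x \<^bold>\<le> s)"
    then have "x \<^bold>\<cdot> (r \<^bold>+ s) = \<zero>"
      using assms by (simp add: atom_closed atom_le_iff distrib zero_sum closed)
    then show False using * assms by (simp add: atom_le_iff closed)
  qed
next
  assume "x \<^bold>\<le> r \<or> x \<^bold>\<le> s"
  then show "x \<^bold>\<le> r \<^bold>+ s"
    using assms by (meson atom_closed closed(1) le_trans sum_upper1 sum_upper2)
qed

lemma atom_le_is_sum:
  assumes "ra_atom A x" "is_sum A X s" "X \<subseteq> carrier A"
  shows "x \<^bold>\<le> s \<longleftrightarrow> (\<exists>r\<in>X. x \<^bold>\<le> r)"
proof
  assume *: "x \<^bold>\<le> s"
  show "\<exists>r\<in>X. x \<^bold>\<le> r"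
  proof (rule ccontr)
    assume "\<not> (\<exists>r\<in>X. x \<^bold>\<le> r)"
    then have "\<forall>r\<in>X. r \<^bold>\<le> \<^bold>- x"
      using assms by (metis atom_closed atom_le_iff' meet_zero_iff subsetD)
    then have "s \<^bold>\<le> \<^bold>- x"
      using assms by (simp add: is_sum_def atom_closed compl_closed)
    then have "s \<^bold>\<cdot> x = \<zero>"
      using assms by (simp add: is_sum_def atom_closed meet_zero_iff)
    then show False using * assms by (simp add: is_sum_def atom_le_iff')
  qed
next
  assume "\<exists>r\<in>X. x \<^bold>\<le> r"
  then show "x \<^bold>\<le> s"
    using assms by (meson atom_closed is_sum_def le_trans subsetD)
qed

lemma is_sum_meets:
  assumes "is_sum A X s" "X \<subseteq> carrier A" "r \<in> carrier A" "r \<^bold>\<cdot> s \<noteq> \<zero>"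
  shows "\<exists>t\<in>X. r \<^bold>\<cdot> t \<noteq> \<zero>"
proof (rule ccontr)
  assume "\<not> ?thesis"
  then have "\<forall>t\<in>X. t \<^bold>\<le> \<^bold>- r"
    using assms by (metis meet_commute meet_zero_iff subsetD)
  then have "s \<^bold>\<le> \<^bold>- r" using assms by (simp add: is_sum_def compl_closed)
  then have "r \<^bold>\<cdot> s = \<zero>" using assms by (metis is_sum_def meet_commute meet_zero_iff)
  then show False using assms by simp
qed

lemma conv_atom: "ra_atom A x \<Longrightarrow> ra_atom A (x\<smile>)"
  unfolding ra_atom_def
  by (metis conv_le_swap conv_closed conv_conv conv_eq_zero)

lemma atom_comp_cycle:
  assumes "ra_atom A a" "ra_atom A b" "ra_atom A c"
  shows "c \<^bold>\<le> a \<Zsemi> b \<longleftrightarrow> b \<^bold>\<le> a\<smile> \<Zsemi> c"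
  using assms cycle_law[of a b c] by (simp add: atom_le_iff' atom_closed closed)

lemma atom_comp_cycle':
  assumes "ra_atom A a" "ra_atom A b" "ra_atom A c"
  shows "c \<^bold>\<le> a \<Zsemi> b \<longleftrightarrow> a \<^bold>\<le> c \<Zsemi> b\<smile>"
  using assms cycle_law'[of a b c] by (simp add: atom_le_iff' atom_closed closed)

end

section \<open>Atomicity\<close>

context relation_algebra
begin

lemma subid_atomD: "subidentity_atom A x \<Longrightarrow> ra_atom A x \<and> x \<in> carrier A \<and> x \<^bold>\<le> rident A"
  by (simp add: subidentity_atom_def ra_atom_def)

text \<open>By the cycle law \<open>x\<smile>;x\<close> is not zero, and it lies below both of the atoms \<open>x\<close> and \<open>x\<smile>\<close>.\<close>

lemma subid_atom_idem:
  assumes "subidentity_atom A x"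
  shows "x \<Zsemi> x = x" "x\<smile> = x"
proof -
  have x: "ra_atom A x" "x \<in> carrier A" "x \<^bold>\<le> rident A" using subid_atomD assms by auto
  have "(x \<Zsemi> rident A) \<^bold>\<cdot> x \<noteq> \<zero>"
    using x by (metis comp_ident atom_le_iff le_refl)
  then have "(x\<smile> \<Zsemi> x) \<^bold>\<cdot> rident A \<noteq> \<zero>"
    using x by (simp add: cycle_law ident_closed)
  then have nz: "x\<smile> \<Zsemi> x \<noteq> \<zero>"
    by (metis ident_closed le_zero meet_lower1 closed(3) zero_closed)
  have 1: "x\<smile> \<Zsemi> x \<^bold>\<le> x"
    using comp_mono_left[of "x\<smile>" "rident A" x] x
    by (metis conv_mono conv_ident ident_closed ident_comp conv_closed)
  have 2: "x\<smile> \<Zsemi> x \<^bold>\<le> x\<smile>"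
    using comp_mono_right[of x "rident A" "x\<smile>"] x
    by (simp add: closed comp_ident)
  have e1: "x\<smile> \<Zsemi> x = x" using 1 nz x unfolding ra_atom_def by (metis closed(6,7))
  have "x\<smile> \<Zsemi> x = x\<smile>"
    using 2 nz conv_atom[OF x(1)] x unfolding ra_atom_def by (metis closed(6,7))
  with e1 show "x\<smile> = x" by simp
  with e1 show "x \<Zsemi> x = x" by simp
qed

lemma le_square_sides:
  assumes "subidentity_atom A x" "subidentity_atom A y" "r \<in> carrier A"
    "r \<^bold>\<le> x \<Zsemi> \<U> \<Zsemi> y"
  shows "r \<^bold>\<le> x \<Zsemi> \<U>" "r \<^bold>\<le> \<U> \<Zsemi> y"
proof -
  have x: "x \<in> carrier A" "y \<in> carrier A" using assms subid_atomD by auto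
  have "x \<Zsemi> \<U> \<Zsemi> y = x \<Zsemi> (\<U> \<Zsemi> y)" using x by (simp add: comp_assoc closed)
  also have "\<dots> \<^bold>\<le> x \<Zsemi> \<U>" using x by (simp add: closed comp_mono_right le_unit)
  finally show "r \<^bold>\<le> x \<Zsemi> \<U>" using assms(3,4) x by (meson closed le_trans)
  have "x \<Zsemi> \<U> \<Zsemi> y \<^bold>\<le> \<U> \<Zsemi> y" using x by (simp add: closed comp_mono_left le_unit)
  then show "r \<^bold>\<le> \<U> \<Zsemi> y" using assms(3,4) x by (meson closed le_trans)
qed

text \<open>The part of \<open>r\<close> outside \<open>x;r\<close> is annihilated by \<open>x\<close>, which is impossible for a non-zero element
  below \<open>x;1\<close>. The statement about \<open>y\<close> is the converse of this.\<close>

lemma square_leI: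
  assumes "subidentity_atom A x" "subidentity_atom A y" "r \<in> carrier A"
    "r \<^bold>\<le> x \<Zsemi> \<U>" "r \<^bold>\<le> \<U> \<Zsemi> y"
  shows "x \<Zsemi> r = r" "r \<Zsemi> y = r" "r \<^bold>\<le> x \<Zsemi> \<U> \<Zsemi> y"
proof -
  have *: "x \<Zsemi> r = r" if "subidentity_atom A x" "r \<in> carrier A" "r \<^bold>\<le> x \<Zsemi> \<U>" for x r
  proof (rule le_antisym)
    have x: "x \<in> carrier A" "x \<^bold>\<le> rident A" using that subid_atomD by auto
    note xx = subid_atom_idem[OF that(1)]
    show "x \<Zsemi> r \<^bold>\<le> r" using comp_mono_left[OF x(2), of r] x that
      by (simp add: ident_closed ident_comp)
    let ?d = "r \<^bold>\<cdot> \<^bold>- (x \<Zsemi> r)"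
    have d: "?d \<in> carrier A" "?d \<^bold>\<le> r" "?d \<^bold>\<le> \<^bold>- (x \<Zsemi> r)"
      using that x by (auto simp: closed meet_lower1 meet_lower2)
    have "(x \<Zsemi> r) \<^bold>\<cdot> ?d = \<zero>"
      using that x d by (metis closed(6) meet_commute meet_zero_iff)
    then have 1: "(x \<Zsemi> ?d) \<^bold>\<cdot> r = \<zero>" using that x d xx by (simp add: cycle_law[of x r])
    have "x \<Zsemi> ?d \<^bold>\<le> r"
      using that x d by (metis \<open>x \<Zsemi> r \<^bold>\<le> r\<close> closed(6) comp_mono_right le_trans)
    then have "x \<Zsemi> ?d = \<zero>"
      using 1 that x d by (metis closed(6) le_antisym le_refl meet_greatest meet_lower1 closed(3))
    then have "(x \<Zsemi> \<U>) \<^bold>\<cdot> ?d = \<zero>" using x d xx by (simp add: comp_zero_iff)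
    moreover have "?d \<^bold>\<le> x \<Zsemi> \<U>" using d that x by (meson closed le_trans)
    ultimately have "?d = \<zero>"
      using x d by (metis closed(6) le_refl le_zero meet_greatest closed(4))
    then show "r \<^bold>\<le> x \<Zsemi> r" using that x by (metis closed(6) not_le_iff)
  qed (use that subid_atomD closed in auto)
  have c: "x \<in> carrier A" "y \<in> carrier A" using assms subid_atomD by auto
  show 1: "x \<Zsemi> r = r" using * assms by blast
  have "r\<smile> \<^bold>\<le> y \<Zsemi> \<U>"
    using conv_mono[OF assms(5)] assms c subid_atom_idem[OF assms(2)]
    by (simp add: closed conv_comp conv_unit)
  then have "y \<Zsemi> r\<smile> = r\<smile>" using *[OF assms(2)] assms(3) by (simp add: closed)
  then show 2: "r \<Zsemi> y = r"
    using assms c subid_atom_idem[OF assms(2)] by (metis conv_closed conv_comp conv_conv)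
  have "x \<Zsemi> r \<Zsemi> y \<^bold>\<le> x \<Zsemi> \<U> \<Zsemi> y"
    using assms c by (simp add: closed comp_mono le_unit le_refl)
  then show "r \<^bold>\<le> x \<Zsemi> \<U> \<Zsemi> y" by (simp add: 1 2)
qed

lemma atom_le_unit_side:
  assumes "subidentity_atom A x" "r \<in> carrier A" "r \<noteq> \<zero>"
  shows "r \<^bold>\<le> x \<Zsemi> \<U> \<Longrightarrow> x \<^bold>\<le> r \<Zsemi> \<U>" "r \<^bold>\<le> \<U> \<Zsemi> x \<Longrightarrow> x \<^bold>\<le> \<U> \<Zsemi> r"
proof -
  have x: "ra_atom A x" "x \<in> carrier A" using assms subid_atomD by auto
  { assume "r \<^bold>\<le> x \<Zsemi> \<U>"
    then have "(x \<Zsemi> \<U>) \<^bold>\<cdot> r \<noteq> \<zero>"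
      using assms x by (metis closed(6) closed(4) le_refl le_zero meet_greatest)
    then have "(r \<Zsemi> \<U>) \<^bold>\<cdot> x \<noteq> \<zero>"
      using assms x closed cycle_law'[of x \<U> r] by (simp add: conv_unit)
    then show "x \<^bold>\<le> r \<Zsemi> \<U>" using assms x by (simp add: closed atom_le_iff') }
  { assume "r \<^bold>\<le> \<U> \<Zsemi> x"
    then have "(\<U> \<Zsemi> x) \<^bold>\<cdot> r \<noteq> \<zero>"
      using assms x by (metis closed(6) closed(4) le_refl le_zero meet_greatest)
    then have "(\<U> \<Zsemi> r) \<^bold>\<cdot> x \<noteq> \<zero>"
      using assms x closed cycle_law[of \<U> x r] by (simp add: conv_unit)
    then show "x \<^bold>\<le> \<U> \<Zsemi> r" using assms x by (simp add: closed atom_le_iff') }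
qed

text \<open>Two disjoint non-zero parts \<open>g\<close> and \<open>h\<close> of \<open>f\<close> have the same domain \<open>x\<close>, so \<open>g\<smile>;h\<close> is not zero.
  Since \<open>f\<close> is functional, \<open>g\<smile>;h\<close> lies below the identity, which makes \<open>g\<close> and \<open>h\<close> meet.\<close>

lemma functional_in_square_atom:
  assumes x: "subidentity_atom A x"
    and f: "functional A f" "f \<noteq> \<zero>" "f \<^bold>\<le> x \<Zsemi> \<U> \<Zsemi> x"
  shows "ra_atom A f"
  unfolding ra_atom_def
proof (intro conjI ballI impI)
  show fc: "f \<in> carrier A" using f by (simp add: functional_def)
  have xc: "x \<in> carrier A" using x subid_atomD by auto
  fix g assume g: "g \<in> carrier A" "g \<^bold>\<le> f"
  show "g = \<zero> \<or> g = f"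
  proof (rule ccontr)
    assume n: "\<not> (g = \<zero> \<or> g = f)"
    define h where "h = f \<^bold>\<cdot> \<^bold>- g"
    have h: "h \<in> carrier A" "h \<^bold>\<le> f" "h \<^bold>\<le> \<^bold>- g"
      using g fc by (auto simp: h_def closed meet_lower1 meet_lower2)
    have hn: "h \<noteq> \<zero>" using n g fc h_def by (metis le_antisym not_le_iff)
    have side: "f \<^bold>\<le> x \<Zsemi> \<U>" using le_square_sides[OF x x fc f(3)] by blast
    have "h \<^bold>\<le> x \<Zsemi> \<U>" "g \<^bold>\<le> x \<Zsemi> \<U>"
      using g h side fc xc by (meson closed le_trans)+
    then have "x \<^bold>\<le> g \<Zsemi> \<U>" using atom_le_unit_side(1)[OF x g(1)] n by simp
    then have "x \<Zsemi> \<U> \<^bold>\<le> g \<Zsemi> \<U> \<Zsemi> \<U>" using xc g by (simp add: closed comp_mono_left)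
    also have "\<dots> = g \<Zsemi> (\<U> \<Zsemi> \<U>)" using g by (simp add: closed comp_assoc)
    finally have "x \<Zsemi> \<U> \<^bold>\<le> g \<Zsemi> (\<U> \<Zsemi> \<U>)" .
    moreover have "g \<Zsemi> (\<U> \<Zsemi> \<U>) \<^bold>\<le> g \<Zsemi> \<U>" using g by (simp add: closed comp_mono_right le_unit)
    ultimately have "x \<Zsemi> \<U> \<^bold>\<le> g \<Zsemi> \<U>" using xc g by (meson closed le_trans)
    then have "h \<^bold>\<le> g \<Zsemi> \<U>" using \<open>h \<^bold>\<le> x \<Zsemi> \<U>\<close> h g xc by (meson closed le_trans)
    then have "(g \<Zsemi> \<U>) \<^bold>\<cdot> h \<noteq> \<zero>"
      using h g hn by (metis closed(6) closed(4) le_refl le_zero meet_greatest)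
    then have nz: "(g\<smile> \<Zsemi> h) \<^bold>\<cdot> \<U> \<noteq> \<zero>" using g h closed by (simp add: cycle_law)
    have "g\<smile> \<Zsemi> h \<^bold>\<le> f\<smile> \<Zsemi> f" using g h fc by (simp add: closed comp_mono conv_mono)
    then have le: "g\<smile> \<Zsemi> h \<^bold>\<le> rident A"
      using f(1) g h fc unfolding functional_def by (meson closed le_trans)
    have "(g\<smile> \<Zsemi> h) \<^bold>\<cdot> rident A \<noteq> \<zero>"
      using nz le g h by (metis closed(3,4,6,7) ident_closed le_refl le_zero meet_greatest meet_lower1)
    then have "(g \<Zsemi> rident A) \<^bold>\<cdot> h \<noteq> \<zero>" using g h by (simp add: cycle_law ident_closed)
    then have "h \<^bold>\<cdot> g \<noteq> \<zero>" using g h by (simp add: comp_ident meet_commute)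
    then show False using h g by (simp add: meet_zero_iff)
  qed
qed (use f in auto)

definition atoms_between :: "'a \<Rightarrow> 'a \<Rightarrow> 'a set" where
  "atoms_between x y = {a. ra_atom A a \<and> a \<^bold>\<le> x \<Zsemi> \<U> \<Zsemi> y}"

lemma measurable_atom_subid: "measurable_atom A x \<Longrightarrow> subidentity_atom A x"
  by (simp add: measurable_atom_def)

lemma measurable_square_meets:
  assumes "measurable_atom A x" "r \<in> carrier A" "r \<noteq> \<zero>" "r \<^bold>\<le> x \<Zsemi> \<U> \<Zsemi> x"
  shows "\<exists>f\<in>atoms_between x x. functional A f \<and> f \<^bold>\<le> r"
proof -
  have x: "subidentity_atom A x" "x \<in> carrier A"
    using assms subid_atomD measurable_atom_subid by auto
  obtain F where F: "\<forall>f\<in>F. functional A f" "is_sum A F (x \<Zsemi> \<U> \<Zsemi> x)"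
    using assms unfolding measurable_atom_def by auto
  have Fc: "F \<subseteq> carrier A" using F by (auto simp: functional_def)
  have "r \<^bold>\<cdot> (x \<Zsemi> \<U> \<Zsemi> x) \<noteq> \<zero>"
    using assms x by (metis closed(6) closed(4) le_refl le_zero meet_greatest)
  then obtain f where f: "f \<in> F" "r \<^bold>\<cdot> f \<noteq> \<zero>"
    using is_sum_meets[OF F(2) Fc assms(2)] by blast
  have "f \<noteq> \<zero>" using f assms Fc by (metis closed(3) le_zero meet_lower2 subsetD)
  have at: "ra_atom A f"
    using functional_in_square_atom[OF x(1), of f] F f \<open>f \<noteq> \<zero>\<close> by (auto simp: is_sum_def)
  then have "f \<^bold>\<le> r" using f assms by (simp add: atom_le_iff')
  then show ?thesis using F f at by (auto simp: atoms_between_def is_sum_def)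
qed

text \<open>An atom below \<open>x;1;x\<close> meets one of the functional elements that sum up to \<open>x;1;x\<close>; as both are
  atoms, they are equal.\<close>

lemma square_atom_functional:
  assumes "measurable_atom A x"
  shows "atoms_between x x = carrier (atom_group A x)"
proof -
  have x: "subidentity_atom A x" using assms measurable_atom_subid by auto
  show ?thesis
  proof (intro subset_antisym subsetI)
    fix f assume f: "f \<in> atoms_between x x"
    then have "ra_atom A f" "f \<^bold>\<le> x \<Zsemi> \<U> \<Zsemi> x" by (auto simp: atoms_between_def)
    moreover obtain g where "g \<in> atoms_between x x" "functional A g" "g \<^bold>\<le> f"
      using measurable_square_meets[OF assms, of f] calculation
      by (auto simp: atom_closed atom_nonzero)
    then have "g = f" using calculation atom_le_atom by (auto simp: atoms_between_def)
    ultimately show "f \<in> carrier (atom_group A x)"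
      using \<open>functional A g\<close> atom_nonzero by (auto simp: atom_group_def)
  next
    fix f assume "f \<in> carrier (atom_group A x)"
    then show "f \<in> atoms_between x x"
      using functional_in_square_atom[OF x] by (auto simp: atoms_between_def atom_group_def)
  qed
qed

lemma conv_hom:
  assumes "subidentity_atom A x" "subidentity_atom A y" "a \<in> atoms_between x y"
  shows "a\<smile> \<in> atoms_between y x"
proof -
  have c: "x \<in> carrier A" "y \<in> carrier A" using assms subid_atomD by auto
  have "a\<smile> \<^bold>\<le> (x \<Zsemi> \<U> \<Zsemi> y)\<smile>"
    using assms c by (simp add: atoms_between_def atom_closed closed conv_mono)
  also have "(x \<Zsemi> \<U> \<Zsemi> y)\<smile> = y \<Zsemi> \<U> \<Zsemi> x"
    using c subid_atom_idem[OF assms(1)] subid_atom_idem[OF assms(2)]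
    by (simp add: closed conv_comp conv_unit comp_assoc)
  finally show ?thesis using assms by (simp add: atoms_between_def conv_atom)
qed

text \<open>An atom is found by minimizing the number of group elements below \<open>a;a\<smile>\<close>. For a minimal \<open>a\<close>
  every non-zero part has the same set of such group elements, and a proper decomposition of \<open>a\<close>
  produces a part for which this fails.\<close>

lemma rectangle_atomic:
  assumes x: "measurable_atom A x" and y: "subidentity_atom A y"
    and fin: "finite (atoms_between x x)"
    and b: "b \<in> carrier A" "b \<noteq> \<zero>" "b \<^bold>\<le> x \<Zsemi> \<U> \<Zsemi> y"
  shows "\<exists>a. ra_atom A a \<and> a \<^bold>\<le> b"
proof -
  have sx: "subidentity_atom A x" using x measurable_atom_subid by auto
  have cc: "x \<in> carrier A" "y \<in> carrier A" using sx y subid_atomD by auto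
  \<comment> \<open>For an atom \<open>a\<close> this is the stabilizer of \<open>a\<close> in the group of \<open>x\<close>.\<close>
  define S where "S a = {f \<in> atoms_between x x. f \<^bold>\<le> a \<Zsemi> a\<smile>}" for a
  have Sfin: "finite (S a)" for a using fin by (simp add: S_def)
  have Smono: "S c \<subseteq> S a" if "c \<^bold>\<le> a" "c \<in> carrier A" "a \<in> carrier A" for a c
    using that unfolding S_def atoms_between_def
    by (auto intro: le_trans[OF _ comp_mono] simp: closed conv_mono atom_closed)
  obtain a where a: "a \<in> carrier A" "a \<noteq> \<zero>" "a \<^bold>\<le> b"
    and amin: "\<And>c. \<lbrakk>c \<in> carrier A; c \<noteq> \<zero>; c \<^bold>\<le> b\<rbrakk> \<Longrightarrow> card (S a) \<le> card (S c)"
    using ex_has_least_nat[of "\<lambda>c. c \<in> carrier A \<and> c \<noteq> \<zero> \<and> c \<^bold>\<le> b" b "\<lambda>c. card (S c)"]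
      b le_refl by blast
  have Seq: "S c = S a" if "c \<in> carrier A" "c \<noteq> \<zero>" "c \<^bold>\<le> a" for c
  proof -
    have "c \<^bold>\<le> b" using that a b by (meson le_trans)
    then have "card (S a) \<le> card (S c)" using that amin by blast
    then show ?thesis using Smono[OF that(3,1) a(1)] Sfin[of a] card_seteq by blast
  qed
  have side: "r \<^bold>\<le> x \<Zsemi> \<U>" "r \<^bold>\<le> \<U> \<Zsemi> y" if "r \<in> carrier A" "r \<^bold>\<le> a" for r
  proof -
    have "r \<^bold>\<le> x \<Zsemi> \<U> \<Zsemi> y" using that a b cc by (meson closed le_trans)
    then show "r \<^bold>\<le> x \<Zsemi> \<U>" "r \<^bold>\<le> \<U> \<Zsemi> y" using le_square_sides[OF sx y that(1)] by auto
  qed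
  have "ra_atom A a" unfolding ra_atom_def
  proof (intro conjI ballI impI)
    fix c assume c: "c \<in> carrier A" "c \<^bold>\<le> a"
    show "c = \<zero> \<or> c = a"
    proof (rule ccontr)
      assume n: "\<not> (c = \<zero> \<or> c = a)"
      define d where "d = a \<^bold>\<cdot> \<^bold>- c"
      have d: "d \<in> carrier A" "d \<^bold>\<le> a" "d \<^bold>\<le> \<^bold>- c"
        using c a by (auto simp: d_def closed meet_lower1 meet_lower2)
      have dn: "d \<noteq> \<zero>" using n c a d_def by (metis le_antisym not_le_iff)
      have dc: "d \<^bold>\<cdot> c = \<zero>" using c d by (simp add: meet_zero_iff)
      note sc = side[OF c] and sd = side[OF d(1,2)]
      have "y \<^bold>\<le> \<U> \<Zsemi> d" using atom_le_unit_side(2)[OF y d(1) dn sd(2)] .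
      then have "\<U> \<Zsemi> y \<^bold>\<le> \<U> \<Zsemi> (\<U> \<Zsemi> d)" using cc d by (simp add: closed comp_mono_right)
      also have "\<dots> = (\<U> \<Zsemi> \<U>) \<Zsemi> d" using d by (simp add: closed comp_assoc)
      finally have "\<U> \<Zsemi> y \<^bold>\<le> (\<U> \<Zsemi> \<U>) \<Zsemi> d" .
      moreover have "(\<U> \<Zsemi> \<U>) \<Zsemi> d \<^bold>\<le> \<U> \<Zsemi> d" using d by (simp add: closed comp_mono_left le_unit)
      ultimately have "c \<^bold>\<le> \<U> \<Zsemi> d" using sc cc d c by (meson closed le_trans)
      then have "(\<U> \<Zsemi> d) \<^bold>\<cdot> c \<noteq> \<zero>"
        using c d n by (metis closed(6) closed(4) le_refl le_zero meet_greatest)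
      then have "(c \<Zsemi> d\<smile>) \<^bold>\<cdot> \<U> \<noteq> \<zero>" using c d closed by (simp add: cycle_law')
      then have nz: "c \<Zsemi> d\<smile> \<noteq> \<zero>" by (metis closed(3,4) le_zero meet_lower1 zero_closed)
      have xx: "c \<Zsemi> d\<smile> \<^bold>\<le> x \<Zsemi> \<U> \<Zsemi> x"
      proof -
        have "c \<Zsemi> d\<smile> = x \<Zsemi> (c \<Zsemi> d\<smile>) \<Zsemi> x"
          using square_leI(1)[OF sx y c(1) sc] square_leI(2)[OF sx y d(1) sd] 
            square_leI(1)[OF sx y d(1) sd] c d cc subid_atom_idem[OF sx]
          by (metis closed(6,7) comp_assoc conv_comp)
        also have "\<dots> \<^bold>\<le> x \<Zsemi> \<U> \<Zsemi> x"
          using c d cc by (simp add: closed comp_mono_left comp_mono_right le_unit)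
        finally show ?thesis .
      qed
      obtain f where f: "f \<in> atoms_between x x" "f \<^bold>\<le> c \<Zsemi> d\<smile>"
        using measurable_square_meets[OF x _ nz xx] c d by (auto simp: comp_closed conv_closed)
      then have fa: "ra_atom A f" "f \<in> carrier A" by (auto simp: atoms_between_def atom_closed)
      have "f \<^bold>\<le> a \<Zsemi> a\<smile>"
        using f c d a fa by (meson closed comp_mono conv_mono le_trans)
      then have "f\<smile> \<^bold>\<le> (a \<Zsemi> a\<smile>)\<smile>" using a fa by (intro conv_mono) (simp_all add: closed)
      then have "f\<smile> \<^bold>\<le> a \<Zsemi> a\<smile>" using a by (simp add: closed conv_comp conv_conv)
      then have fS: "f\<smile> \<in> S a"
        using conv_hom[OF sx sx f(1)] by (simp add: S_def)
      have "(c \<Zsemi> d\<smile>) \<^bold>\<cdot> f \<noteq> \<zero>" using f fa c d by (simp add: closed atom_le_iff')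
      then have nz1: "(f \<Zsemi> d) \<^bold>\<cdot> c \<noteq> \<zero>"
        using cycle_law'[of c "d\<smile>" f] c d fa by (simp add: closed conv_conv)
      \<comment> \<open>The part \<open>e\<close> of \<open>c\<close> is moved into \<open>d\<close> by \<open>f\<smile>\<close>, although \<open>f\<smile>\<close> lies below \<open>e;e\<smile>\<close> by minimality.\<close>
      define e where "e = (f \<Zsemi> d) \<^bold>\<cdot> c"
      have e: "e \<in> carrier A" "e \<noteq> \<zero>" "e \<^bold>\<le> f \<Zsemi> d" "e \<^bold>\<le> c"
        using nz1 c d fa by (auto simp: e_def closed meet_lower1 meet_lower2)
      then have "e \<^bold>\<le> a" using c a by (meson le_trans)
      then have "f\<smile> \<in> S e" using Seq[of e] e fS by simp
      then have "(e \<Zsemi> e\<smile>) \<^bold>\<cdot> f\<smile> \<noteq> \<zero>"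
        using e fa conv_atom by (simp add: S_def closed atom_le_iff')
      then have nz2: "(f\<smile> \<Zsemi> e) \<^bold>\<cdot> e \<noteq> \<zero>"
        using cycle_law'[of e "e\<smile>" "f\<smile>"] e fa by (simp add: closed conv_conv)
      have "functional A f" using f(1) square_atom_functional[OF x] by (auto simp: atom_group_def)
      then have "f\<smile> \<Zsemi> f \<Zsemi> d \<^bold>\<le> rident A \<Zsemi> d"
        using d fa by (simp add: functional_def closed comp_mono_left)
      moreover have "f\<smile> \<Zsemi> e \<^bold>\<le> f\<smile> \<Zsemi> f \<Zsemi> d"
        using comp_mono_right[OF e(3), of "f\<smile>"] e fa d by (simp add: closed comp_assoc)
      ultimately have "f\<smile> \<Zsemi> e \<^bold>\<le> d"
        using d e fa by (simp add: ident_comp) (meson closed le_trans)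
      then have "(f\<smile> \<Zsemi> e) \<^bold>\<cdot> e = \<zero>"
        using e fa d c by (intro meet_mono_zero[OF _ e(4) dc]) (simp_all add: closed)
      then show False using nz2 by simp
    qed
  qed (use a in auto)
  then show ?thesis using a by blast
qed

end

text \<open>As the identity is a sum of measurable atoms, \<open>b\<close> cannot be annihilated by all of them on the
  right, nor can the product be annihilated by all of them on the left. So \<open>b\<close> contains a non-zero
  element of some rectangle.\<close>

lemma measurable_atomic:
  fixes A (structure)
  assumes "measurable_ra A"
    and fin: "\<And>x. measurable_atom A x \<Longrightarrow> finite (carrier (atom_group A x))"
    and b: "b \<in> carrier A" "b \<noteq> rzero A"
  shows "\<exists>x y a. measurable_atom A x \<and> measurable_atom A y \<and> a \<in> relation_algebra.atoms_between A x y \<and> a \<^bold>\<le> b"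
proof -
  interpret relation_algebra A using assms by (simp add: measurable_ra_def)
  obtain M where M: "\<forall>x\<in>M. measurable_atom A x" "is_sum A M (rident A)"
    using assms by (auto simp: measurable_ra_def)
  have Mc: "M \<subseteq> carrier A" using M measurable_atom_subid subid_atomD by blast
  have right: "\<exists>y\<in>M. r \<Zsemi> y \<noteq> \<zero>" if r: "r \<in> carrier A" "r \<noteq> \<zero>" for r
  proof -
    have "(r \<Zsemi> rident A) \<^bold>\<cdot> r \<noteq> \<zero>" using r by (metis comp_ident le_refl le_zero meet_greatest)
    then have "(r\<smile> \<Zsemi> r) \<^bold>\<cdot> rident A \<noteq> \<zero>" using r by (simp add: cycle_law ident_closed)
    then obtain y where y: "y \<in> M" "(r\<smile> \<Zsemi> r) \<^bold>\<cdot> y \<noteq> \<zero>"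
      using is_sum_meets[OF M(2) Mc, of "r\<smile> \<Zsemi> r"] r by (auto simp: comp_closed conv_closed)
    then have "(r \<Zsemi> y) \<^bold>\<cdot> r \<noteq> \<zero>" using r Mc by (simp add: cycle_law[of r y r] subsetD)
    then show ?thesis using y r Mc by (metis meet_lower1 le_zero closed(3) zero_closed)
  qed
  obtain y where y: "y \<in> M" "b \<Zsemi> y \<noteq> \<zero>" using right b by blast
  have yc: "y \<in> carrier A" "subidentity_atom A y" "y \<^bold>\<le> rident A"
    using y M measurable_atom_subid subid_atomD by auto
  have "(b \<Zsemi> y)\<smile> \<noteq> \<zero>" using y b yc by (simp add: closed conv_eq_zero)
  then obtain x where x: "x \<in> M" "(b \<Zsemi> y)\<smile> \<Zsemi> x \<noteq> \<zero>" using right[of "(b \<Zsemi> y)\<smile>"] b yc by (auto simp: comp_closed conv_closed)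
  have xc: "x \<in> carrier A" "subidentity_atom A x" "x \<^bold>\<le> rident A"
    using x M measurable_atom_subid subid_atomD by auto
  have "((b \<Zsemi> y)\<smile> \<Zsemi> x)\<smile> \<noteq> \<zero>" using x b yc xc by (simp add: closed conv_eq_zero)
  then have nz: "x \<Zsemi> (b \<Zsemi> y) \<noteq> \<zero>"
    using b xc yc subid_atom_idem[OF xc(2)] by (simp add: closed conv_comp conv_conv)
  have "x \<Zsemi> b \<^bold>\<le> x \<Zsemi> \<U>" using b xc by (simp add: closed comp_mono_right le_unit)
  then have "x \<Zsemi> b \<Zsemi> y \<^bold>\<le> x \<Zsemi> \<U> \<Zsemi> y" using b xc yc by (simp add: closed comp_mono_left)
  then have r: "x \<Zsemi> (b \<Zsemi> y) \<^bold>\<le> x \<Zsemi> \<U> \<Zsemi> y" using b xc yc by (simp add: comp_assoc)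
  have fin': "finite (atoms_between x x)" using fin M x square_atom_functional by auto
  obtain a where a: "ra_atom A a" "a \<^bold>\<le> x \<Zsemi> (b \<Zsemi> y)"
    using rectangle_atomic[OF _ yc(2) fin' _ nz r] M x b xc yc by (auto simp: comp_closed)
  have "a \<in> atoms_between x y" using a r b xc yc unfolding atoms_between_def
    by (auto intro: le_trans simp: closed atom_closed)
  have "x \<Zsemi> (b \<Zsemi> y) \<^bold>\<le> rident A \<Zsemi> (b \<Zsemi> rident A)"
    using b xc yc by (simp add: closed comp_mono le_refl)
  then have "x \<Zsemi> (b \<Zsemi> y) \<^bold>\<le> b" using b by (simp add: comp_ident ident_comp)
  then have "a \<^bold>\<le> b" using a b xc yc by (meson atom_closed closed le_trans)
  then show ?thesis using \<open>a \<in> atoms_between x y\<close> M x y by blast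
qed

section \<open>Systems of congruences modulo divisors of one number\<close>

text \<open>A property that the Chinese remainder theorem transfers to products of coprime numbers only
  has to be proved for prime powers.\<close>

lemma coprime_split_induct [consumes 1, case_names prime_power coprime]:
  fixes n :: nat
  assumes "n > 0"
    and pp: "\<And>p k. prime p \<Longrightarrow> P (p ^ k)"
    and cop: "\<And>a b. \<lbrakk>a > 0; b > 0; coprime a b; P a; P b\<rbrakk> \<Longrightarrow> P (a * b)"
  shows "P n"
  using assms(1)
proof (induction n rule: less_induct)
  case (less n)
  show ?case
  proof (cases "n = 1")
    case True then show ?thesis using pp[of 2 0] by simp
  next
    case False
    then obtain p where p: "prime p" "p dvd n" using prime_factor_nat by blast
    obtain m where m: "n = p ^ multiplicity p n * m" "\<not> p dvd m"
      using less.prems p multiplicity_decompose'[of n p] by (metis not_prime_unit neq0_conv)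
    define k where "k = multiplicity p n"
    have k: "k > 0" using p less.prems by (simp add: k_def prime_multiplicity_gt_zero_iff)
    have m0: "m > 0" using less.prems m by (cases m) auto
    have "p ^ k > 1" using k p by (metis one_less_power prime_gt_1_nat)
    then have "1 * m < p ^ k * m" using m0 by (intro mult_strict_right_mono)
    then have "m < n" using m(1) unfolding k_def by simp
    then have "P m" using less.IH m0 by blast
    moreover have "coprime (p ^ k) m" using p m by (simp add: prime_imp_coprime)
    ultimately show ?thesis using cop[of "p ^ k" m] pp[OF p(1)] m m0 p
      by (simp add: k_def prime_gt_0_nat)
  qed
qed

text \<open>The divisors of a prime power form a chain, and a bounded family has a largest member.\<close>

lemma largest_prime_power_divisor:
  fixes d :: "'b \<Rightarrow> nat"
  assumes p: "prime p" and J: "J \<noteq> {}" and d: "\<And>y. y \<in> J \<Longrightarrow> d y dvd p ^ k"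
  obtains z where "z \<in> J" "\<And>y. y \<in> J \<Longrightarrow> d y dvd d z"
proof -
  have "\<exists>z. z \<in> J \<and> (\<forall>y. y \<in> J \<longrightarrow> d y \<le> d z)"
  proof -
    have "\<forall>y. y \<in> J \<longrightarrow> d y < p ^ k + 1"
      using d p by (auto simp: less_Suc_eq_le prime_gt_0_nat intro!: dvd_imp_le)
    then show ?thesis using J ex_has_greatest_nat[of "\<lambda>y. y \<in> J" _ d "p ^ k + 1"] by (metis ex_in_conv)
  qed
  then obtain z where z: "z \<in> J" "\<forall>y\<in>J. d y \<le> d z" by blast
  have "d y dvd d z" if y: "y \<in> J" for y
  proof -
    obtain i j where "d y = p ^ i" "d z = p ^ j"
      using d[OF y] d[OF z(1)] p by (metis divides_primepow_nat)
    moreover have "p ^ i \<le> p ^ j" using z(2) y calculation by metis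
    then have "i \<le> j" using p by (meson power_le_imp_le_exp prime_gt_1_nat)
    ultimately show ?thesis by (simp add: le_imp_power_dvd)
  qed
  with z that show thesis by blast
qed

lemma dvd_split_coprime:
  fixes d a b :: nat and i :: int
  assumes "d dvd a * b" "coprime a b" "int (gcd d a) dvd i" "int (gcd d b) dvd i"
  shows "int d dvd i"
proof -
  obtain u v where uv: "d = u * v" "u dvd a" "v dvd b"
    using assms(1) division_decomp by blast
  have "coprime u v" using uv assms(2) by (meson coprime_divisors)
  moreover have "int u dvd i" "int v dvd i"
    using uv assms(3,4) by (meson dvd_trans gcd_greatest dvd_triv_left dvd_triv_right int_dvd_int_iff)+
  ultimately show ?thesis using uv by (simp add: divides_mult)
qed

lemma chinese_remainder_pair:
  fixes x y :: int and a b :: nat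
  assumes "coprime a b"
  shows "\<exists>t. int a dvd t - x \<and> int b dvd t - y"
proof -
  have "coprime (int a) (int b)" using assms by simp
  then obtain t where "[t = x] (mod int a)" "[t = y] (mod int b)"
    using binary_chinese_remainder_int by blast
  then show ?thesis by (auto simp: cong_iff_dvd_diff)
qed

text \<open>The set \<open>J\<close> may be infinite, but all moduli divide \<open>n\<close>. For a prime power, the residue demanded
  by the largest modulus satisfies all the other congruences, and it is prime to \<open>p\<close> unless all
  moduli are \<open>1\<close>.\<close>

lemma solve_congruences_coprime:
  fixes d :: "'b \<Rightarrow> nat" and w :: "'b \<Rightarrow> int"
  assumes "n > 0"
    and "\<And>y. y \<in> J \<Longrightarrow> d y dvd n"
    and "\<And>y. y \<in> J \<Longrightarrow> coprime (w y) (int (d y))"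
    and "\<And>y z. \<lbrakk>y \<in> J; z \<in> J\<rbrakk> \<Longrightarrow> int (gcd (d y) (d z)) dvd w y - w z"
  shows "\<exists>t. coprime t (int n) \<and> (\<forall>y\<in>J. int (d y) dvd t - w y)"
  using assms
proof (induction n arbitrary: d rule: coprime_split_induct)
  case (prime_power p k)
  show ?case
  proof (cases "J = {}")
    case True then show ?thesis by (auto intro: exI[of _ 1])
  next
    case False
    obtain z where z: "z \<in> J" "\<And>y. y \<in> J \<Longrightarrow> d y dvd d z"
      using largest_prime_power_divisor[OF prime_power(1) False, of d k] prime_power(2) by blast
    show ?thesis
    proof (cases "d z = 1")
      case True then show ?thesis using z by (auto intro!: exI[of _ 1])
    next
      case False
      then have "p dvd d z" using prime_power(1) prime_power(2)[OF z(1)]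
        by (metis divides_primepow_nat dvd_power dvd_refl power_0 neq0_conv)
      then have "coprime (w z) (int p)"
        using prime_power(3)[OF z(1)] by (meson coprime_divisors dvd_refl int_dvd_int_iff)
      then have "coprime (w z) (int (p ^ k))" by simp
      moreover have "int (d y) dvd w z - w y" if "y \<in> J" for y
        using prime_power(4)[OF z(1) that] z(2)[OF that] by (simp add: gcd_nat.absorb2)
      ultimately show ?thesis by blast
    qed
  qed
next
  case (coprime a b)
  have sub: "\<exists>t. coprime t (int c) \<and> (\<forall>y\<in>J. int (gcd (d y) c) dvd t - w y)"
    if IH: "\<And>d :: 'b \<Rightarrow> nat. \<lbrakk>\<And>y. y \<in> J \<Longrightarrow> d y dvd c;
        \<And>y. y \<in> J \<Longrightarrow> coprime (w y) (int (d y));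
        \<And>y z. \<lbrakk>y \<in> J; z \<in> J\<rbrakk> \<Longrightarrow> int (gcd (d y) (d z)) dvd w y - w z\<rbrakk>
       \<Longrightarrow> \<exists>t. coprime t (int c) \<and> (\<forall>y\<in>J. int (d y) dvd t - w y)" for c
  proof (rule IH)
    show "coprime (w y) (int (gcd (d y) c))" if "y \<in> J" for y
      using coprime.prems(2)[OF that] by (meson coprime_divisors dvd_refl gcd_dvd1 int_dvd_int_iff)
    show "int (gcd (gcd (d y) c) (gcd (d z) c)) dvd w y - w z" if "y \<in> J" "z \<in> J" for y z
      using coprime.prems(3)[OF that]
      by (meson dvd_trans gcd_dvd1 gcd_mono int_dvd_int_iff)
  qed simp
  obtain t1 where t1: "coprime t1 (int a)" "\<And>y. y \<in> J \<Longrightarrow> int (gcd (d y) a) dvd t1 - w y"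
    using sub[OF coprime.IH(1)] by blast
  obtain t2 where t2: "coprime t2 (int b)" "\<And>y. y \<in> J \<Longrightarrow> int (gcd (d y) b) dvd t2 - w y"
    using sub[OF coprime.IH(2)] by blast
  obtain t where t: "int a dvd t - t1" "int b dvd t - t2"
    using chinese_remainder_pair[OF coprime.hyps(3)] by blast
  have "coprime t (int a)" "coprime t (int b)"
    using t t1(1) t2(1) by (metis cong_iff_dvd_diff cong_imp_coprime cong_sym coprime_commute)+
  then have "coprime t (int (a * b))" by simp
  moreover have "int (d y) dvd t - w y" if y: "y \<in> J" for y
  proof (rule dvd_split_coprime[OF coprime.prems(1)[OF y] coprime.hyps(3)])
    have "int (gcd (d y) a) dvd (t - t1) + (t1 - w y)"
      using t t1(2)[OF y] by (meson dvd_add dvd_trans gcd_dvd2 int_dvd_int_iff)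
    then show "int (gcd (d y) a) dvd t - w y" by simp
    have "int (gcd (d y) b) dvd (t - t2) + (t2 - w y)"
      using t t2(2)[OF y] by (meson dvd_add dvd_trans gcd_dvd2 int_dvd_int_iff)
    then show "int (gcd (d y) b) dvd t - w y" by simp
  qed
  ultimately show ?case by blast
qed

text \<open>For a prime power, let \<open>o\<close> be an index with the largest modulus: the cocycle identity for
  \<open>o\<close>, \<open>y\<close>, \<open>z\<close> then holds modulo the full \<open>gcd (d y) (d z)\<close> and shows that \<open>s y = c o y\<close> is a
  solution.\<close>

lemma trivialize_cocycle:
  fixes d :: "'b \<Rightarrow> nat" and c :: "'b \<Rightarrow> 'b \<Rightarrow> int"
  assumes "n > 0"
    and "\<And>y. y \<in> J \<Longrightarrow> d y dvd n"
    and "\<And>y z w. \<lbrakk>y \<in> J; z \<in> J; w \<in> J\<rbrakk> \<Longrightarrow>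
      int (gcd (d y) (gcd (d z) (d w))) dvd c y z + c z w - c y w"
  shows "\<exists>s. \<forall>y\<in>J. \<forall>z\<in>J. int (gcd (d y) (d z)) dvd s z - s y - c y z"
  using assms
proof (induction n arbitrary: d rule: coprime_split_induct)
  case (prime_power p k)
  show ?case
  proof (cases "J = {}")
    case False
    obtain o' where o: "o' \<in> J" "\<And>y. y \<in> J \<Longrightarrow> d y dvd d o'"
      using largest_prime_power_divisor[OF prime_power(1) False, of d k] prime_power(2) by blast
    have "int (gcd (d y) (d z)) dvd c o' z - c o' y - c y z" if "y \<in> J" "z \<in> J" for y z
    proof -
      have "gcd (d o') (gcd (d y) (d z)) = gcd (d y) (d z)"
        using o(2)[OF that(1)] by (meson dvd_trans gcd_dvd1 gcd_nat.absorb2)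
      then have "int (gcd (d y) (d z)) dvd c o' y + c y z - c o' z"
        using prime_power(3)[OF o(1) that] by simp
      then have "int (gcd (d y) (d z)) dvd - (c o' y + c y z - c o' z)"
        by (simp only: dvd_minus_iff)
      then show ?thesis by (simp add: algebra_simps)
    qed
    then show ?thesis by blast
  qed auto
next
  case (coprime a b)
  have sub: "\<exists>s. \<forall>y\<in>J. \<forall>z\<in>J. int (gcd (gcd (d y) e) (gcd (d z) e)) dvd s z - s y - c y z"
    if IH: "\<And>d :: 'b \<Rightarrow> nat. \<lbrakk>\<And>y. y \<in> J \<Longrightarrow> d y dvd e;
        \<And>y z w. \<lbrakk>y \<in> J; z \<in> J; w \<in> J\<rbrakk> \<Longrightarrow>
          int (gcd (d y) (gcd (d z) (d w))) dvd c y z + c z w - c y w\<rbrakk>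
       \<Longrightarrow> \<exists>s. \<forall>y\<in>J. \<forall>z\<in>J. int (gcd (d y) (d z)) dvd s z - s y - c y z" for e
  proof (rule IH)
    show "int (gcd (gcd (d y) e) (gcd (gcd (d z) e) (gcd (d w) e))) dvd c y z + c z w - c y w"
      if "y \<in> J" "z \<in> J" "w \<in> J" for y z w
      using coprime.prems(2)[OF that]
      by (meson dvd_trans gcd_dvd1 gcd_mono int_dvd_int_iff)
  qed simp
  obtain s1 where s1: "\<And>y z. \<lbrakk>y \<in> J; z \<in> J\<rbrakk> \<Longrightarrow>
      int (gcd (gcd (d y) a) (gcd (d z) a)) dvd s1 z - s1 y - c y z"
    using sub[OF coprime.IH(1)] by blast
  obtain s2 where s2: "\<And>y z. \<lbrakk>y \<in> J; z \<in> J\<rbrakk> \<Longrightarrow>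
      int (gcd (gcd (d y) b) (gcd (d z) b)) dvd s2 z - s2 y - c y z"
    using sub[OF coprime.IH(2)] by blast
  have "\<forall>y. \<exists>t. int a dvd t - s1 y \<and> int b dvd t - s2 y"
    using chinese_remainder_pair[OF coprime.hyps(3)] by blast
  then obtain s where s: "\<And>y. int a dvd s y - s1 y" "\<And>y. int b dvd s y - s2 y" by metis
  have "int (gcd (d y) (d z)) dvd s z - s y - c y z" if yz: "y \<in> J" "z \<in> J" for y z
  proof (rule dvd_split_coprime[OF _ coprime.hyps(3)])
    show "gcd (d y) (d z) dvd a * b" using coprime.prems(1)[OF yz(1)] by (meson dvd_trans gcd_dvd1)
    have combine: "int (gcd (gcd (d y) (d z)) e) dvd s z - s y - c y z"
      if e: "\<And>y. int e dvd s y - s' y"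
        "int (gcd (gcd (d y) e) (gcd (d z) e)) dvd s' z - s' y - c y z" for e s'
    proof -
      have "int (gcd (gcd (d y) (d z)) e) dvd s' z - s' y - c y z"
        using e(2) by (simp add: gcd.commute gcd.left_commute)
      moreover have "int (gcd (gcd (d y) (d z)) e) dvd (s z - s' z) - (s y - s' y)"
        using e(1) by (meson dvd_diff dvd_trans gcd_dvd2 int_dvd_int_iff)
      ultimately have "int (gcd (gcd (d y) (d z)) e)
          dvd ((s z - s' z) - (s y - s' y)) + (s' z - s' y - c y z)"
        by (rule dvd_add[rotated])
      then show ?thesis by (simp add: algebra_simps)
    qed
    show "int (gcd (gcd (d y) (d z)) a) dvd s z - s y - c y z"
      using combine[of a s1] s(1) s1[OF yz] by blast
    show "int (gcd (gcd (d y) (d z)) b) dvd s z - s y - c y z"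
      using combine[of b s2] s(2) s2[OF yz] by blast
  qed
  then show ?case by blast
qed

text \<open>The hypothesis says that \<open>f\<close> is the orbit map of an action of the integers. Its least period is
  the number of elements of the orbit.\<close>

lemma orbit_period:
  fixes f :: "int \<Rightarrow> 'b"
  assumes shift: "\<And>i j k. f i = f j \<Longrightarrow> f (i + k) = f (j + k)"
    and fin: "finite (range f)"
  shows "f i = f j \<longleftrightarrow> int (card (range f)) dvd i - j"
proof -
  have diff: "f i = f j \<longleftrightarrow> f (i - j) = f 0" for i j
    using shift[of i j "- j"] shift[of "i - j" 0 j] by auto
  have "\<not> inj f" using fin infinite_UNIV_int finite_imageD by blast
  then obtain i j where "f i = f j" "i \<noteq> j" unfolding inj_def by blast
  then have "f (i - j) = f 0" "f (j - i) = f 0" "i \<noteq> j" using diff by metis+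
  then have "\<exists>p::nat. p > 0 \<and> f (int p) = f 0"
    by (cases "i < j") (auto intro: exI[of _ "nat (i - j)"] exI[of _ "nat (j - i)"])
  then obtain p :: nat where p: "p > 0" "f (int p) = f 0"
    and least: "\<And>q. q > 0 \<Longrightarrow> f (int q) = f 0 \<Longrightarrow> p \<le> q"
    using ex_has_least_nat[of "\<lambda>p. p > 0 \<and> f (int p) = f 0" _ id] by (metis id_apply)
  have mult: "f (int p * int k) = f 0" for k
  proof (induction k)
    case (Suc k)
    then have "f (int p * int k + int p) = f (0 + int p)" by (rule shift)
    then show ?case using p by (simp add: algebra_simps)
  qed simp
  have mult': "f (int p * k) = f 0" for k
  proof (cases "k \<ge> 0")
    case True then show ?thesis using mult[of "nat k"] by simp
  next
    case False
    then have "f (- (int p * k)) = f 0" using mult[of "nat (- k)"] by simp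
    then show ?thesis using diff[of 0 "int p * k"] by simp
  qed
  have modp: "f k = f (k mod int p)" for k
    using shift[OF mult'[of "k div int p"], of "k mod int p"] by simp
  have zero: "f k = f 0 \<longleftrightarrow> int p dvd k" for k
  proof
    assume "f k = f 0"
    then have "f (int (nat (k mod int p))) = f 0" using modp p by simp
    moreover have "nat (k mod int p) < p" using p by (simp add: nat_less_iff)
    ultimately have "nat (k mod int p) = 0" using least[of "nat (k mod int p)"] by (metis not_less gr0I)
    moreover have "k mod int p \<ge> 0" using p by simp
    ultimately show "int p dvd k" by (simp add: dvd_eq_mod_eq_0)
  qed (use mult' in \<open>auto elim!: dvdE\<close>)
  have "range f = f ` {0..<int p}"
  proof (intro equalityI subsetI)
    fix y assume "y \<in> range f"
    then obtain k where "y = f (k mod int p)" using modp by blast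
    then show "y \<in> f ` {0..<int p}" using p by auto
  qed auto
  moreover have "inj_on f {0..<int p}"
  proof (rule inj_onI)
    fix x y assume "x \<in> {0..<int p}" "y \<in> {0..<int p}" "f x = f y"
    moreover from this have "int p dvd x - y" using diff zero by blast
    ultimately show "x = y" by (metis atLeastLessThan_iff mod_eq_dvd_iff mod_pos_pos_trivial)
  qed
  ultimately have "card (range f) = p" by (simp add: card_image)
  then show ?thesis using diff zero by simp
qed

section \<open>The atom structure and its indices\<close>

text \<open>The atom structure of a measurable relation algebra with finite groups, detached from the
  algebra: \<open>I\<close> is the set of measurable atoms, \<open>hom x y\<close> the set of atoms below \<open>x;1;y\<close>, and
  \<open>a \<odot> b\<close> the set of atoms below \<open>a;b\<close>. Nothing is said about \<open>a \<odot> b\<close> when the inner measurable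
  atoms of \<open>a\<close> and \<open>b\<close> differ.\<close>

locale measured_atoms =
  fixes I :: "'a set" and hom :: "'a \<Rightarrow> 'a \<Rightarrow> 'a set"
    and comp :: "'a \<Rightarrow> 'a \<Rightarrow> 'a set" (infixl \<open>\<odot>\<close> 70)
    and cv :: "'a \<Rightarrow> 'a"
    and G :: "'a \<Rightarrow> 'a monoid"
  assumes hom_unique: "\<lbrakk>x \<in> I; y \<in> I; x' \<in> I; y' \<in> I; a \<in> hom x y; a \<in> hom x' y'\<rbrakk>
        \<Longrightarrow> x = x' \<and> y = y'"
    and comp_hom: "\<lbrakk>x \<in> I; y \<in> I; z \<in> I; a \<in> hom x y; b \<in> hom y z; c \<in> a \<odot> b\<rbrakk> \<Longrightarrow> c \<in> hom x z"
    and comp_nonempty: "\<lbrakk>x \<in> I; y \<in> I; z \<in> I; a \<in> hom x y; b \<in> hom y z\<rbrakk> \<Longrightarrow> a \<odot> b \<noteq> {}"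
    and cv_hom: "\<lbrakk>x \<in> I; y \<in> I; a \<in> hom x y\<rbrakk> \<Longrightarrow> cv a \<in> hom y x"
    and cv_cv: "\<lbrakk>x \<in> I; y \<in> I; a \<in> hom x y\<rbrakk> \<Longrightarrow> cv (cv a) = a"
    and peirce_left: "\<lbrakk>x \<in> I; y \<in> I; z \<in> I; a \<in> hom x y; b \<in> hom y z; c \<in> a \<odot> b\<rbrakk>
        \<Longrightarrow> a \<in> c \<odot> cv b"
    and peirce_right: "\<lbrakk>x \<in> I; y \<in> I; z \<in> I; a \<in> hom x y; b \<in> hom y z; c \<in> a \<odot> b\<rbrakk>
        \<Longrightarrow> b \<in> cv a \<odot> c"
    and assoc: "\<lbrakk>x \<in> I; y \<in> I; z \<in> I; w \<in> I; a \<in> hom x y; b \<in> hom y z; c \<in> hom z w\<rbrakk>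
        \<Longrightarrow> (\<Union>e\<in>a \<odot> b. e \<odot> c) = (\<Union>e\<in>b \<odot> c. a \<odot> e)"
    and id_hom: "x \<in> I \<Longrightarrow> x \<in> hom x x"
    and id_left: "\<lbrakk>x \<in> I; y \<in> I; a \<in> hom x y\<rbrakk> \<Longrightarrow> x \<odot> a = {a}"
    and id_right: "\<lbrakk>x \<in> I; y \<in> I; a \<in> hom x y\<rbrakk> \<Longrightarrow> a \<odot> y = {a}"
    and G_carrier: "x \<in> I \<Longrightarrow> carrier (G x) = hom x x"
    and G_one: "x \<in> I \<Longrightarrow> \<one>\<^bsub>G x\<^esub> = x"
    and G_mult: "\<lbrakk>x \<in> I; p \<in> hom x x; q \<in> hom x x\<rbrakk> \<Longrightarrow> p \<odot> q = {p \<otimes>\<^bsub>G x\<^esub> q}"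
    and G_finite: "x \<in> I \<Longrightarrow> finite (hom x x)"
begin

lemma cv_comp:
  assumes "x \<in> I" "y \<in> I" "z \<in> I" "a \<in> hom x y" "b \<in> hom y z"
  shows "cv b \<odot> cv a = cv ` (a \<odot> b)"
proof -
  have *: "cv c \<in> cv b \<odot> cv a" if "x \<in> I" "y \<in> I" "z \<in> I" "a \<in> hom x y" "b \<in> hom y z" "c \<in> a \<odot> b"
    for x y z a b c
  proof -
    have c: "c \<in> hom x z" using comp_hom that by blast
    have "b \<in> cv a \<odot> c" using peirce_right that by blast
    then have "cv a \<in> b \<odot> cv c"
      using peirce_left[of y x z "cv a" c b] that c by (simp add: cv_hom)
    then show ?thesis
      using peirce_right[of y z x b "cv c" "cv a"] that c by (simp add: cv_hom)
  qed
  have "c \<in> cv ` (a \<odot> b)" if c: "c \<in> cv b \<odot> cv a" for c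
  proof -
    have h: "c \<in> hom z x" using comp_hom[of z y x "cv b" "cv a"] c assms cv_hom by blast
    have "cv c \<in> cv (cv a) \<odot> cv (cv b)"
      using *[of z y x "cv b" "cv a" c] c assms cv_hom by blast
    then have "cv c \<in> a \<odot> b" using assms cv_cv by metis
    moreover have "cv (cv c) = c" using h assms cv_cv by blast
    ultimately show ?thesis by force
  qed
  then show ?thesis using * assms by blast
qed

lemma group_G:
  assumes x: "x \<in> I"
  shows "group (G x)"
proof (rule groupI)
  show "\<one>\<^bsub>G x\<^esub> \<in> carrier (G x)" using x by (simp add: G_carrier G_one id_hom)
  fix p q assume p: "p \<in> carrier (G x)" and q: "q \<in> carrier (G x)"
  then have p': "p \<in> hom x x" and q': "q \<in> hom x x" using x G_carrier by auto
  show pq: "p \<otimes>\<^bsub>G x\<^esub> q \<in> carrier (G x)"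
    using comp_hom[OF x x x p' q'] G_mult[OF x p' q'] x by (simp add: G_carrier)
  show "\<one>\<^bsub>G x\<^esub> \<otimes>\<^bsub>G x\<^esub> p = p"
    using id_left[OF x x p'] G_mult[OF x _ p', of x] x by (simp add: G_one id_hom)
  have "x \<in> cv p \<odot> p"
    using peirce_right[OF x x x p' id_hom[OF x], of p] id_right[OF x x p'] by simp
  then show "\<exists>q\<in>carrier (G x). q \<otimes>\<^bsub>G x\<^esub> p = \<one>\<^bsub>G x\<^esub>"
    using G_mult[OF x cv_hom[OF x x p'] p'] x cv_hom[OF x x p']
    by (intro bexI[of _ "cv p"]) (auto simp: G_carrier G_one)
  fix r assume "r \<in> carrier (G x)"
  then have r': "r \<in> hom x x" using x G_carrier by auto
  show "p \<otimes>\<^bsub>G x\<^esub> q \<otimes>\<^bsub>G x\<^esub> r = p \<otimes>\<^bsub>G x\<^esub> (q \<otimes>\<^bsub>G x\<^esub> r)"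
  proof -
    have pq': "p \<otimes>\<^bsub>G x\<^esub> q \<in> hom x x" "q \<otimes>\<^bsub>G x\<^esub> r \<in> hom x x"
      using comp_hom[OF x x x p' q'] comp_hom[OF x x x q' r'] G_mult[OF x p' q'] G_mult[OF x q' r']
      by auto
    have "{p \<otimes>\<^bsub>G x\<^esub> q \<otimes>\<^bsub>G x\<^esub> r} = (\<Union>e\<in>p \<odot> q. e \<odot> r)"
      unfolding G_mult[OF x p' q'] using G_mult[OF x pq'(1) r'] by (simp only: UN_insert UN_empty Un_empty_right)
    also have "\<dots> = (\<Union>e\<in>q \<odot> r. p \<odot> e)" by (rule assoc[OF x x x x p' q' r'])
    also have "\<dots> = {p \<otimes>\<^bsub>G x\<^esub> (q \<otimes>\<^bsub>G x\<^esub> r)}"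
      unfolding G_mult[OF x q' r'] using G_mult[OF x p' pq'(2)] by (simp only: UN_insert UN_empty Un_empty_right)
    finally show ?thesis by simp
  qed
qed

lemma cv_is_inv:
  assumes x: "x \<in> I" and p: "p \<in> hom x x"
  shows "cv p = inv\<^bsub>G x\<^esub> p"
proof -
  interpret Gx: group "G x" using group_G x .
  have "x \<in> cv p \<odot> p"
    using peirce_right[OF x x x p id_hom[OF x], of p] id_right[OF x x p] by simp
  then have "cv p \<otimes>\<^bsub>G x\<^esub> p = \<one>\<^bsub>G x\<^esub>"
    using G_mult[OF x cv_hom[OF x x p] p] x by (auto simp: G_one)
  then show ?thesis using Gx.inv_equality p cv_hom[OF x x p] x by (simp add: G_carrier)
qed

text \<open>If \<open>c \<in> p \<odot> a\<close>, then \<open>a \<in> cv p \<odot> c\<close>, and therefore \<open>p \<odot> a\<close> is contained in the product of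
  \<open>p \<odot> cv p = {x}\<close> with \<open>c\<close>.\<close>

lemma group_acts_left:
  assumes "x \<in> I" "y \<in> I" "p \<in> hom x x" "a \<in> hom x y"
  shows "\<exists>c\<in>hom x y. p \<odot> a = {c}"
proof -
  interpret Gx: group "G x" using group_G assms by blast
  obtain c where c: "c \<in> p \<odot> a" using comp_nonempty assms by blast
  have cv: "cv p \<in> hom x x" using cv_hom assms by blast
  have ch: "c \<in> hom x y" using c comp_hom assms by blast
  have a: "a \<in> cv p \<odot> c" using peirce_right c assms by blast
  have "p \<odot> a \<subseteq> (\<Union>e\<in>cv p \<odot> c. p \<odot> e)" using a by blast
  also have "\<dots> = (\<Union>e\<in>p \<odot> cv p. e \<odot> c)"
    using assoc[of x x x y p "cv p" c] assms cv ch by simp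
  also have "\<dots> = x \<odot> c"
    using G_mult[of x p "cv p"] assms cv cv_is_inv[of x p] by (simp add: G_carrier G_one)
  also have "\<dots> = {c}" using id_left assms ch by blast
  finally show ?thesis using c ch by blast
qed

text \<open>Any atom of \<open>b \<odot> cv a\<close> carries \<open>a\<close> to \<open>b\<close>.\<close>

lemma transitive_left:
  assumes "x \<in> I" "y \<in> I" "a \<in> hom x y" "b \<in> hom x y"
  shows "\<exists>p\<in>hom x x. b \<in> p \<odot> a"
proof -
  have cv: "cv a \<in> hom y x" using cv_hom assms by blast
  obtain p where p: "p \<in> b \<odot> cv a" using comp_nonempty[of x y x b "cv a"] assms cv by blast
  have "p \<in> hom x x" using comp_hom[of x y x b "cv a"] p assms cv by blast
  moreover have "b \<in> p \<odot> a"
    using peirce_left[of x y x b "cv a" p] p assms cv cv_cv by fastforce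
  ultimately show ?thesis by blast
qed

definition generator :: "'a \<Rightarrow> 'a \<Rightarrow> bool" where
  "generator x p \<longleftrightarrow> p \<in> hom x x \<and> (\<forall>q\<in>hom x x. \<exists>i::int. q = p [^]\<^bsub>G x\<^esub> i)"

text \<open>By transitivity this is the index of the stabilizer of an atom of \<open>hom x y\<close>, in the group of \<open>x\<close>
  as well as in the group of \<open>y\<close>. Counting atoms makes the symmetry in \<open>x\<close> and \<open>y\<close> evident.\<close>

definition index :: "'a \<Rightarrow> 'a \<Rightarrow> nat" where
  "index x y = card (hom x y)"

lemma index_commute: "\<lbrakk>x \<in> I; y \<in> I\<rbrakk> \<Longrightarrow> index x y = index y x"
  unfolding index_def
  by (rule bij_betw_same_card[OF bij_betw_byWitness[where f' = cv and f = cv]])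
    (auto simp: cv_hom cv_cv)

end

locale generated_atoms = measured_atoms +
  fixes g :: "'a \<Rightarrow> 'a"
  assumes generator: "x \<in> I \<Longrightarrow> generator x (g x)"
begin

abbreviation gpow :: "'a \<Rightarrow> int \<Rightarrow> 'a" where "gpow x i \<equiv> g x [^]\<^bsub>G x\<^esub> i"

definition lact :: "'a \<Rightarrow> int \<Rightarrow> 'a \<Rightarrow> 'a" where
  "lact x i a = (THE c. gpow x i \<odot> a = {c})"

text \<open>Conjugating the left action by the converse makes all laws of the right action consequences of
  those of the left action; \<open>ract_comp\<close> shows that this is multiplication by a power of \<open>g y\<close>.\<close>

definition ract :: "'a \<Rightarrow> int \<Rightarrow> 'a \<Rightarrow> 'a" where
  "ract y i a = cv (lact y (- i) (cv a))"

lemma g_hom: "x \<in> I \<Longrightarrow> g x \<in> hom x x"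
  using generator generator_def by blast

lemma gpow_hom: "x \<in> I \<Longrightarrow> gpow x i \<in> hom x x"
  using group.int_pow_closed[OF group_G] G_carrier g_hom by metis

lemma hom_gpow: "\<lbrakk>x \<in> I; p \<in> hom x x\<rbrakk> \<Longrightarrow> \<exists>i. p = gpow x i"
  using generator generator_def by blast

lemma gpow_0: "x \<in> I \<Longrightarrow> gpow x 0 = x"
  by (simp add: G_one)

lemma gpow_add: "x \<in> I \<Longrightarrow> gpow x (i + j) = gpow x i \<otimes>\<^bsub>G x\<^esub> gpow x j"
  using group.int_pow_mult[OF group_G, of x "g x" i j] G_carrier g_hom by simp

lemma cv_gpow: "x \<in> I \<Longrightarrow> cv (gpow x i) = gpow x (- i)"
  using group.int_pow_neg[OF group_G, of x "g x" i] cv_is_inv[OF _ gpow_hom] G_carrier g_hom by simp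

lemma lact_comp:
  assumes "x \<in> I" "y \<in> I" "a \<in> hom x y"
  shows "gpow x i \<odot> a = {lact x i a}" "lact x i a \<in> hom x y"
proof -
  obtain c where c: "c \<in> hom x y" "gpow x i \<odot> a = {c}"
    using group_acts_left[OF assms(1,2) gpow_hom assms(3)] assms by blast
  then have "lact x i a = c" unfolding lact_def by (intro the_equality) auto
  with c show "gpow x i \<odot> a = {lact x i a}" "lact x i a \<in> hom x y" by simp_all
qed

lemma lact_0: "\<lbrakk>x \<in> I; y \<in> I; a \<in> hom x y\<rbrakk> \<Longrightarrow> lact x 0 a = a"
  using lact_comp(1)[of x y a 0] id_left gpow_0 by (metis singleton_inject)

lemma lact_add:
  assumes "x \<in> I" "y \<in> I" "a \<in> hom x y"
  shows "lact x (i + j) a = lact x i (lact x j a)"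
proof -
  have "gpow x i \<odot> gpow x j = {gpow x (i + j)}"
    using G_mult[OF assms(1) gpow_hom gpow_hom] assms(1) gpow_add by metis
  then have "{lact x (i + j) a} = (\<Union>e\<in>gpow x i \<odot> gpow x j. e \<odot> a)"
    using lact_comp(1)[OF assms] by simp
  also have "\<dots> = (\<Union>e\<in>gpow x j \<odot> a. gpow x i \<odot> e)"
    using assoc[of x x x y] assms gpow_hom by simp
  also have "\<dots> = {lact x i (lact x j a)}"
    using assms lact_comp by simp
  finally show ?thesis by simp
qed

lemma comp_lact:
  assumes "x \<in> I" "y \<in> I" "z \<in> I" "a \<in> hom x y" "b \<in> hom y z"
  shows "lact x i a \<odot> b = lact x i ` (a \<odot> b)"
proof -
  have "lact x i a \<odot> b = (\<Union>e\<in>gpow x i \<odot> a. e \<odot> b)" using lact_comp(1) assms by simp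
  also have "\<dots> = (\<Union>e\<in>a \<odot> b. gpow x i \<odot> e)"
    using assoc[of x x y z "gpow x i" a b] assms gpow_hom by simp
  also have "\<dots> = (\<Union>e\<in>a \<odot> b. {lact x i e})"
    using lact_comp(1)[OF assms(1,3)] comp_hom[OF assms(1-5)] by simp
  finally show ?thesis by blast
qed

lemma ract_comp:
  assumes "x \<in> I" "y \<in> I" "a \<in> hom x y"
  shows "a \<odot> gpow y i = {ract y i a}" "ract y i a \<in> hom x y"
proof -
  have c: "cv a \<in> hom y x" using cv_hom assms by blast
  have "a \<odot> gpow y i = cv (cv a) \<odot> cv (gpow y (- i))" using assms cv_cv cv_gpow by simp
  also have "\<dots> = cv ` (gpow y (- i) \<odot> cv a)"
    using cv_comp[OF assms(2,2,1) gpow_hom c] assms by blast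
  also have "\<dots> = {ract y i a}" using lact_comp(1)[OF assms(2,1) c] by (simp add: ract_def)
  finally show "a \<odot> gpow y i = {ract y i a}" .
  show "ract y i a \<in> hom x y"
    unfolding ract_def using lact_comp(2)[OF assms(2,1) c] assms cv_hom by blast
qed

lemma cv_lact: "\<lbrakk>x \<in> I; y \<in> I; a \<in> hom x y\<rbrakk> \<Longrightarrow> cv (lact x i a) = ract x (- i) (cv a)"
  by (simp add: ract_def cv_cv)

lemma ract_0: "\<lbrakk>x \<in> I; y \<in> I; a \<in> hom x y\<rbrakk> \<Longrightarrow> ract y 0 a = a"
  by (simp add: ract_def lact_0[of y x] cv_hom cv_cv)

lemma ract_add:
  assumes "x \<in> I" "y \<in> I" "a \<in> hom x y"
  shows "ract y (i + j) a = ract y i (ract y j a)"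
proof -
  have c: "cv a \<in> hom y x" using cv_hom assms by blast
  have "cv (cv (lact y (- j) (cv a))) = lact y (- j) (cv a)"
    using lact_comp(2)[OF assms(2,1) c] cv_cv assms by blast
  then show ?thesis using lact_add[OF assms(2,1) c, of "- i" "- j"] by (simp add: ract_def)
qed

lemma comp_ract:
  assumes "x \<in> I" "y \<in> I" "z \<in> I" "a \<in> hom x y" "b \<in> hom y z"
  shows "a \<odot> ract z i b = ract z i ` (a \<odot> b)"
proof -
  have "a \<odot> ract z i b = (\<Union>e\<in>b \<odot> gpow z i. a \<odot> e)" using ract_comp(1)[of y z] assms by simp
  also have "\<dots> = (\<Union>e\<in>a \<odot> b. e \<odot> gpow z i)"
    using assoc[of x y z z a b "gpow z i"] assms gpow_hom by simp
  also have "\<dots> = (\<Union>e\<in>a \<odot> b. {ract z i e})"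
    using ract_comp(1)[OF assms(1,3)] comp_hom[OF assms(1-5)] by simp
  finally show ?thesis by blast
qed

lemma comp_middle:
  assumes "x \<in> I" "y \<in> I" "z \<in> I" "a \<in> hom x y" "b \<in> hom y z"
  shows "ract y i a \<odot> b = a \<odot> lact y i b"
proof -
  have "ract y i a \<odot> b = (\<Union>e\<in>a \<odot> gpow y i. e \<odot> b)" using ract_comp(1)[of x y] assms by simp
  also have "\<dots> = (\<Union>e\<in>gpow y i \<odot> b. a \<odot> e)"
    using assoc[of x y y z a "gpow y i" b] assms gpow_hom by simp
  also have "\<dots> = a \<odot> lact y i b" using lact_comp(1)[of y z] assms by simp
  finally show ?thesis .
qed

lemma lact_ract:
  assumes "x \<in> I" "y \<in> I" "a \<in> hom x y"
  shows "lact x i (ract y j a) = ract y j (lact x i a)"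
  using comp_lact[OF assms(1,2,2,3) gpow_hom[OF assms(2)], of i j]
    ract_comp(1)[OF assms] ract_comp(1)[OF assms(1,2) lact_comp(2)[OF assms]] by simp

lemma lact_transitive:
  assumes "x \<in> I" "y \<in> I" "a \<in> hom x y" "b \<in> hom x y"
  shows "\<exists>i. b = lact x i a"
proof -
  obtain p where p: "p \<in> hom x x" "b \<in> p \<odot> a" using transitive_left assms by blast
  then show ?thesis using hom_gpow[OF assms(1) p(1)] lact_comp(1)[OF assms(1-3)] by auto
qed

lemma ract_transitive:
  assumes "x \<in> I" "y \<in> I" "a \<in> hom x y" "b \<in> hom x y"
  shows "\<exists>i. b = ract y i a"
proof -
  obtain i where "cv b = lact y i (cv a)"
    using lact_transitive[of y x "cv a" "cv b"] assms cv_hom by blast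
  then have "b = ract y (- i) a" using cv_cv assms by (metis ract_def minus_minus)
  then show ?thesis by blast
qed

lemma range_lact:
  assumes "x \<in> I" "y \<in> I" "a \<in> hom x y"
  shows "range (\<lambda>i. lact x i a) = hom x y"
  using lact_transitive lact_comp(2) assms by blast

lemma finite_hom:
  assumes "x \<in> I" "y \<in> I"
  shows "finite (hom x y)"
proof (cases "hom x y = {}")
  case False
  then obtain a where a: "a \<in> hom x y" by blast
  have "hom x y \<subseteq> (\<lambda>p. THE c. p \<odot> a = {c}) ` hom x x"
  proof
    fix b assume "b \<in> hom x y"
    then obtain i where "b = lact x i a" using lact_transitive[OF assms a] by blast
    then have "b = (\<lambda>p. THE c. p \<odot> a = {c}) (gpow x i)" by (simp only: lact_def)
    then show "b \<in> (\<lambda>p. THE c. p \<odot> a = {c}) ` hom x x"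
      using gpow_hom[OF assms(1), of i] by (rule image_eqI)
  qed
  moreover have "finite ((\<lambda>p. THE c. p \<odot> a = {c}) ` hom x x)"
    using G_finite[OF assms(1)] by (rule finite_imageI)
  ultimately show ?thesis by (rule finite_subset)
qed simp

text \<open>The integers act transitively on the finite set \<open>hom x y\<close>.\<close>

lemma lact_eq_iff:
  assumes "x \<in> I" "y \<in> I" "a \<in> hom x y"
  shows "lact x i a = lact x j a \<longleftrightarrow> int (index x y) dvd i - j"
proof -
  have shift: "lact x (i + k) a = lact x (j + k) a" if "lact x i a = lact x j a" for i j k
    using that lact_add[OF assms, of k] by (simp add: add.commute)
  have "lact x i a = lact x j a \<longleftrightarrow> int (card (range (\<lambda>i. lact x i a))) dvd i - j"
    using finite_hom[OF assms(1,2)] by (intro orbit_period shift) (simp_all add: range_lact[OF assms])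
  then show ?thesis by (simp only: range_lact[OF assms] index_def)
qed

lemma lact_fix_iff:
  "\<lbrakk>x \<in> I; y \<in> I; a \<in> hom x y\<rbrakk> \<Longrightarrow> lact x i a = a \<longleftrightarrow> int (index x y) dvd i"
  using lact_eq_iff[of x y a i 0] lact_0 by simp

lemma ract_fix_iff:
  assumes "x \<in> I" "y \<in> I" "a \<in> hom x y"
  shows "ract y i a = a \<longleftrightarrow> int (index x y) dvd i"
proof -
  have c: "cv a \<in> hom y x" using cv_hom assms by blast
  have "ract y i a = a \<longleftrightarrow> lact y (- i) (cv a) = cv a"
    using lact_comp(2)[OF assms(2,1) c, of "- i"] cv_cv assms unfolding ract_def by metis
  then show ?thesis using lact_fix_iff[OF assms(2,1) c, of "- i"] index_commute assms by simp
qed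

lemma ract_eq_iff:
  assumes "x \<in> I" "y \<in> I" "a \<in> hom x y"
  shows "ract y i a = ract y j a \<longleftrightarrow> int (index x y) dvd i - j"
proof -
  have h: "ract y j a \<in> hom x y" using ract_comp(2) assms by blast
  have "ract y i a = ract y (i - j) (ract y j a)" using ract_add[OF assms, of "i - j" j] by simp
  then show ?thesis using ract_fix_iff[OF assms(1,2) h] by simp
qed

text \<open>The order of \<open>g x\<close> is \<open>index x x\<close>, so a shift by this number fixes every atom.\<close>

lemma index_dvd:
  assumes "x \<in> I" "y \<in> I" "hom x y \<noteq> {}"
  shows "index x y dvd index x x"
proof -
  obtain a where a: "a \<in> hom x y" using assms by blast
  have "lact x (int (index x x)) x = x"
    using lact_fix_iff[OF assms(1,1) id_hom[OF assms(1)]] by simp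
  moreover have "lact x (int (index x x)) x = gpow x (int (index x x))"
    using lact_comp(1)[OF assms(1,1) id_hom[OF assms(1)]]
      id_right[OF assms(1,1) gpow_hom[OF assms(1)]] by (metis singleton_inject)
  ultimately have "lact x (int (index x x)) a = a"
    using lact_comp(1)[OF assms(1,2) a] id_left[OF assms(1,2) a] by (metis singleton_inject)
  then show ?thesis using lact_fix_iff[OF assms(1,2) a] by simp
qed

lemma index_pos: "\<lbrakk>x \<in> I; y \<in> I; hom x y \<noteq> {}\<rbrakk> \<Longrightarrow> index x y > 0"
  using finite_hom by (simp add: index_def card_gt_0_iff)

lemma lact_power_ract:
  assumes "x \<in> I" "y \<in> I" "a \<in> hom x y" and u: "lact x 1 a = ract y u a"
  shows "lact x i a = ract y (u * i) a"
proof -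
  note assms = assms(1-3)
  have nat: "lact x (int n) a = ract y (u * int n) a" for n
  proof (induction n)
    case (Suc n)
    have "lact x (int (Suc n)) a = lact x 1 (lact x (int n) a)"
      using lact_add[OF assms, of 1 "int n"] by simp
    also have "\<dots> = ract y (u * int n) (ract y u a)"
      using Suc lact_ract[OF assms] u by simp
    also have "\<dots> = ract y (u * int (Suc n)) a"
      using ract_add[OF assms, of "u * int n" u] by (simp add: algebra_simps)
    finally show ?case .
  qed (simp add: lact_0[OF assms] ract_0[OF assms])
  show ?thesis
  proof (cases "i \<ge> 0")
    case True then show ?thesis using nat[of "nat i"] by simp
  next
    case False
    define n where "n = nat (- i)"
    have i: "i = - int n" using False by (simp add: n_def)
    have l: "lact x i a \<in> hom x y" "ract y (u * i) a \<in> hom x y"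
      using lact_comp(2) ract_comp(2) assms by blast+
    have "a = lact x i (lact x (int n) a)" using lact_add[OF assms, of i "int n"] i lact_0[OF assms] by simp
    also have "\<dots> = ract y (u * int n) (lact x i a)" using nat lact_ract[OF assms] by simp
    finally have a: "ract y (u * int n) (lact x i a) = a" by simp
    have "ract y (u * i) a = ract y (u * i + u * int n) (lact x i a)"
      using ract_add[OF assms(1,2) l(1), of "u * i" "u * int n"] a by simp
    also have "u * i + u * int n = 0" using i by simp
    finally show ?thesis using ract_0[OF assms(1,2) l(1)] by simp
  qed
qed

lemma lact_as_ract:
  assumes "x \<in> I" "y \<in> I" "a \<in> hom x y"
  shows "\<exists>u. \<forall>i. lact x i a = ract y (u * i) a"
  using ract_transitive[OF assms lact_comp(2)[OF assms]] lact_power_ract[OF assms] by blast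

text \<open>Shifts by multiples of \<open>index x y\<close> fix \<open>a\<close>. A shift of \<open>a\<close> by a multiple of \<open>index y z\<close> can be
  moved through \<open>a\<close> to a shift of \<open>b\<close> by a multiple of the same number, which fixes \<open>b\<close>.\<close>

lemma comp_fixed_shift:
  assumes "x \<in> I" "y \<in> I" "z \<in> I" "a \<in> hom x y" "b \<in> hom y z"
    and i: "int (gcd (index x y) (index y z)) dvd i"
  shows "lact x i a \<odot> b = a \<odot> b"
proof -
  obtain s t where st: "s * int (index x y) + t * int (index y z) = int (gcd (index x y) (index y z))"
    using bezout_int[of "int (index x y)" "int (index y z)"] by auto
  obtain k where k: "i = int (gcd (index x y) (index y z)) * k" using i by blast
  define u v where "u = k * s * int (index x y)" and "v = k * t * int (index y z)"
  have uv: "i = v + u" unfolding u_def v_def k st[symmetric] by (simp add: algebra_simps)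
  have "lact x u a = a" using lact_fix_iff[OF assms(1,2,4)] by (simp add: u_def)
  then have "lact x i a = lact x v a" using lact_add[OF assms(1,2,4)] uv by simp
  also obtain r where "lact x v a = ract y (r * v) a" using lact_as_ract[OF assms(1,2,4)] by blast
  finally have "lact x i a \<odot> b = a \<odot> lact y (r * v) b" using comp_middle[OF assms(1-5)] by simp
  also have "lact y (r * v) b = b" using lact_fix_iff[OF assms(2,3,5)] by (simp add: v_def)
  finally show ?thesis .
qed

text \<open>From \<open>b \<in> cv a \<odot> c\<close> it follows that \<open>c'\<close> lies in \<open>(a \<odot> cv a) \<odot> c\<close>, and the members of
  \<open>a \<odot> cv a\<close> are the group elements that fix \<open>a\<close>.\<close>

lemma comp_difference:
  assumes "x \<in> I" "y \<in> I" "z \<in> I" "a \<in> hom x y" "b \<in> hom y z" "c \<in> a \<odot> b" "c' \<in> a \<odot> b"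
  shows "\<exists>i. c' = lact x i c \<and> int (index x y) dvd i"
proof -
  have c: "c \<in> hom x z" "cv a \<in> hom y x" using comp_hom cv_hom assms by blast+
  have "b \<in> cv a \<odot> c" using peirce_right assms by blast
  then have "c' \<in> (\<Union>e\<in>cv a \<odot> c. a \<odot> e)" using assms by blast
  also have "\<dots> = (\<Union>p\<in>a \<odot> cv a. p \<odot> c)"
    using assoc[OF assms(1,2,1,3,4) c(2,1)] by simp
  finally obtain p where p: "p \<in> a \<odot> cv a" "c' \<in> p \<odot> c" by blast
  have ph: "p \<in> hom x x" using comp_hom[OF assms(1,2,1,4) c(2) p(1)] .
  then obtain i where i: "p = gpow x i" using hom_gpow assms by blast
  have "a \<in> p \<odot> a" using peirce_left[OF assms(1,2,1,4) c(2) p(1)] cv_cv assms by metis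
  then have "lact x i a = a" using lact_comp(1)[OF assms(1,2,4)] i by simp
  then have "int (index x y) dvd i" using lact_fix_iff assms by blast
  moreover have "c' = lact x i c" using p(2) i lact_comp(1)[OF assms(1,3) c(1)] by simp
  ultimately show ?thesis by blast
qed

text \<open>With \<open>d = gcd (index x y) (index y z)\<close>, the shift of an atom \<open>c \<in> a \<odot> b\<close> by \<open>d\<close> stays in \<open>a \<odot> b\<close>
  by \<open>comp_fixed_shift\<close>. By \<open>comp_difference\<close> it is also a shift of \<open>c\<close> by a multiple of \<open>index x y\<close>,
  so \<open>d\<close> is congruent to such a multiple modulo \<open>index x z\<close>.\<close>

lemma index_gcd_dvd:
  assumes "x \<in> I" "y \<in> I" "z \<in> I" "hom x y \<noteq> {}" "hom y z \<noteq> {}"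
  shows "gcd (index x y) (index x z) dvd index y z"
proof -
  obtain a b where ab: "a \<in> hom x y" "b \<in> hom y z" using assms by blast
  obtain c where c: "c \<in> a \<odot> b" using comp_nonempty ab assms by blast
  then have ch: "c \<in> hom x z" using comp_hom ab assms by blast
  define d where "d = gcd (index x y) (index y z)"
  have "lact x (int d) a \<odot> b = a \<odot> b"
    using comp_fixed_shift[OF assms(1-3) ab, of "int d"] by (simp add: d_def)
  then have "lact x (int d) c \<in> a \<odot> b" using comp_lact[OF assms(1-3) ab, of "int d"] c by blast
  then obtain i where i: "lact x (int d) c = lact x i c" "int (index x y) dvd i"
    using comp_difference[OF assms(1-3) ab c] by blast
  have "int (index x z) dvd int d - i" using i lact_eq_iff[OF assms(1,3) ch] by blast
  then have "int (gcd (index x y) (index x z)) dvd (int d - i) + i"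
    using i(2) by (meson dvd_add dvd_trans gcd_dvd1 gcd_dvd2 int_dvd_int_iff)
  then have "gcd (index x y) (index x z) dvd d" by simp
  then show ?thesis unfolding d_def by (meson dvd_trans gcd_dvd2)
qed

lemma hom_trans:
  "\<lbrakk>x \<in> I; y \<in> I; z \<in> I; hom x y \<noteq> {}; hom y z \<noteq> {}\<rbrakk> \<Longrightarrow> hom x z \<noteq> {}"
  using comp_nonempty comp_hom by blast

lemma hom_sym: "\<lbrakk>x \<in> I; y \<in> I; hom x y \<noteq> {}\<rbrakk> \<Longrightarrow> hom y x \<noteq> {}"
  using cv_hom by blast

text \<open>The divisibility \<open>index_gcd_dvd\<close> for all three orderings of the triangle.\<close>

lemma index_gcds:
  assumes "x \<in> I" "y \<in> I" "z \<in> I" "hom x y \<noteq> {}" "hom y z \<noteq> {}"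
  shows "gcd (index x y) (index x z) = gcd (index x y) (index y z)"
    "gcd (index x y) (index x z) = gcd (index x z) (index y z)"
proof -
  have xz: "hom x z \<noteq> {}" using hom_trans assms by blast
  have 1: "gcd (index x y) (index x z) dvd index y z" using index_gcd_dvd assms by blast
  have 2: "gcd (index x y) (index y z) dvd index x z"
    using index_gcd_dvd[of y x z] assms hom_sym index_commute xz by metis
  have 3: "gcd (index x z) (index y z) dvd index x y"
    using index_gcd_dvd[of z x y] assms hom_sym index_commute xz by metis
  show "gcd (index x y) (index x z) = gcd (index x y) (index y z)"
    using 1 2 by (simp add: gcd_nat.antisym)
  show "gcd (index x y) (index x z) = gcd (index x z) (index y z)"
    using 1 3 by (simp add: gcd_nat.antisym)
qed

text \<open>This describes \<open>a \<odot> b\<close> completely, since \<open>hom x z\<close> is a single orbit.\<close>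

lemma comp_eq:
  assumes "x \<in> I" "y \<in> I" "z \<in> I" "a \<in> hom x y" "b \<in> hom y z" "c \<in> a \<odot> b"
  shows "lact x i c \<in> a \<odot> b \<longleftrightarrow> int (gcd (index x y) (index x z)) dvd i"
proof
  have ch: "c \<in> hom x z" using comp_hom assms by blast
  { assume "lact x i c \<in> a \<odot> b"
    then obtain j where j: "lact x i c = lact x j c" "int (index x y) dvd j"
      using comp_difference[OF assms] by blast
    then have "int (index x z) dvd i - j" using lact_eq_iff[OF assms(1,3) ch] by blast
    then have "int (gcd (index x y) (index x z)) dvd (i - j) + j"
      using j(2) by (meson dvd_add dvd_trans gcd_dvd1 gcd_dvd2 int_dvd_int_iff)
    then show "int (gcd (index x y) (index x z)) dvd i" by simp }
  assume "int (gcd (index x y) (index x z)) dvd i"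
  moreover have "gcd (index x y) (index x z) = gcd (index x y) (index y z)"
    using assms(4,5) by (intro index_gcds(1)[OF assms(1-3)]) auto
  ultimately have "lact x i a \<odot> b = a \<odot> b"
    using comp_fixed_shift[OF assms(1-5), of i] by simp
  then show "lact x i c \<in> a \<odot> b" using comp_lact[OF assms(1-5), of i] assms(6) by blast
qed

end

section \<open>Compatible generators and a coherent network of atoms\<close>

text \<open>For abelian groups, left multiplication by \<open>p\<close> induces on \<open>hom x y\<close> a map that commutes
  with both actions, so it is enough to compare \<open>p \<odot> a\<close> and \<open>a \<odot> q\<close> for one atom \<open>a\<close>; the
  quantifier makes the notion independent of that atom.\<close>

definition (in measured_atoms) compatible :: "'a \<Rightarrow> 'a \<Rightarrow> 'a \<Rightarrow> 'a \<Rightarrow> bool" where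
  "compatible x y p q \<longleftrightarrow> (\<forall>a\<in>hom x y. p \<odot> a = a \<odot> q)"

lemma (in measured_atoms) cv_id:
  assumes x: "x \<in> I"
  shows "cv x = x"
  using peirce_right[OF x x x id_hom[OF x] id_hom[OF x], of x] id_left[OF x x id_hom[OF x]]
    id_right[OF x x cv_hom[OF x x id_hom[OF x]]] by simp

context generated_atoms
begin

lemma gpow_eq_iff:
  assumes "x \<in> I"
  shows "gpow x i = gpow x j \<longleftrightarrow> int (index x x) dvd i - j"
proof -
  have "lact x i x = gpow x i" for i
    using lact_comp(1)[OF assms assms id_hom[OF assms], of i]
      id_right[OF assms assms gpow_hom[OF assms, of i]] by simp
  then show ?thesis using lact_eq_iff[OF assms assms id_hom[OF assms], of i j] by simp
qed

lemma gpow_gpow: "x \<in> I \<Longrightarrow> gpow x i [^]\<^bsub>G x\<^esub> (j::int) = gpow x (i * j)"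
  using group.int_pow_pow[OF group_G, of x "g x" i j] G_carrier g_hom by simp

lemma generator_gpow:
  assumes "x \<in> I" "coprime t (int (index x x))"
  shows "generator x (gpow x t)"
  unfolding generator_def
proof (intro conjI ballI)
  show "gpow x t \<in> hom x x" using gpow_hom assms by blast
  fix q assume "q \<in> hom x x"
  then obtain k where k: "q = gpow x k" using hom_gpow assms by blast
  obtain u v where uv: "u * t + v * int (index x x) = 1"
    using bezout_int[of t "int (index x x)"] assms(2) by auto
  have "t * (u * k) - k = (u * t + v * int (index x x) - 1) * k + int (index x x) * (- v * k)"
    by (simp add: algebra_simps)
  then have "t * (u * k) - k = int (index x x) * (- v * k)" unfolding uv by simp
  then have "gpow x (t * (u * k)) = q" using k gpow_eq_iff[OF assms(1)] by simp
  then show "\<exists>i::int. q = gpow x t [^]\<^bsub>G x\<^esub> i" using gpow_gpow[OF assms(1)] by metis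
qed

lemma compatible_gpow_iff:
  assumes "x \<in> I" "y \<in> I"
  shows "compatible x y (gpow x s) (gpow y t) \<longleftrightarrow> (\<forall>a\<in>hom x y. lact x s a = ract y t a)"
  unfolding compatible_def using lact_comp(1)[OF assms] ract_comp(1)[OF assms] by auto

lemma compatible_sym:
  assumes x: "x \<in> I" "y \<in> I" and p: "p \<in> hom x x" "q \<in> hom y y" and c: "compatible x y p q"
  shows "compatible y x q p"
proof -
  obtain s t where st: "p = gpow x s" "q = gpow y t" using hom_gpow x p by metis
  have eq: "lact x s a = ract y t a" if "a \<in> hom x y" for a
    using c that compatible_gpow_iff[OF x] st by blast
  have "lact y t a = ract x s a" if a: "a \<in> hom y x" for a
  proof -
    have ca: "cv a \<in> hom x y" using cv_hom x a by blast
    have la: "lact y (- t) a \<in> hom y x" using lact_comp(2)[OF x(2,1) a] .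
    have "ract x (- s) a = cv (ract y t (cv a))" using eq[OF ca] by (simp add: ract_def)
    also have "\<dots> = lact y (- t) a"
      using cv_cv[OF x(2,1) la] cv_cv[OF x(2,1) a] by (simp add: ract_def)
    finally have "ract x s (ract x (- s) a) = ract x s (lact y (- t) a)" by simp
    then have "a = ract x s (lact y (- t) a)"
      using ract_add[OF x(2,1) a, of s "- s"] ract_0[OF x(2,1) a] by simp
    then have "lact y t a = ract x s (lact y t (lact y (- t) a))"
      using lact_ract[OF x(2,1) la] by metis
    then show ?thesis using lact_add[OF x(2,1) a, of t "- t"] lact_0[OF x(2,1) a] by simp
  qed
  then show ?thesis using st compatible_gpow_iff[OF x(2,1)] by blast
qed

lemma compatible_refl:
  assumes x: "x \<in> I" and p: "p \<in> hom x x"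
  shows "compatible x x p p"
proof -
  obtain s where s: "p = gpow x s" using hom_gpow x p by metis
  have "p \<odot> a = a \<odot> p" if a: "a \<in> hom x x" for a
  proof -
    obtain k where k: "a = gpow x k" using hom_gpow x a by metis
    show ?thesis
      using G_mult[OF x p a] G_mult[OF x a p] gpow_add[OF x, of s k] gpow_add[OF x, of k s] s k
      by (simp add: add.commute)
  qed
  then show ?thesis by (simp add: compatible_def)
qed

text \<open>Let \<open>w y\<close> be an exponent such that \<open>g x\<close> to the power \<open>w y\<close> acts on \<open>hom x y\<close> as \<open>h y\<close> does from the
  right. The element sought is \<open>g x\<close> to some power \<open>t\<close> with \<open>t\<close> congruent to all \<open>w y\<close> modulo
  \<open>index x y\<close>. The congruences are consistent because an atom of \<open>hom y z\<close> transports the action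
  of \<open>h y\<close> to the action of \<open>h z\<close>; \<open>w y\<close> is a unit because \<open>h y\<close> generates its group.\<close>

lemma extend_generator:
  assumes x: "x \<in> I" and J: "J \<subseteq> I" "\<And>y. y \<in> J \<Longrightarrow> hom x y \<noteq> {}"
    and h: "\<And>y. y \<in> J \<Longrightarrow> generator y (h y)"
    and compat: "\<And>y z. \<lbrakk>y \<in> J; z \<in> J\<rbrakk> \<Longrightarrow> compatible y z (h y) (h z)"
  shows "\<exists>p. generator x p \<and> (\<forall>y\<in>J. compatible x y p (h y))"
proof -
  have "\<forall>y\<in>J. \<exists>s. h y = gpow y s" using h hom_gpow J(1) unfolding generator_def by blast
  then obtain s where s: "\<And>y. y \<in> J \<Longrightarrow> h y = gpow y (s y)" by metis
  have "\<forall>y\<in>J. \<exists>a. a \<in> hom x y" using J(2) by blast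
  then obtain b where b: "\<And>y. y \<in> J \<Longrightarrow> b y \<in> hom x y" by metis
  have "\<forall>y\<in>J. \<exists>w. ract y (s y) (b y) = lact x w (b y)"
    using lact_transitive[OF x] ract_comp(2)[OF x] b J(1) by blast
  then obtain w where w: "\<And>y. y \<in> J \<Longrightarrow> ract y (s y) (b y) = lact x (w y) (b y)" by metis
  \<comment> \<open>The groups are abelian, so the exponent \<open>w y\<close> serves every atom of \<open>hom x y\<close>.\<close>
  have wall: "ract y (s y) a = lact x (w y) a" if y: "y \<in> J" and a: "a \<in> hom x y" for y a
  proof -
    have yI: "y \<in> I" using J y by blast
    obtain i where i: "a = lact x i (b y)" using lact_transitive[OF x yI b[OF y] a] by blast
    have "ract y (s y) a = lact x i (lact x (w y) (b y))"
      unfolding i w[OF y, symmetric] lact_ract[OF x yI b[OF y]] ..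
    also have "\<dots> = lact x (w y) a"
      using lact_add[OF x yI b[OF y], of i "w y"] lact_add[OF x yI b[OF y], of "w y" i] i
      by (simp add: add.commute)
    finally show ?thesis .
  qed
  have "\<exists>t. coprime t (int (index x x)) \<and> (\<forall>y\<in>J. int (index x y) dvd t - w y)"
  proof (rule solve_congruences_coprime)
    show "index x x > 0" using index_pos[OF x x] id_hom[OF x] by blast
    fix y assume y: "y \<in> J"
    then have yI: "y \<in> I" using J by blast
    show "index x y dvd index x x" using index_dvd[OF x yI J(2)[OF y]] .
    show "coprime (w y) (int (index x y))"
    proof -
      have "g y \<in> hom y y" using g_hom yI by blast
      then obtain k where "g y = h y [^]\<^bsub>G y\<^esub> (k::int)" using h[OF y] unfolding generator_def by blast
      then have "gpow y 1 = gpow y (s y * k)"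
        using s[OF y] gpow_gpow[OF yI] group.int_pow_1[OF group_G[OF yI]] G_carrier[OF yI] g_hom[OF yI]
        by metis
      then have k: "ract y 1 (b y) = ract y (s y * k) (b y)"
        using ract_comp(1)[OF x yI b[OF y]] by (metis singleton_inject)
      obtain u where u: "\<And>i. lact x i (b y) = ract y (u * i) (b y)"
        using lact_as_ract[OF x yI b[OF y]] by blast
      have d1: "int (index x y) dvd s y - u * w y"
        using w[OF y] u ract_eq_iff[OF x yI b[OF y]] by metis
      have d2: "int (index x y) dvd 1 - s y * k"
        using k ract_eq_iff[OF x yI b[OF y]] by blast
      have "int (index x y) dvd (1 - s y * k) + (s y - u * w y) * k"
        using d1 d2 by (meson dvd_add dvd_mult2)
      then have d: "int (index x y) dvd 1 - w y * (u * k)" by (simp add: algebra_simps)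
      show ?thesis
      proof (rule coprimeI)
        fix c assume c: "c dvd w y" "c dvd int (index x y)"
        have "c dvd (1 - w y * (u * k)) + w y * (u * k)"
          using c d by (meson dvd_add dvd_mult2 dvd_trans)
        then show "is_unit c" by simp
      qed
    qed
    fix z assume z: "z \<in> J"
    then have zI: "z \<in> I" using J by blast
    have "hom y z \<noteq> {}" using hom_trans[OF yI x zI] hom_sym[OF x yI] J(2) y z by blast
    then obtain e where e: "e \<in> hom y z" by blast
    obtain c where c: "c \<in> b y \<odot> e" using comp_nonempty[OF x yI zI b[OF y] e] by blast
    have ch: "c \<in> hom x z" using comp_hom[OF x yI zI b[OF y] e c] .
    let ?a = "lact x (w y) (b y)"
    have ah: "?a \<in> hom x y" using lact_comp(2)[OF x yI b[OF y]] .
    have c1: "lact x (w y) c \<in> ?a \<odot> e" using comp_lact[OF x yI zI b[OF y] e] c by blast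
    have "lact y (s y) e = ract z (s z) e"
      using compat[OF y z] s[OF y] s[OF z] compatible_gpow_iff[OF yI zI] e by simp
    then have "?a \<odot> e = ract z (s z) ` (b y \<odot> e)"
      using w[OF y] comp_middle[OF x yI zI b[OF y] e] comp_ract[OF x yI zI b[OF y] e] by metis
    then have c2: "lact x (w z) c \<in> ?a \<odot> e" using wall[OF z ch] c by (metis imageI)
    have "lact x (w y - w z) (lact x (w z) c) = lact x (w y) c"
      using lact_add[OF x zI ch, of "w y - w z" "w z"] by simp
    then show "int (gcd (index x y) (index x z)) dvd w y - w z"
      using comp_eq[OF x yI zI ah e c2, of "w y - w z"] c1 by simp
  qed
  then obtain t where t: "coprime t (int (index x x))"
    "\<And>y. y \<in> J \<Longrightarrow> int (index x y) dvd t - w y" by blast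
  have "compatible x y (gpow x t) (h y)" if y: "y \<in> J" for y
  proof -
    have yI: "y \<in> I" using J y by blast
    have "lact x t a = ract y (s y) a" if "a \<in> hom x y" for a
      using wall[OF y that] lact_eq_iff[OF x yI that, of t "w y"] t(2)[OF y] by simp
    then show ?thesis using compatible_gpow_iff[OF x yI] s[OF y] by simp
  qed
  then show ?thesis using generator_gpow[OF x t(1)] by blast
qed

end

lemma total_wf_relation:
  obtains W :: "('a \<times> 'a) set" where "wf W" "\<And>x y. x \<noteq> y \<Longrightarrow> (x, y) \<in> W \<or> (y, x) \<in> W"
proof -
  obtain r :: "('a \<times> 'a) set" where r: "well_order_on UNIV r" using well_order_on by blast
  then have "wf (r - Id)" "total_on UNIV r" by (auto simp: well_order_on_def linear_order_on_def)
  then show thesis using that[of "r - Id"] by (auto simp: total_on_def)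
qed

text \<open>Recursion along a well-ordering; at stage \<open>x\<close> the earlier elements that are connected with \<open>x\<close>
  are pairwise compatible by the induction hypothesis.\<close>

lemma (in generated_atoms) compatible_generators:
  "\<exists>h. (\<forall>x\<in>I. generator x (h x)) \<and> (\<forall>x\<in>I. \<forall>y\<in>I. compatible x y (h x) (h y))"
proof -
  obtain W :: "('a \<times> 'a) set" where W: "wf W" "\<And>x y. x \<noteq> y \<Longrightarrow> (x, y) \<in> W \<or> (y, x) \<in> W"
    using total_wf_relation by blast
  define P where "P f x p \<longleftrightarrow> (x \<in> I \<longrightarrow> generator x p \<and>
      (\<forall>y\<in>I. (y, x) \<in> W \<longrightarrow> compatible x y p (f y)))" for f x p
  have all: "compatible y z (f y) (f z)"
    if "y \<in> I" "z \<in> I" "P f y (f y)" "P f z (f z)" for f y z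
  proof -
    have h: "f y \<in> hom y y" "f z \<in> hom z z" using that by (auto simp: P_def generator_def)
    consider "y = z" | "(z, y) \<in> W" | "(y, z) \<in> W" using W(2) by blast
    then show ?thesis
    proof cases
      case 1 then show ?thesis using compatible_refl that h by simp
    next
      case 2 then show ?thesis using that by (simp add: P_def)
    next
      case 3
      then have "compatible z y (f z) (f y)" using that by (simp add: P_def)
      then show ?thesis using compatible_sym[of z y] that h by blast
    qed
  qed
  have "\<exists>f. \<forall>x. P f x (f x)"
  proof (rule dependent_wf_choice[OF W(1)])
    show "P f x r = P g x r" if "\<And>z. (z, x) \<in> W \<Longrightarrow> f z = g z" for f g x r
      using that by (auto simp: P_def)
    fix x f assume IH: "\<And>y. (y, x) \<in> W \<Longrightarrow> P f y (f y)"
    show "\<exists>r. P f x r"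
    proof (cases "x \<in> I")
      case True
      define J where "J = {y \<in> I. (y, x) \<in> W \<and> hom x y \<noteq> {}}"
      have "\<exists>p. generator x p \<and> (\<forall>y\<in>J. compatible x y p (f y))"
      proof (rule extend_generator[OF True])
        show "J \<subseteq> I" "\<And>y. y \<in> J \<Longrightarrow> hom x y \<noteq> {}" by (auto simp: J_def)
        show "generator y (f y)" if "y \<in> J" for y
          using IH[of y] that by (simp add: J_def P_def)
        show "compatible y z (f y) (f z)" if "y \<in> J" "z \<in> J" for y z
          using all[of y z f] IH[of y] IH[of z] that by (simp add: J_def)
      qed
      moreover have "compatible x y p q" if "hom x y = {}" for y p q
        using that by (simp add: compatible_def)
      ultimately show ?thesis unfolding P_def J_def by blast
    qed (simp add: P_def)
  qed
  then obtain f where f: "\<And>x. P f x (f x)" by blast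
  have "generator x (f x)" if "x \<in> I" for x using f[of x] that by (simp add: P_def)
  moreover have "compatible x y (f x) (f y)" if "x \<in> I" "y \<in> I" for x y
    using all[OF that f f] .
  ultimately show ?thesis by blast
qed

locale compatible_atoms = generated_atoms +
  assumes compatible: "\<lbrakk>x \<in> I; y \<in> I\<rbrakk> \<Longrightarrow> compatible x y (g x) (g y)"
begin

lemma lact_is_ract:
  assumes "x \<in> I" "y \<in> I" "a \<in> hom x y"
  shows "lact x i a = ract y i a"
proof -
  have "compatible x y (gpow x 1) (gpow y 1)"
    using compatible[OF assms(1,2)] group.int_pow_1[OF group_G] G_carrier g_hom assms by metis
  then have "lact x 1 a = ract y 1 a" using compatible_gpow_iff assms by blast
  then show ?thesis using lact_power_ract[OF assms, of 1 i] by simp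
qed

lemma comp_lact_right:
  assumes "x \<in> I" "y \<in> I" "z \<in> I" "a \<in> hom x y" "b \<in> hom y z"
  shows "a \<odot> lact y i b = lact x i ` (a \<odot> b)"
proof -
  have "a \<odot> lact y i b = lact x i a \<odot> b"
    using lact_is_ract comp_middle[OF assms] assms by simp
  then show ?thesis using comp_lact[OF assms] by simp
qed

text \<open>Start with arbitrary atoms \<open>b y\<close> of \<open>hom x y\<close> and shift them by \<open>s y\<close>. The triangle over \<open>y\<close>, \<open>z\<close>
  closes after a correction by some \<open>c y z\<close>, unique modulo \<open>gcd (index x y) (index x z)\<close>. Associativity
  makes \<open>c\<close> a cocycle, and the shifts \<open>s\<close> have to trivialize it.\<close>

lemma extend_network:
  assumes x: "x \<in> I" and J: "J \<subseteq> I" "\<And>y. y \<in> J \<Longrightarrow> hom x y \<noteq> {}"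
    and w: "\<And>y z. \<lbrakk>y \<in> J; z \<in> J\<rbrakk> \<Longrightarrow> w y z \<in> hom y z"
    and tri: "\<And>y z v. \<lbrakk>y \<in> J; z \<in> J; v \<in> J\<rbrakk> \<Longrightarrow> w y v \<in> w y z \<odot> w z v"
  shows "\<exists>r. (\<forall>y\<in>J. r y \<in> hom x y) \<and> (\<forall>y\<in>J. \<forall>z\<in>J. r z \<in> r y \<odot> w y z)"
proof -
  have JI: "y \<in> I" if "y \<in> J" for y using that J by blast
  have "\<forall>y\<in>J. \<exists>a. a \<in> hom x y" using J(2) by blast
  then obtain b where b: "\<And>y. y \<in> J \<Longrightarrow> b y \<in> hom x y" by metis
  \<comment> \<open>The correction that closes the triangle over \<open>y\<close> and \<open>z\<close>.\<close>
  have "\<exists>c. lact x c (b z) \<in> b y \<odot> w y z" if yz: "y \<in> J" "z \<in> J" for y z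
  proof -
    note yI = JI[OF yz(1)] and zI = JI[OF yz(2)]
    obtain e where e: "e \<in> b y \<odot> w y z"
      using comp_nonempty[OF x yI zI b[OF yz(1)] w[OF yz]] by blast
    then have "e \<in> hom x z" using comp_hom[OF x yI zI b[OF yz(1)] w[OF yz]] by blast
    then show ?thesis using lact_transitive[OF x zI b[OF yz(2)]] e by blast
  qed
  then obtain c where c: "\<And>y z. \<lbrakk>y \<in> J; z \<in> J\<rbrakk> \<Longrightarrow> lact x (c y z) (b z) \<in> b y \<odot> w y z" by metis
  have "\<exists>s. \<forall>y\<in>J. \<forall>z\<in>J. int (gcd (index x y) (index x z)) dvd s z - s y - c y z"
  proof (rule trivialize_cocycle)
    show "index x x > 0" using index_pos[OF x x] id_hom[OF x] by blast
    show "index x y dvd index x x" if "y \<in> J" for y using index_dvd[OF x JI J(2)] that by blast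
    fix y z v assume yzv: "y \<in> J" "z \<in> J" "v \<in> J"
    note yI = JI[OF yzv(1)] and zI = JI[OF yzv(2)] and vI = JI[OF yzv(3)]
    note bb = b[OF yzv(1)] and bz = b[OF yzv(2)] and bv = b[OF yzv(3)]
    note wyz = w[OF yzv(1,2)] and wzv = w[OF yzv(2,3)] and wyv = w[OF yzv(1,3)]
    have "lact x (c y z) (lact x (c z v) (b v)) \<in> lact x (c y z) (b z) \<odot> w z v"
      using comp_lact[OF x zI vI bz wzv] c[OF yzv(2,3)] by blast
    then have "lact x (c y z + c z v) (b v) \<in> (\<Union>e\<in>b y \<odot> w y z. e \<odot> w z v)"
      using lact_add[OF x vI bv] c[OF yzv(1,2)] by auto
    also have "\<dots> = (\<Union>e\<in>w y z \<odot> w z v. b y \<odot> e)" using assoc[OF x yI zI vI bb wyz wzv] .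
    finally obtain e where e: "e \<in> w y z \<odot> w z v" "lact x (c y z + c z v) (b v) \<in> b y \<odot> e" by blast
    obtain i where i: "e = lact y i (w y v)" "int (index y z) dvd i"
      using comp_difference[OF yI zI vI wyz wzv tri[OF yzv] e(1)] by blast
    have "b y \<odot> e = lact x i ` (b y \<odot> w y v)" using comp_lact_right[OF x yI vI bb wyv] i by simp
    then obtain e' where e': "e' \<in> b y \<odot> w y v" "lact x (c y z + c z v) (b v) = lact x i e'"
      using e(2) by auto
    obtain j where j: "e' = lact x j (lact x (c y v) (b v))" "int (index x y) dvd j"
      using comp_difference[OF x yI vI bb wyv c[OF yzv(1,3)] e'(1)] by blast
    have "lact x (c y z + c z v) (b v) = lact x (i + (j + c y v)) (b v)"
      using e'(2) j(1) lact_add[OF x vI bv] by simp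
    then have "int (index x v) dvd (c y z + c z v) - (i + (j + c y v))"
      using lact_eq_iff[OF x vI bv] by blast
    moreover let ?d = "int (gcd (index x y) (gcd (index x z) (index x v)))"
    have "gcd (index x y) (index x z) dvd index y z"
      using index_gcd_dvd[OF x yI zI J(2)[OF yzv(1)]] wyz by blast
    then have "gcd (index x y) (gcd (index x z) (index x v)) dvd index y z"
      by (metis dvd_trans gcd.assoc gcd_dvd1)
    then have "?d dvd i" using i(2) by (meson dvd_trans int_dvd_int_iff)
    moreover have "?d dvd j" using j(2) by (meson dvd_trans gcd_dvd1 int_dvd_int_iff)
    moreover have "?d dvd int (index x v)" by (meson dvd_trans gcd_dvd2 int_dvd_int_iff)
    ultimately have "?d dvd ((c y z + c z v) - (i + (j + c y v))) + (i + j)"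
      by (meson dvd_add dvd_trans)
    then show "?d dvd c y z + c z v - c y v" by (simp add: algebra_simps)
  qed
  then obtain s where s: "\<And>y z. \<lbrakk>y \<in> J; z \<in> J\<rbrakk> \<Longrightarrow>
      int (gcd (index x y) (index x z)) dvd s z - s y - c y z" by blast
  define r where "r y = lact x (s y) (b y)" for y
  have "r z \<in> r y \<odot> w y z" if yz: "y \<in> J" "z \<in> J" for y z
  proof -
    note yI = JI[OF yz(1)] and zI = JI[OF yz(2)]
    note bb = b[OF yz(1)] and bz = b[OF yz(2)]
    have "lact x (s z - s y - c y z) (lact x (c y z) (b z)) \<in> b y \<odot> w y z"
      using comp_eq[OF x yI zI bb w[OF yz] c[OF yz]] s[OF yz] by blast
    then have "lact x (s y) (lact x (s z - s y - c y z) (lact x (c y z) (b z))) \<in> r y \<odot> w y z"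
      using comp_lact[OF x yI zI bb w[OF yz]] unfolding r_def by blast
    moreover have "lact x (s y) (lact x (s z - s y - c y z) (lact x (c y z) (b z))) = r z"
      using lact_add[OF x zI bz, symmetric] by (simp add: r_def)
    ultimately show ?thesis by simp
  qed
  moreover have "r y \<in> hom x y" if "y \<in> J" for y
    unfolding r_def using lact_comp(2)[OF x JI b] that by blast
  ultimately show ?thesis by blast
qed

text \<open>The recursion chooses at stage \<open>x\<close> only the atoms \<open>f x y\<close> for earlier \<open>y\<close>. The family \<open>w f\<close> extends
  this choice to all pairs by converses, and \<open>P f x r\<close> says that \<open>r\<close> fits to the earlier choices. All
  triangles then close because the condition on a triangle is invariant under permutations of
  its vertices, so that the latest vertex may be put first.\<close>

lemma network_exists:
  "\<exists>a. (\<forall>x\<in>I. \<forall>y\<in>I. hom x y \<noteq> {} \<longrightarrow> a x y \<in> hom x y) \<and>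
    (\<forall>x\<in>I. \<forall>y\<in>I. \<forall>z\<in>I. hom x y \<noteq> {} \<longrightarrow> hom y z \<noteq> {} \<longrightarrow> a x z \<in> a x y \<odot> a y z)"
proof -
  obtain W :: "('a \<times> 'a) set" where W: "wf W" "\<And>x y. x \<noteq> y \<Longrightarrow> (x, y) \<in> W \<or> (y, x) \<in> W"
    using total_wf_relation by blast
  have irr: "(x, x) \<notin> W" for x using W(1) by (simp add: wf_not_refl)
  have asym: "(x, y) \<in> W \<Longrightarrow> (y, x) \<notin> W" for x y using W(1) by (meson wf_not_sym)
  have trans: "(x, y) \<in> W \<Longrightarrow> (y, z) \<in> W \<Longrightarrow> (x, z) \<in> W" for x y z
  proof -
    assume *: "(x, y) \<in> W" "(y, z) \<in> W"
    have "\<not> (x = z)" using * asym by blast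
    moreover have "(z, x) \<notin> W"
    proof
      assume "(z, x) \<in> W"
      then show False using * W(1) wfE_min[of W x "{x, y, z}"] by blast
    qed
    ultimately show ?thesis using W(2) by blast
  qed
  define w where "w f y z = (if y = z then y else if (z, y) \<in> W then f y z else cv (f z y))"
    for f :: "'a \<Rightarrow> 'a \<Rightarrow> 'a" and y z
  define B where "B x = {y \<in> I. (y, x) \<in> W \<and> hom x y \<noteq> {}}" for x
  define P where "P f x r \<longleftrightarrow> (x \<in> I \<longrightarrow> (\<forall>y\<in>B x. r y \<in> hom x y) \<and>
      (\<forall>y\<in>B x. \<forall>z\<in>B x. r z \<in> r y \<odot> w f y z))" for f x r
  have w_hom: "w f y z \<in> hom y z"
    if "y \<in> I" "z \<in> I" "hom y z \<noteq> {}" "P f y (f y)" "P f z (f z)" for f y z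
    using that W(2)[of y z] id_hom hom_sym[of y z] cv_hom[of z y "f z y"]
    by (auto simp: w_def P_def B_def)
  have w_cv: "w f z y = cv (w f y z)"
    if "y \<in> I" "z \<in> I" "hom y z \<noteq> {}" "P f y (f y)" "P f z (f z)" for f y z
  proof (cases "y = z")
    case True
    then show ?thesis using cv_id that by (simp add: w_def)
  next
    case False
    have "cv (cv (f z y)) = f z y" if "(z, y) \<notin> W"
    proof (rule cv_cv)
      show "f z y \<in> hom z y" using that \<open>P f z (f z)\<close> False W(2)[of y z] \<open>y \<in> I\<close> \<open>z \<in> I\<close>
          \<open>hom y z \<noteq> {}\<close> hom_sym[of y z] by (auto simp: P_def B_def)
    qed (use \<open>y \<in> I\<close> \<open>z \<in> I\<close> in auto)
    then show ?thesis using False W(2) asym by (auto simp: w_def)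
  qed
  have triangle: "w f y v \<in> w f y z \<odot> w f z v"
    if I: "y \<in> I" "z \<in> I" "v \<in> I" and h: "hom y z \<noteq> {}" "hom z v \<noteq> {}"
      and P: "P f y (f y)" "P f z (f z)" "P f v (f v)" for f y z v
  proof -
    have swap: "w f y v \<in> w f y z \<odot> w f z v \<and> w f z y \<in> w f z v \<odot> w f v y"
      if I: "y \<in> I" "z \<in> I" "v \<in> I" and h: "hom y z \<noteq> {}" "hom z v \<noteq> {}"
      and P: "P f y (f y)" "P f z (f z)" "P f v (f v)" 
      and m: "w f z v \<in> w f z y \<odot> w f y v" for y z v
    proof -
      have yv: "hom y v \<noteq> {}" using hom_trans I h by blast
      have zy: "hom z y \<noteq> {}" using hom_sym I h by blast
      have wh: "w f z y \<in> hom z y" "w f y v \<in> hom y v" using w_hom I zy yv P by blast+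
      have "w f y v \<in> cv (w f z y) \<odot> w f z v" using peirce_right[OF I(2,1,3) wh m] .
      moreover have "w f z y \<in> w f z v \<odot> cv (w f y v)" using peirce_left[OF I(2,1,3) wh m] .
      ultimately show ?thesis using w_cv[OF I(2,1) zy P(2,1)] w_cv[OF I(1,3) yv P(1,3)] by simp
    qed
    have yv: "hom y v \<noteq> {}" using hom_trans I h by blast
    have zy: "hom z y \<noteq> {}" and vz: "hom v z \<noteq> {}" and vy: "hom v y \<noteq> {}" using hom_sym I h yv by blast+
    have yz': "w f y z \<in> hom y z" "w f z v \<in> hom z v" "w f y v \<in> hom y v" using w_hom I h yv P by blast+
    have direct: "w f y v \<in> w f y z \<odot> w f z v"
      if "y \<in> I" "z \<in> I" "v \<in> I" "hom y z \<noteq> {}" "hom y v \<noteq> {}" "(z, y) \<in> W" "(v, y) \<in> W" "P f y (f y)" for y z v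
    proof -
      have "z \<in> B y" "v \<in> B y" using that by (auto simp: B_def)
      then have "f y v \<in> f y z \<odot> w f z v" using that by (auto simp: P_def)
      moreover have "y \<noteq> z" "y \<noteq> v" using that irr by auto
      ultimately show ?thesis using that by (simp add: w_def)
    qed
    consider "y = z" | "z = v" | "y = v" | "(z, y) \<in> W" "(v, y) \<in> W"
      | "(y, z) \<in> W" "(v, z) \<in> W" | "(y, v) \<in> W" "(z, v) \<in> W"
      using W(2) trans by metis
    then show ?thesis
    proof cases
      case 1 then show ?thesis using id_left[OF I(1,3) yz'(3)] by (simp add: w_def)
    next
      case 2 then show ?thesis using id_right[OF I(1,2) yz'(1)] by (simp add: w_def)
    next
      case 3
      have "w f y z \<in> y \<odot> w f y z" using id_left[OF I(1,2) yz'(1)] by simp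
      then have "y \<in> w f y z \<odot> cv (w f y z)"
        using peirce_left[OF I(1,1,2) id_hom[OF I(1)] yz'(1)] by blast
      then show ?thesis using 3 w_cv[OF I(1,2) h(1) P(1,2)] by (simp add: w_def)
    next
      case 4 then show ?thesis using direct[OF I h(1) yv] P by blast
    next
      case 5
      then have "w f z v \<in> w f z y \<odot> w f y v" using direct[OF I(2,1,3) zy h(2)] P by blast
      then show ?thesis using swap[OF I h P] by blast
    next
      case 6
      then have "w f v z \<in> w f v y \<odot> w f y z" using direct[OF I(3,1,2) vy vz] P by blast
      then have "w f y z \<in> w f y v \<odot> w f v z" using swap[OF I(1,3,2) yv vz P(1,3,2)] by blast
      then show ?thesis using swap[OF I(3,1,2) vy h(1) P(3,1,2)] by blast
    qed
  qed
  have "\<exists>f. \<forall>x. P f x (f x)"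
  proof (rule dependent_wf_choice[OF W(1)])
    fix f f' :: "'a \<Rightarrow> 'a \<Rightarrow> 'a" and x r
    assume eq: "\<And>z. (z, x) \<in> W \<Longrightarrow> f z = f' z"
    have "w f y z = w f' y z" if "y \<in> B x" "z \<in> B x" for y z
      using that eq by (simp add: w_def B_def)
    then show "P f x r = P f' x r" by (simp add: P_def)
  next
    fix x f assume IH: "\<And>y. (y, x) \<in> W \<Longrightarrow> P f y (f y)"
    show "\<exists>r. P f x r"
    proof (cases "x \<in> I")
      case True
      have BI: "y \<in> I" "hom x y \<noteq> {}" "P f y (f y)" if "y \<in> B x" for y
        using that IH by (auto simp: B_def)
      have con: "hom y z \<noteq> {}" if "y \<in> B x" "z \<in> B x" for y z
        using BI[OF that(1)] BI[OF that(2)] True hom_trans[of y x z] hom_sym[of x y] by blast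
      have "\<exists>r. (\<forall>y\<in>B x. r y \<in> hom x y) \<and> (\<forall>y\<in>B x. \<forall>z\<in>B x. r z \<in> r y \<odot> w f y z)"
      proof (rule extend_network[OF True])
        show "B x \<subseteq> I" "\<And>y. y \<in> B x \<Longrightarrow> hom x y \<noteq> {}" using BI by blast+
        show "w f y z \<in> hom y z" if "y \<in> B x" "z \<in> B x" for y z
          using BI[OF that(1)] BI[OF that(2)] con[OF that] by (intro w_hom) simp_all
        show "w f y v \<in> w f y z \<odot> w f z v" if "y \<in> B x" "z \<in> B x" "v \<in> B x" for y z v
          using BI[OF that(1)] BI[OF that(2)] BI[OF that(3)] con[OF that(1,2)] con[OF that(2,3)]
          by (intro triangle) simp_all
      qed
      then show ?thesis by (auto simp: P_def)
    qed (simp add: P_def)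
  qed
  then obtain f where f: "\<And>x. P f x (f x)" by blast
  have "w f y z \<in> hom y z" if "y \<in> I" "z \<in> I" "hom y z \<noteq> {}" for y z
    using w_hom[OF that f f] .
  moreover have "w f y v \<in> w f y z \<odot> w f z v"
    if "y \<in> I" "z \<in> I" "v \<in> I" "hom y z \<noteq> {}" "hom z v \<noteq> {}" for y z v
    using triangle[OF that f f f] .
  ultimately show ?thesis by (intro exI[of _ "w f"]) simp
qed

end

section \<open>Atoms as coset relations\<close>

text \<open>The atoms \<open>base x y\<close> serve as origins: the integer \<open>i\<close> is the coordinate of the atom
  \<open>lact x i (base x y)\<close> of \<open>hom x y\<close>.\<close>

locale atom_network = compatible_atoms +
  fixes base :: "'a \<Rightarrow> 'a \<Rightarrow> 'a"
  assumes base_hom: "\<lbrakk>x \<in> I; y \<in> I; hom x y \<noteq> {}\<rbrakk> \<Longrightarrow> base x y \<in> hom x y"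
    and base_triangle: "\<lbrakk>x \<in> I; y \<in> I; z \<in> I; hom x y \<noteq> {}; hom y z \<noteq> {}\<rbrakk>
      \<Longrightarrow> base x z \<in> base x y \<odot> base y z"
begin

definition conn :: "('a \<times> 'a) set" where
  "conn = {(x, y). x \<in> I \<and> y \<in> I \<and> hom x y \<noteq> {}}"

text \<open>Without exponents: \<open>(p, q)\<close> belongs to \<open>rel c\<close> if and only if the product of \<open>p\<smile>\<close>, \<open>base x y\<close> and \<open>q\<close>
  is \<open>c\<close>.\<close>

definition rel :: "'a \<Rightarrow> ('a \<times> 'a) set" where
  "rel c = {(gpow x i, gpow y j) | x y i j. (x, y) \<in> conn \<and> c = lact x (j - i) (base x y)}"

lemma connD: "(x, y) \<in> conn \<Longrightarrow> x \<in> I \<and> y \<in> I \<and> hom x y \<noteq> {} \<and> base x y \<in> hom x y"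
  using base_hom by (auto simp: conn_def)

lemma equiv_conn: "equiv I conn"
proof (intro equivI refl_onI symI transI)
  show "conn \<subseteq> I \<times> I" by (auto simp: conn_def)
  show "(x, x) \<in> conn" if "x \<in> I" for x using that id_hom by (auto simp: conn_def)
  show "(y, x) \<in> conn" if "(x, y) \<in> conn" for x y using that hom_sym by (auto simp: conn_def)
  show "(x, z) \<in> conn" if "(x, y) \<in> conn" "(y, z) \<in> conn" for x y z
    using connD[OF that(1)] connD[OF that(2)] hom_trans[of x y z] by (simp add: conn_def)
qed

text \<open>The group element \<open>base x x\<close> is idempotent, because the triangle with three equal vertices closes.\<close>

lemma base_id:
  assumes x: "x \<in> I"
  shows "base x x = x"
proof -
  have ne: "hom x x \<noteq> {}" using id_hom x by blast
  have b: "base x x \<in> hom x x" using base_hom x ne by blast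
  obtain i where i: "base x x = gpow x i" using hom_gpow[OF x b] by blast
  have "base x x \<in> gpow x i \<odot> base x x" using base_triangle[OF x x x ne ne] i by simp
  then have "lact x i (base x x) = base x x" using lact_comp(1)[OF x x b] by simp
  then have "int (index x x) dvd i" using lact_fix_iff[OF x x b] by blast
  then have "gpow x i = gpow x 0" using gpow_eq_iff[OF x, of i 0] by simp
  then show ?thesis using i gpow_0[OF x] by simp
qed

lemma base_cv:
  assumes "(x, y) \<in> conn"
  shows "base y x = cv (base x y)"
proof -
  have xy: "x \<in> I" "y \<in> I" "hom x y \<noteq> {}" "base x y \<in> hom x y" using connD assms by blast+
  have yx: "hom y x \<noteq> {}" "base y x \<in> hom y x" using hom_sym base_hom xy by blast+
  have "x \<in> base x y \<odot> base y x"
    using base_triangle[OF xy(1,2,1,3) yx(1)] base_id[OF xy(1)] by simp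
  then have "base y x \<in> cv (base x y) \<odot> x"
    using peirce_right[OF xy(1,2,1,4) yx(2)] by blast
  then show ?thesis using id_right[OF xy(2,1) cv_hom[OF xy(1,2,4)]] by simp
qed

text \<open>The exponents of \<open>p\<close> and \<open>q\<close> are determined modulo \<open>index x x\<close> and \<open>index y y\<close>, and \<open>index x y\<close> divides
  both numbers.\<close>

lemma rel_gpow_iff:
  assumes "(x, y) \<in> conn"
  shows "(gpow x i, gpow y j) \<in> rel c \<longleftrightarrow> c = lact x (j - i) (base x y)"
proof
  note xy = connD[OF assms]
  assume "(gpow x i, gpow y j) \<in> rel c"
  then obtain x' y' i' j' where r: "(x', y') \<in> conn" "gpow x i = gpow x' i'" "gpow y j = gpow y' j'"
    "c = lact x' (j' - i') (base x' y')" by (auto simp: rel_def)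
  note xy' = connD[OF r(1)]
  have "x = x'"
    using hom_unique[of x x x' x' "gpow x i"] xy xy' r(2) gpow_hom[of x i] gpow_hom[of x' i'] by auto
  moreover have "y = y'"
    using hom_unique[of y y y' y' "gpow y j"] xy xy' r(3) gpow_hom[of y j] gpow_hom[of y' j'] by auto
  ultimately have e: "gpow x i = gpow x i'" "gpow y j = gpow y j'"
    "c = lact x (j' - i') (base x y)" using r by auto
  have "int (index x x) dvd i - i'" "int (index y y) dvd j - j'"
    using e gpow_eq_iff xy by blast+
  moreover have "index x y dvd index x x" using index_dvd xy by blast
  moreover have "index x y dvd index y y" using index_dvd[of y x] hom_sym[of x y] index_commute xy by metis
  ultimately have "int (index x y) dvd (j - j') - (i - i')"
    by (meson dvd_diff dvd_trans int_dvd_int_iff)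
  then have "int (index x y) dvd (j - i) - (j' - i')" by (simp add: algebra_simps)
  then show "c = lact x (j - i) (base x y)" using e(3) lact_eq_iff xy by metis
qed (use assms in \<open>auto simp: rel_def\<close>)

lemma rel_cases:
  assumes "(p, q) \<in> rel c"
  obtains x y i j where "(x, y) \<in> conn" "p = gpow x i" "q = gpow y j"
    "c = lact x (j - i) (base x y)" "c \<in> hom x y"
  using assms connD lact_comp(2) unfolding rel_def by blast

lemma rel_total:
  assumes "(x, y) \<in> conn" "p \<in> hom x x" "q \<in> hom y y"
  shows "\<exists>c\<in>hom x y. (p, q) \<in> rel c"
proof -
  have xy: "x \<in> I" "y \<in> I" "base x y \<in> hom x y" using connD assms by blast+
  obtain i j where "p = gpow x i" "q = gpow y j" using hom_gpow xy assms by metis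
  then show ?thesis using rel_gpow_iff[OF assms(1)] lact_comp(2)[OF xy] by blast
qed

lemma rel_dom:
  assumes "x \<in> I" "y \<in> I" "c \<in> hom x y"
  shows "(x, y) \<in> conn" "rel c \<subseteq> hom x x \<times> hom y y"
proof -
  show "(x, y) \<in> conn" using assms by (auto simp: conn_def)
  show "rel c \<subseteq> hom x x \<times> hom y y"
  proof (intro subrelI)
    fix p q assume "(p, q) \<in> rel c"
    then obtain u v i j where r: "(u, v) \<in> conn" "p = gpow u i" "q = gpow v j" "c \<in> hom u v"
      by (rule rel_cases)
    then have "u = x \<and> v = y" using hom_unique[of u v x y c] connD[OF r(1)] assms by blast
    then show "(p, q) \<in> hom x x \<times> hom y y" using r gpow_hom assms by blast
  qed
qed

lemma rel_hom:
  assumes "x \<in> I" "y \<in> I" "c \<in> hom x y" "(p, q) \<in> rel c"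
  obtains i j where "p = gpow x i" "q = gpow y j" "c = lact x (j - i) (base x y)"
proof -
  have c: "(x, y) \<in> conn" "p \<in> hom x x" "q \<in> hom y y" using rel_dom assms by blast+
  obtain i j where ij: "p = gpow x i" "q = gpow y j" using hom_gpow assms c by metis
  then show thesis using that assms(4) rel_gpow_iff[OF c(1)] by blast
qed

lemma rel_nonempty:
  assumes "x \<in> I" "y \<in> I" "c \<in> hom x y"
  shows "rel c \<noteq> {}"
proof -
  have c: "(x, y) \<in> conn" "base x y \<in> hom x y" using rel_dom assms connD by blast+
  obtain k where "c = lact x k (base x y)" using lact_transitive[OF assms(1,2) c(2) assms(3)] by blast
  then have "(gpow x 0, gpow y k) \<in> rel c" using rel_gpow_iff[OF c(1), of 0 k c] by simp
  then show ?thesis by blast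
qed

lemma rel_disjoint:
  assumes "(p, q) \<in> rel c" "(p, q) \<in> rel c'"
  shows "c = c'"
  using assms(1)
proof (rule rel_cases)
  fix x y i j assume "(x, y) \<in> conn" "p = gpow x i" "q = gpow y j" "c = lact x (j - i) (base x y)"
  then show ?thesis using assms(2) rel_gpow_iff[of x y i j] by simp
qed

lemma rel_converse:
  assumes "x \<in> I" "y \<in> I" "c \<in> hom x y"
  shows "rel (cv c) = (rel c)\<inverse>"
proof -
  have *: "(q, p) \<in> rel (cv c)" if c: "x \<in> I" "y \<in> I" "c \<in> hom x y" and r: "(p, q) \<in> rel c" for x y c p q
  proof -
    obtain i j where ij: "p = gpow x i" "q = gpow y j" "c = lact x (j - i) (base x y)"
      by (rule rel_hom[OF c r])
    have xy: "(x, y) \<in> conn" "base x y \<in> hom x y" using rel_dom[OF c] connD by blast+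
    have "(y, x) \<in> conn" using xy(1) equiv_conn by (meson equivE symE)
    moreover have "cv c = lact y (i - j) (base y x)"
      using ij(3) cv_lact[OF c(1,2) xy(2), of "j - i"] base_cv[OF xy(1)]
        lact_is_ract[OF c(2,1) cv_hom[OF c(1,2) xy(2)], of "i - j"] 
      by (simp add: ract_def cv_cv[OF c(1,2) xy(2)])
    ultimately show ?thesis using ij rel_gpow_iff by blast
  qed
  have "(p, q) \<in> (rel c)\<inverse>" if "(p, q) \<in> rel (cv c)" for p q
    using *[OF assms(2,1) cv_hom[OF assms] that] cv_cv[OF assms] by simp
  then show ?thesis using *[OF assms] by auto
qed

text \<open>For the inclusion from left to right, the coordinates of \<open>a\<close> and \<open>b\<close> add up along the middle point,
  and the triangle of \<open>base\<close> closes. Conversely, a middle point with exponent \<open>j\<close> has to satisfy one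
  congruence modulo \<open>index x y\<close> and one modulo \<open>index y z\<close>; they are consistent since
  \<open>c\<close> belongs to \<open>a \<odot> b\<close>.\<close>

lemma rel_comp:
  assumes I: "x \<in> I" "y \<in> I" "z \<in> I" and a: "a \<in> hom x y" and b: "b \<in> hom y z"
  shows "rel a O rel b = (\<Union>c\<in>a \<odot> b. rel c)"
proof -
  have xy: "(x, y) \<in> conn" "hom x y \<noteq> {}" "base x y \<in> hom x y" using rel_dom connD I a by blast+
  have yz: "(y, z) \<in> conn" "hom y z \<noteq> {}" "base y z \<in> hom y z" using rel_dom connD I b by blast+
  have xz: "(x, z) \<in> conn" "base x z \<in> hom x z"
    using equiv_conn xy yz connD by (meson equivE transE)+
  have bt: "base x z \<in> base x y \<odot> base y z" using base_triangle I xy yz by blast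
  have shift: "lact x s (base x y) \<odot> lact y t (base y z) = lact x (s + t) ` (base x y \<odot> base y z)" for s t
  proof -
    have "lact x s (base x y) \<odot> lact y t (base y z) = lact x s ` (base x y \<odot> lact y t (base y z))"
      using comp_lact[OF I xy(3) lact_comp(2)[OF I(2,3) yz(3)]] .
    also have "\<dots> = lact x s ` lact x t ` (base x y \<odot> base y z)"
      using comp_lact_right[OF I xy(3) yz(3)] by simp
    also have "\<dots> = (\<lambda>c. lact x (s + t) c) ` (base x y \<odot> base y z)"
      unfolding image_image
      using lact_add[OF I(1,3) comp_hom[OF I xy(3) yz(3)], symmetric] by (intro image_cong) auto
    finally show ?thesis .
  qed
  show ?thesis
  proof (intro equalityI subrelI)
    fix p r assume "(p, r) \<in> rel a O rel b"
    then obtain q where q: "(p, q) \<in> rel a" "(q, r) \<in> rel b" by blast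
    obtain i j where ij: "p = gpow x i" "q = gpow y j" "a = lact x (j - i) (base x y)"
      by (rule rel_hom[OF I(1,2) a q(1)])
    have "r \<in> hom z z" using rel_dom(2)[OF I(2,3) b] q(2) by blast
    then obtain k where k: "r = gpow z k" using hom_gpow I by blast
    have "b = lact y (k - j) (base y z)" using q(2) ij(2) k rel_gpow_iff[OF yz(1)] by simp
    then have "lact x (k - i) (base x z) \<in> a \<odot> b"
      using shift[of "j - i" "k - j"] ij(3) bt by simp
    moreover have "(p, r) \<in> rel (lact x (k - i) (base x z))" using ij k rel_gpow_iff[OF xz(1)] by simp
    ultimately show "(p, r) \<in> (\<Union>c\<in>a \<odot> b. rel c)" by blast
  next
    fix p r assume "(p, r) \<in> (\<Union>c\<in>a \<odot> b. rel c)"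
    then obtain c where c: "c \<in> a \<odot> b" "(p, r) \<in> rel c" by blast
    have ch: "c \<in> hom x z" using comp_hom[OF I a b c(1)] .
    obtain i k where ik: "p = gpow x i" "r = gpow z k" "c = lact x (k - i) (base x z)"
      by (rule rel_hom[OF I(1,3) ch c(2)])
    obtain s where s: "a = lact x s (base x y)" using lact_transitive[OF I(1,2) xy(3) a] by blast
    obtain t where t: "b = lact y t (base y z)" using lact_transitive[OF I(2,3) yz(3) b] by blast
    obtain e where e: "e \<in> base x y \<odot> base y z" "c = lact x (s + t) e" using c(1) shift s t by blast
    obtain u where u: "e = lact x u (base x z)" "int (index x y) dvd u"
      using comp_difference[OF I xy(3) yz(3) bt e(1)] by blast
    have "lact x (k - i) (base x z) = lact x (s + t + u) (base x z)"
      using e(2) u(1) ik(3) lact_add[OF I(1,3) xz(2), of "s + t" u] by simp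
    \<comment> \<open>Since \<open>p\<close> and \<open>r\<close> have exponents \<open>i\<close> and \<open>k\<close>, their difference is known modulo \<open>index x z\<close>.\<close>
    then have d1: "int (index x z) dvd (k - i) - (s + t + u)" using lact_eq_iff[OF I(1,3) xz(2)] by blast
    \<comment> \<open>The middle point must be congruent to \<open>i + s\<close> modulo the index of \<open>x, y\<close> and to
      \<open>k - t\<close> modulo the index of \<open>y, z\<close>.\<close>
    have "gcd (index x y) (index y z) dvd gcd (index x y) (index x z)"
      using index_gcds(1)[OF I xy(2) yz(2)] by simp
    then have "int (gcd (index x y) (index y z)) dvd int (index x z)"
      by (meson dvd_trans gcd_dvd2 int_dvd_int_iff)
    then have "int (gcd (index x y) (index y z)) dvd (k - i) - (s + t + u)" using d1 dvd_trans by blast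
    moreover have "int (gcd (index x y) (index y z)) dvd u"
      using u(2) by (meson dvd_trans gcd_dvd1 int_dvd_int_iff)
    ultimately have "int (gcd (index x y) (index y z)) dvd ((k - i) - (s + t + u)) + u" by (rule dvd_add)
    then have "int (gcd (index x y) (index y z)) dvd (k - t) - (i + s)" by (simp add: algebra_simps)
    then obtain w where w: "(k - t) - (i + s) = int (gcd (index x y) (index y z)) * w" by blast
    obtain m n where mn: "m * int (index x y) + n * int (index y z) = int (gcd (index x y) (index y z))"
      using bezout_int[of "int (index x y)" "int (index y z)"] by auto
    define j where "j = i + s + w * m * int (index x y)"
    have kt: "k - t - j = w * n * int (index y z)"
    proof -
      have "k - t - j = (k - t - (i + s)) - w * m * int (index x y)" by (simp add: j_def)
      also have "\<dots> = (m * int (index x y) + n * int (index y z)) * w - w * m * int (index x y)"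
        unfolding w mn ..
      also have "\<dots> = w * n * int (index y z)" by (simp add: algebra_simps)
      finally show ?thesis .
    qed
    have "int (index x y) dvd (j - i) - s" by (simp add: j_def)
    then have "a = lact x (j - i) (base x y)"
      using s lact_eq_iff[OF I(1,2) xy(3), of "j - i" s] by simp
    moreover have "int (index y z) dvd t - (k - j)"
    proof -
      have "t - (k - j) = - (w * n * int (index y z))" using kt by (simp add: algebra_simps)
      then show ?thesis by simp
    qed
    then have "b = lact y (k - j) (base y z)"
      using t lact_eq_iff[OF I(2,3) yz(3), of t "k - j"] by simp
    ultimately have "(p, gpow y j) \<in> rel a" "(gpow y j, r) \<in> rel b"
      using ik rel_gpow_iff[OF xy(1), of i j a] rel_gpow_iff[OF yz(1), of j k b] by simp_all
    then show "(p, r) \<in> rel a O rel b" by blast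
  qed
qed

lemma rel_identity: "(\<Union>x\<in>I. rel x) = Id_on (\<Union>x\<in>I. carrier (G x))"
proof -
  have eq: "(gpow x i, gpow x j) \<in> rel x \<longleftrightarrow> gpow x i = gpow x j" if x: "x \<in> I" for x i j
  proof -
    have "(x, x) \<in> conn" using x id_hom by (auto simp: conn_def)
    then have "(gpow x i, gpow x j) \<in> rel x \<longleftrightarrow> x = lact x (j - i) x"
      using rel_gpow_iff base_id[OF x] by metis
    also have "\<dots> \<longleftrightarrow> int (index x x) dvd j - i"
      using lact_fix_iff[OF x x id_hom[OF x], of "j - i"] by auto
    also have "\<dots> \<longleftrightarrow> gpow x i = gpow x j" using gpow_eq_iff[OF x, of j i] by auto
    finally show ?thesis .
  qed
  show ?thesis
  proof (intro equalityI subrelI)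
    fix p q assume "(p, q) \<in> (\<Union>x\<in>I. rel x)"
    then obtain x where x: "x \<in> I" "(p, q) \<in> rel x" by blast
    then obtain i j where "p = gpow x i" "q = gpow x j" using rel_hom[OF x(1,1) id_hom[OF x(1)] x(2)] by blast
    then show "(p, q) \<in> Id_on (\<Union>x\<in>I. carrier (G x))"
      using eq[OF x(1), of i j] x gpow_hom[OF x(1), of i] G_carrier[OF x(1)] by (auto simp: Id_on_iff)
  next
    fix p q assume "(p, q) \<in> Id_on (\<Union>x\<in>I. carrier (G x))"
    then have "p \<in> (\<Union>x\<in>I. carrier (G x)) \<and> q = p" unfolding Id_on_iff by metis
    then obtain x where x: "x \<in> I" "p \<in> carrier (G x)" "q = p" by blast
    then obtain i where "p = gpow x i" using hom_gpow[of x p] G_carrier[of x] by blast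
    then show "(p, q) \<in> (\<Union>x\<in>I. rel x)" using eq[OF x(1), of i i] x by auto
  qed
qed

definition atoms :: "'a set" where
  "atoms = (\<Union>(x, y)\<in>conn. hom x y)"

lemma atomsI: "\<lbrakk>x \<in> I; y \<in> I; a \<in> hom x y\<rbrakk> \<Longrightarrow> a \<in> atoms"
  using rel_dom(1) by (auto simp: atoms_def)

lemma atomsE:
  assumes "a \<in> atoms"
  obtains x y where "x \<in> I" "y \<in> I" "a \<in> hom x y"
  using assms connD by (auto simp: atoms_def)

lemma rel_union: "(\<Union>a\<in>atoms. rel a) = (\<Union>(x, y)\<in>conn. carrier (G x) \<times> carrier (G y))"
proof (intro equalityI subrelI)
  fix p q assume "(p, q) \<in> (\<Union>a\<in>atoms. rel a)"
  then obtain a where a: "a \<in> atoms" "(p, q) \<in> rel a" by blast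
  then obtain x y where "x \<in> I" "y \<in> I" "a \<in> hom x y" using atomsE by blast
  then have "(x, y) \<in> conn" "(p, q) \<in> carrier (G x) \<times> carrier (G y)"
    using rel_dom[of x y a] a(2) G_carrier[of x] G_carrier[of y] by auto
  then show "(p, q) \<in> (\<Union>(x, y)\<in>conn. carrier (G x) \<times> carrier (G y))" by blast
next
  fix p q assume "(p, q) \<in> (\<Union>(x, y)\<in>conn. carrier (G x) \<times> carrier (G y))"
  then obtain x y where xy: "(x, y) \<in> conn" "p \<in> carrier (G x)" "q \<in> carrier (G y)" by blast
  note I = connD[OF xy(1)]
  have "p \<in> hom x x" "q \<in> hom y y" using xy I G_carrier[of x] G_carrier[of y] by auto
  then obtain c where c: "c \<in> hom x y" "(p, q) \<in> rel c" using rel_total[OF xy(1)] by blast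
  then show "(p, q) \<in> (\<Union>a\<in>atoms. rel a)" using atomsI[of x y c] I by blast
qed

lemma multiples_eq:
  assumes "x \<in> I"
  shows "multiples (G x) m = range (\<lambda>k::int. gpow x (int m * k))"
proof -
  have "(gpow x k) [^]\<^bsub>G x\<^esub> m = gpow x (int m * k)" for k
    using gpow_gpow[OF assms, of k "int m"] int_pow_int[of "G x" "gpow x k" m] by (simp add: mult.commute)
  moreover have "carrier (G x) = range (gpow x)"
    using hom_gpow[OF assms] gpow_hom[OF assms] G_carrier[OF assms] by auto
  ultimately show ?thesis by (simp add: multiples_def image_image)
qed

abbreviation gcoset :: "'a \<Rightarrow> nat \<Rightarrow> int \<Rightarrow> 'a set" where
  "gcoset x m i \<equiv> multiples (G x) m #>\<^bsub>G x\<^esub> gpow x i"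

lemma gcoset_eq:
  assumes "x \<in> I"
  shows "gcoset x m i = {gpow x j | j. int m dvd j - i}"
proof -
  have "gcoset x m i = range (\<lambda>k. gpow x (int m * k + i))"
    using gpow_add[OF assms] by (auto simp: multiples_eq[OF assms] r_coset_def)
  also have "\<dots> = {gpow x j | j. int m dvd j - i}"
  proof (intro equalityI subsetI)
    fix p assume "p \<in> {gpow x j | j. int m dvd j - i}"
    then obtain j k where j: "p = gpow x j" "j - i = int m * k" by blast
    then have "p = gpow x (int m * k + i)" by (metis diff_add_cancel)
    then show "p \<in> range (\<lambda>k. gpow x (int m * k + i))" by blast
  qed auto
  finally show ?thesis .
qed

lemma gcoset_member:
  assumes "x \<in> I" "m dvd index x x"
  shows "gpow x j \<in> gcoset x m i \<longleftrightarrow> int m dvd j - i"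
proof
  assume "gpow x j \<in> gcoset x m i"
  then obtain k where k: "gpow x j = gpow x k" "int m dvd k - i" using gcoset_eq[OF assms(1)] by auto
  have "int m dvd j - k" using k gpow_eq_iff[OF assms(1)] assms(2) by (meson dvd_trans int_dvd_int_iff)
  then have "int m dvd (j - k) + (k - i)" using k(2) by (rule dvd_add)
  then show "int m dvd j - i" by simp
qed (use gcoset_eq[OF assms(1)] in auto)

lemma gcoset_eq_iff:
  assumes "x \<in> I" "m dvd index x x"
  shows "gcoset x m i = gcoset x m j \<longleftrightarrow> int m dvd i - j"
proof
  assume "gcoset x m i = gcoset x m j"
  then show "int m dvd i - j" using gcoset_member[OF assms, of i i] gcoset_member[OF assms, of i j] by simp
next
  assume d: "int m dvd i - j"
  have "int m dvd k - i \<longleftrightarrow> int m dvd k - j" for k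
    using dvd_add_left_iff[OF d, of "k - i"] by (simp add: algebra_simps)
  then show "gcoset x m i = gcoset x m j" using gcoset_eq[OF assms(1)] by simp
qed

lemma gcoset_mult:
  assumes "x \<in> I"
  shows "gcoset x m i <#>\<^bsub>G x\<^esub> gcoset x m j = gcoset x m (i + j)"
proof (intro equalityI subsetI)
  fix p assume "p \<in> gcoset x m i <#>\<^bsub>G x\<^esub> gcoset x m j"
  then obtain k l where kl: "p = gpow x k \<otimes>\<^bsub>G x\<^esub> gpow x l" "int m dvd k - i" "int m dvd l - j"
    by (auto simp: gcoset_eq[OF assms] set_mult_def)
  have "int m dvd (k - i) + (l - j)" using kl by simp
  then have "int m dvd (k + l) - (i + j)" by (simp add: algebra_simps)
  moreover have "p = gpow x (k + l)" using kl(1) gpow_add[OF assms, of k l] by simp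
  ultimately show "p \<in> gcoset x m (i + j)" unfolding gcoset_eq[OF assms] by blast
next
  fix p assume "p \<in> gcoset x m (i + j)"
  then obtain k where k: "p = gpow x k" "int m dvd k - (i + j)" by (auto simp: gcoset_eq[OF assms])
  have "gpow x i \<in> gcoset x m i" "gpow x (k - i) \<in> gcoset x m j"
    using k by (auto simp: gcoset_eq[OF assms] algebra_simps)
  moreover have "p = gpow x i \<otimes>\<^bsub>G x\<^esub> gpow x (k - i)" using gpow_add[OF assms, of i "k - i"] k by simp
  ultimately show "p \<in> gcoset x m i <#>\<^bsub>G x\<^esub> gcoset x m j" by (auto simp: set_mult_def)
qed

lemma rcosets_eq:
  assumes "x \<in> I"
  shows "rcosets\<^bsub>G x\<^esub> (multiples (G x) m) = range (gcoset x m)"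
  using hom_gpow[OF assms] gpow_hom[OF assms] G_carrier[OF assms] by (auto simp: RCOSETS_def)

lemma index_dvd_both:
  assumes "(x, y) \<in> conn"
  shows "index x y dvd index x x" "index x y dvd index y y" "index x y > 0"
  using index_dvd[of x y] index_dvd[of y x] index_pos[of x y] hom_sym[of x y] index_commute[of x y]
    connD[OF assms] by simp_all

lemma coset_map_gcoset:
  assumes xy: "(x, y) \<in> conn"
  shows "coset_map G g index x y (gcoset x (index x y) k) = gcoset y (index x y) k"
  unfolding coset_map_def
proof (rule the_equality)
  have I: "x \<in> I" "y \<in> I" using connD xy by auto
  let ?m = "index x y"
  have nat: "g u [^]\<^bsub>G u\<^esub> (l::nat) = gpow u (int l)" for u l by (simp add: int_pow_int)
  show "\<exists>l<?m. gcoset x ?m k = multiples (G x) ?m #>\<^bsub>G x\<^esub> (g x [^]\<^bsub>G x\<^esub> l) \<and>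
      gcoset y ?m k = multiples (G y) ?m #>\<^bsub>G y\<^esub> (g y [^]\<^bsub>G y\<^esub> l)"
  proof (intro exI conjI)
    let ?l = "nat (k mod int ?m)"
    have m: "int ?m > 0" using index_dvd_both[OF xy] by simp
    show "?l < ?m" using m by (simp add: nat_less_iff)
    have "int ?m dvd k - int ?l" using m by (simp add: minus_mod_eq_mult_div)
    then show "gcoset x ?m k = multiples (G x) ?m #>\<^bsub>G x\<^esub> (g x [^]\<^bsub>G x\<^esub> ?l)"
      "gcoset y ?m k = multiples (G y) ?m #>\<^bsub>G y\<^esub> (g y [^]\<^bsub>G y\<^esub> ?l)"
      unfolding nat using gcoset_eq_iff I index_dvd_both[OF xy] by blast+
  qed
  fix D assume "\<exists>l<?m. gcoset x ?m k = multiples (G x) ?m #>\<^bsub>G x\<^esub> (g x [^]\<^bsub>G x\<^esub> l) \<and>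
      D = multiples (G y) ?m #>\<^bsub>G y\<^esub> (g y [^]\<^bsub>G y\<^esub> l)"
  then obtain l :: nat where l: "gcoset x ?m k = gcoset x ?m (int l)" "D = gcoset y ?m (int l)"
    unfolding nat by blast
  then have "int ?m dvd k - int l" using gcoset_eq_iff I index_dvd_both[OF xy] by blast
  then show "D = gcoset y ?m k" using l(2) gcoset_eq_iff I index_dvd_both[OF xy] by blast
qed

text \<open>Both sides consist of the pairs of powers of \<open>g x\<close> and \<open>g y\<close> whose exponents differ by \<open>l\<close> modulo
  \<open>index x y\<close>.\<close>

lemma coset_rel_eq_rel:
  assumes xy: "(x, y) \<in> conn"
  shows "coset_rel G g index x y (gcoset x (index x y) l) = rel (lact x l (base x y))"
proof -
  have I: "x \<in> I" "y \<in> I" "base x y \<in> hom x y" using connD xy by auto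
  let ?m = "index x y"
  have "coset_rel G g index x y (gcoset x ?m l) = (\<Union>k. gcoset x ?m k \<times> gcoset y ?m (k + l))"
    by (simp add: coset_rel_def rcosets_eq[OF I(1)] gcoset_mult[OF I(1)] coset_map_gcoset[OF xy])
  also have "\<dots> = rel (lact x l (base x y))"
  proof (intro equalityI subrelI)
    fix p q assume "(p, q) \<in> (\<Union>k. gcoset x ?m k \<times> gcoset y ?m (k + l))"
    then obtain k i j where r: "p = gpow x i" "q = gpow y j" "int ?m dvd i - k" "int ?m dvd j - (k + l)"
      by (auto simp: gcoset_eq I)
    have "int ?m dvd (i - k) - (j - (k + l))" using dvd_diff[OF r(3,4)] .
    then have "int ?m dvd l - (j - i)" by (simp add: algebra_simps)
    then show "(p, q) \<in> rel (lact x l (base x y))"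
      using r rel_gpow_iff[OF xy] lact_eq_iff[OF I] by blast
  next
    fix p q assume r: "(p, q) \<in> rel (lact x l (base x y))"
    obtain i j where ij: "p = gpow x i" "q = gpow y j"
      "lact x l (base x y) = lact x (j - i) (base x y)"
      by (rule rel_hom[OF I(1,2) lact_comp(2)[OF I] r])
    then have "int ?m dvd - (l - (j - i))" using lact_eq_iff[OF I] by (simp only: dvd_minus_iff)
    then have "int ?m dvd j - (i + l)" by (simp add: algebra_simps)
    then have "p \<in> gcoset x ?m i" "q \<in> gcoset y ?m (i + l)" using ij by (auto simp: gcoset_eq I)
    then show "(p, q) \<in> (\<Union>k. gcoset x ?m k \<times> gcoset y ?m (k + l))" by blast
  qed
  finally show ?thesis .
qed

lemma carrier_cyclic_group_ra:
  "carrier (cyclic_group_ra I conn G g index) = (\<lambda>X. \<Union>a\<in>X. rel a) ` Pow atoms"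
proof -
  let ?D = "{(x, y, D). (x, y) \<in> conn \<and> D \<in> rcosets\<^bsub>G x\<^esub> (multiples (G x) (index x y))}"
  let ?c = "\<lambda>(x, y, D). coset_rel G g index x y D"
  have sub: "?c ` ?D = rel ` atoms"
  proof (intro equalityI subsetI)
    fix r assume "r \<in> ?c ` ?D"
    then obtain x y D where d: "(x, y) \<in> conn" "D \<in> range (gcoset x (index x y))" "r = coset_rel G g index x y D"
      using rcosets_eq connD by auto
    then obtain l where "r = rel (lact x l (base x y))" using coset_rel_eq_rel[OF d(1)] by auto
    then show "r \<in> rel ` atoms" using atomsI lact_comp(2) connD[OF d(1)] by blast
  next
    fix r assume "r \<in> rel ` atoms"
    then obtain a where a: "r = rel a" "a \<in> atoms" by blast
    then obtain x y where xy: "x \<in> I" "y \<in> I" "a \<in> hom x y" using atomsE by blast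
    then have c: "(x, y) \<in> conn" using rel_dom by blast
    obtain l where "a = lact x l (base x y)" using lact_transitive[of x y "base x y" a] connD[OF c] xy by blast
    then have "r = ?c (x, y, gcoset x (index x y) l)" using a coset_rel_eq_rel[OF c] by simp
    moreover have "(x, y, gcoset x (index x y) l) \<in> ?D" using c rcosets_eq[OF xy(1)] by blast
    ultimately show "r \<in> ?c ` ?D" by blast
  qed
  have "carrier (cyclic_group_ra I conn G g index) = (\<lambda>X. \<Union> (?c ` X)) ` Pow ?D"
    by (simp only: cyclic_group_ra_def partial_object.select_convs Pow_def setcompr_eq_image)
  also have "\<dots> = Union ` image ?c ` Pow ?D" by (simp add: image_image)
  also have "\<dots> = Union ` Pow (?c ` ?D)" by (simp only: image_Pow_surj[OF refl])
  also have "\<dots> = Union ` image rel ` Pow atoms" unfolding sub by (simp add: image_Pow_surj)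
  also have "\<dots> = (\<lambda>X. \<Union>a\<in>X. rel a) ` Pow atoms" by (simp add: image_image)
  finally show ?thesis .
qed

lemma order_index: "x \<in> I \<Longrightarrow> order (G x) = index x x"
  by (simp add: order_def G_carrier index_def)

lemma index_conditions: "index_conditions conn G index"
  unfolding index_conditions_def
proof (intro allI impI)
  fix x y z assume c: "(x, y) \<in> conn \<and> (y, z) \<in> conn"
  have xy: "x \<in> I" "y \<in> I" "hom x y \<noteq> {}" and yz: "z \<in> I" "hom y z \<noteq> {}"
    using c connD by blast+
  show "0 < index x y \<and> (index x y dvd order (G x) \<and> index x y dvd order (G y)) \<and>
      index x x = order (G x) \<and> index y x = index x y \<and>
      gcd (index x y) (index y z) = gcd (index x y) (index x z) \<and>
      gcd (index x y) (index x z) = gcd (index x z) (index y z)"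
    using index_dvd_both[of x y] c order_index[OF xy(1)] order_index[OF xy(2)] index_commute[OF xy(1,2)]
      index_gcds[OF xy(1,2) yz(1) xy(3) yz(2)] by simp
qed

lemma cyclic_group_system: "cyclic_group_system I G g"
  unfolding cyclic_group_system_def
proof (intro conjI ballI impI)
  fix x assume x: "x \<in> I"
  interpret Gx: group "G x" using group_G x .
  show "group (G x)" by unfold_locales
  show "finite (carrier (G x))" using G_finite G_carrier x by simp
  show gx: "g x \<in> carrier (G x)" using g_hom G_carrier x by simp
  have "carrier (G x) = range (gpow x)"
    using hom_gpow[OF x] gpow_hom[OF x] G_carrier[OF x] by auto
  then show sg: "subgroup_generated (G x) {g x} = G x"
    using gx Gx.carrier_subgroup_generated_by_singleton[OF gx]
    by (auto simp: subgroup_generated_def Gx.generate_pow intro!: monoid.equality)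
  show "cyclic_group (G x)" using sg gx unfolding cyclic_group_def by blast
next
  fix x y assume "x \<in> I" "y \<in> I" "x \<noteq> y"
  then show "carrier (G x) \<inter> carrier (G y) = {}" using hom_unique G_carrier by blast
qed

end

section \<open>Embedding into the cyclic group relation algebra\<close>

definition set_ra :: "'u set \<Rightarrow> ('u \<times> 'u) set \<Rightarrow> ('u \<times> 'u) set set \<Rightarrow> ('u \<times> 'u) set ra" where
  "set_ra U E K = \<lparr>carrier = K, rsum = (\<union>), rcompl = (\<lambda>r. E - r), rcomp = (O),
     rconv = converse, rident = Id_on U\<rparr>"

lemma set_ra_relation_algebra:
  assumes E: "equiv U E" and K: "K \<subseteq> Pow E"
    and cl: "\<And>r s. \<lbrakk>r \<in> K; s \<in> K\<rbrakk> \<Longrightarrow> r \<union> s \<in> K"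
      "\<And>r. r \<in> K \<Longrightarrow> E - r \<in> K"
      "\<And>r s. \<lbrakk>r \<in> K; s \<in> K\<rbrakk> \<Longrightarrow> r O s \<in> K"
      "\<And>r. r \<in> K \<Longrightarrow> r\<inverse> \<in> K"
      "Id_on U \<in> K"
  shows "relation_algebra (set_ra U E K)"
proof -
  have KE: "r \<subseteq> E" if "r \<in> K" for r using that K by blast
  have sub: "E \<subseteq> U \<times> U" "sym E" "trans E" using E by (auto simp: equiv_def refl_on_def)
  show ?thesis
  proof (unfold_locales, unfold set_ra_def rmeet_def rle_def partial_object.select_convs ra.select_convs)
    show "K \<noteq> {}" using cl(5) by blast
    fix r s t assume rst: "r \<in> K" "s \<in> K"
    show "r \<union> (E - ((E - r) \<union> (E - s))) = r" using KE[OF rst(1)] by blast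
    show "E - ((E - r) \<union> (E - (E - r))) \<union> s = s" using KE[OF rst(2)] by blast
    have rE: "(p, q) \<in> E" if "(p, q) \<in> r" for p q using that KE[OF rst(1)] by blast
    show "r\<inverse> O (E - r O s) \<union> (E - s) = E - s"
    proof -
      have "r\<inverse> O (E - r O s) \<subseteq> E - s"
      proof (intro subrelI)
        fix p q assume "(p, q) \<in> r\<inverse> O (E - r O s)"
        then obtain u where u: "(u, p) \<in> r" "(u, q) \<in> E" "(u, q) \<notin> r O s" by blast
        have "(p, u) \<in> E" using rE[OF u(1)] sub(2) by (meson symE)
        then have "(p, q) \<in> E" using u(2) sub(3) by (meson transE)
        then show "(p, q) \<in> E - s" using u by blast
      qed
      then show ?thesis by blast
    qed
  next
    fix r assume r: "r \<in> K"
    then have "r \<subseteq> U \<times> U" using KE sub(1) by blast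
    then show "r O Id_on U = r" by blast
    show "E - (E - r) = r" using KE[OF r] by blast
  next
    fix r s t assume "r \<in> K" "s \<in> K" "t \<in> K"
    then show "E - ((E - r) \<union> (E - (s \<union> t))) = E - ((E - r) \<union> (E - s)) \<union> (E - ((E - r) \<union> (E - t)))"
      by blast
  qed (use cl in \<open>auto simp: converse_relcomp\<close>)
qed

lemma set_ra_set_relation_algebra:
  assumes "equiv U E" and "relation_algebra (set_ra U E K)" "K \<subseteq> Pow E" "E \<in> K"
  shows "set_relation_algebra (set_ra U E K)"
  unfolding set_relation_algebra_def
proof (intro conjI exI)
  show "equiv U E" by fact
  show "relation_algebra (set_ra U E K)" by fact
qed (use assms(3,4) in \<open>auto simp: set_ra_def\<close>)

context atom_network
begin

definition pts :: "'a set" where "pts = (\<Union>x\<in>I. carrier (G x))"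

definition full :: "('a \<times> 'a) set" where
  "full = (\<Union>(x, y)\<in>conn. carrier (G x) \<times> carrier (G y))"

definition rels :: "('a \<times> 'a) set set" where
  "rels = (\<lambda>X. \<Union>a\<in>X. rel a) ` Pow atoms"

abbreviation cyclic_ra :: "('a \<times> 'a) set ra" where
  "cyclic_ra \<equiv> cyclic_group_ra I conn G g index"

lemma cyclic_ra_eq: "cyclic_ra = set_ra pts full rels"
  using carrier_cyclic_group_ra
  by (simp add: cyclic_group_ra_def set_ra_def pts_def full_def rels_def)

lemma full_eq: "full = (\<Union>a\<in>atoms. rel a)"
  by (simp add: full_def rel_union)

lemma equiv_full: "equiv pts full"
proof (intro equivI refl_onI symI transI)
  have mem: "(p, q) \<in> full \<longleftrightarrow> (\<exists>x y. (x, y) \<in> conn \<and> p \<in> hom x x \<and> q \<in> hom y y)" for p q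
  proof -
    have "p \<in> carrier (G x) \<longleftrightarrow> p \<in> hom x x" "q \<in> carrier (G y) \<longleftrightarrow> q \<in> hom y y"
      if "(x, y) \<in> conn" for x y
      using connD[OF that] G_carrier[of x] G_carrier[of y] by auto
    then show ?thesis unfolding full_def by blast
  qed
  show "full \<subseteq> pts \<times> pts" using connD by (auto simp: full_def pts_def)
  show "(p, p) \<in> full" if "p \<in> pts" for p
    using that equiv_conn by (auto simp: full_def pts_def equiv_def refl_on_def)
  show "(q, p) \<in> full" if "(p, q) \<in> full" for p q
    using that equiv_conn unfolding mem by (meson equivE symE)
  show "(p, r) \<in> full" if pq: "(p, q) \<in> full" and qr: "(q, r) \<in> full" for p q r
  proof -
    obtain x y where xy: "(x, y) \<in> conn" "p \<in> hom x x" "q \<in> hom y y" using pq mem by blast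
    obtain y' z where yz: "(y', z) \<in> conn" "q \<in> hom y' y'" "r \<in> hom z z" using qr mem by blast
    have "y = y'" using hom_unique[of y y y' y' q] connD[OF xy(1)] connD[OF yz(1)] xy yz by blast
    then have "(x, z) \<in> conn" using equiv_conn xy yz by (meson equivE transE)
    then show ?thesis using mem xy yz by blast
  qed
qed

text \<open>The relations of different atoms are non-empty and disjoint.\<close>

lemma rel_Union_mono_iff:
  assumes "X \<subseteq> atoms" "Y \<subseteq> atoms"
  shows "(\<Union>a\<in>X. rel a) \<subseteq> (\<Union>a\<in>Y. rel a) \<longleftrightarrow> X \<subseteq> Y"
proof
  assume sub: "(\<Union>a\<in>X. rel a) \<subseteq> (\<Union>a\<in>Y. rel a)"
  show "X \<subseteq> Y"
  proof
    fix a assume a: "a \<in> X"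
    then have "a \<in> atoms" using assms by blast
    then obtain x y where "x \<in> I" "y \<in> I" "a \<in> hom x y" by (rule atomsE)
    then obtain p q where pq: "(p, q) \<in> rel a" using rel_nonempty[of x y a] by auto
    then have "(p, q) \<in> (\<Union>a\<in>Y. rel a)" using sub a by blast
    then obtain b where "b \<in> Y" "(p, q) \<in> rel b" by blast
    then show "a \<in> Y" using rel_disjoint[OF pq] by blast
  qed
qed blast

lemma rels_Union:
  assumes "F \<subseteq> rels"
  shows "\<Union>F \<in> rels"
proof -
  have "\<Union>F = (\<Union>a\<in>{a \<in> atoms. \<exists>r\<in>F. rel a \<subseteq> r}. rel a)"
  proof (intro equalityI subsetI)
    fix u assume "u \<in> \<Union>F"
    then obtain r where r: "r \<in> F" "u \<in> r" by blast
    then obtain X where X: "X \<subseteq> atoms" "r = (\<Union>a\<in>X. rel a)" using assms by (auto simp: rels_def)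
    then obtain a where a: "a \<in> X" "u \<in> rel a" using r by blast
    have "rel a \<subseteq> r" "a \<in> atoms" using X a by blast+
    then show "u \<in> (\<Union>a\<in>{a \<in> atoms. \<exists>r\<in>F. rel a \<subseteq> r}. rel a)" using r(1) a(2) by blast
  qed blast
  then show ?thesis unfolding rels_def by blast
qed

lemma rel_Union_in_rels: "X \<subseteq> atoms \<Longrightarrow> (\<Union>a\<in>X. rel a) \<in> rels"
  unfolding rels_def by blast

lemma compl_rel_Union:
  assumes "X \<subseteq> atoms"
  shows "full - (\<Union>a\<in>X. rel a) = (\<Union>a\<in>atoms - X. rel a)"
proof (intro equalityI subsetI)
  fix u assume "u \<in> (\<Union>a\<in>atoms - X. rel a)"
  then obtain a where a: "a \<in> atoms" "a \<notin> X" "u \<in> rel a" by blast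
  then have "u \<notin> rel b" if "b \<in> X" for b using that rel_disjoint[of "fst u" "snd u" a b] by auto
  then show "u \<in> full - (\<Union>a\<in>X. rel a)" using a full_eq by blast
qed (auto simp: full_eq)

text \<open>The product of arbitrary atoms: it is empty if the inner measurable atoms differ, a case in which
  \<open>a \<odot> b\<close> is unspecified.\<close>

definition acomp :: "'a \<Rightarrow> 'a \<Rightarrow> 'a set" where
  "acomp a b = {c. \<exists>x y z. x \<in> I \<and> y \<in> I \<and> z \<in> I \<and> a \<in> hom x y \<and> b \<in> hom y z \<and> c \<in> a \<odot> b}"

lemma acomp_atoms: "acomp a b \<subseteq> atoms"
  unfolding acomp_def using comp_hom atomsI by blast

lemma rel_acomp:
  assumes "a \<in> atoms" "b \<in> atoms"
  shows "rel a O rel b = (\<Union>c\<in>acomp a b. rel c)"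
proof -
  obtain x y where a: "x \<in> I" "y \<in> I" "a \<in> hom x y" using assms(1) by (rule atomsE)
  obtain y' z where b: "y' \<in> I" "z \<in> I" "b \<in> hom y' z" using assms(2) by (rule atomsE)
  show ?thesis
  proof (cases "y = y'")
    case True
    then have b': "b \<in> hom y z" using b by simp
    have "acomp a b = a \<odot> b" using a b b' unfolding acomp_def by blast
    then show ?thesis using rel_comp[OF a(1,2) b(2) a(3) b'] by simp
  next
    case False
    have "acomp a b = {}"
      unfolding acomp_def using False hom_unique[OF _ _ a(1,2) _ a(3)] hom_unique[OF _ _ b(1,2) _ b(3)] by blast
    moreover have "rel a O rel b = {}"
    proof (rule ccontr)
      assume "rel a O rel b \<noteq> {}"
      then obtain p q r where "(p, q) \<in> rel a" "(q, r) \<in> rel b" by auto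
      then have "q \<in> hom y y" "q \<in> hom y' y'" using rel_dom(2)[OF a] rel_dom(2)[OF b] by blast+
      then show False using hom_unique[of y y y' y' q] a b False by blast
    qed
    ultimately show ?thesis by simp
  qed
qed

lemma rel_Union_comp:
  assumes "X \<subseteq> atoms" "Y \<subseteq> atoms"
  shows "(\<Union>a\<in>X. rel a) O (\<Union>b\<in>Y. rel b) = (\<Union>c\<in>(\<Union>a\<in>X. \<Union>b\<in>Y. acomp a b). rel c)"
proof -
  have "(\<Union>a\<in>X. rel a) O (\<Union>b\<in>Y. rel b) = (\<Union>a\<in>X. \<Union>b\<in>Y. rel a O rel b)" by blast
  also have "\<dots> = (\<Union>a\<in>X. \<Union>b\<in>Y. \<Union>c\<in>acomp a b. rel c)"
    using rel_acomp assms by (intro SUP_cong refl) blast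
  finally show ?thesis by (simp only: UN_UN_flatten)
qed

lemma cv_atoms: "a \<in> atoms \<Longrightarrow> cv a \<in> atoms \<and> cv (cv a) = a \<and> rel (cv a) = (rel a)\<inverse>"
  by (erule atomsE) (simp add: rel_converse cv_cv atomsI[OF _ _ cv_hom])

lemma rel_Union_converse:
  assumes "X \<subseteq> atoms"
  shows "(\<Union>a\<in>X. rel a)\<inverse> = (\<Union>a\<in>cv ` X. rel a)"
proof -
  have "(\<Union>a\<in>X. rel a)\<inverse> = (\<Union>a\<in>X. (rel a)\<inverse>)" by blast
  also have "\<dots> = (\<Union>a\<in>X. rel (cv a))" using cv_atoms assms by (intro SUP_cong refl) blast
  finally show ?thesis by blast
qed

lemma I_atoms: "I \<subseteq> atoms"
  using atomsI id_hom by blast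

lemma Id_pts: "Id_on pts = (\<Union>x\<in>I. rel x)"
  by (simp add: pts_def rel_identity)

lemma rels_full: "rels \<subseteq> Pow full"
  by (auto simp: rels_def full_eq)

lemma cyclic_ra_relation_algebra: "relation_algebra cyclic_ra"
  unfolding cyclic_ra_eq
proof (rule set_ra_relation_algebra[OF equiv_full rels_full])
  fix r s assume "r \<in> rels" "s \<in> rels"
  then obtain X Y where X: "X \<subseteq> atoms" "r = (\<Union>a\<in>X. rel a)" and Y: "Y \<subseteq> atoms" "s = (\<Union>a\<in>Y. rel a)"
    by (auto simp: rels_def)
  have "r \<union> s = (\<Union>a\<in>X \<union> Y. rel a)" using X Y by blast
  then show "r \<union> s \<in> rels" using X Y rel_Union_in_rels[of "X \<union> Y"] by simp
  show "full - r \<in> rels" using X compl_rel_Union rel_Union_in_rels[of "atoms - X"] by simp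
  show "r\<inverse> \<in> rels"
  proof -
    have "cv ` X \<subseteq> atoms" using X(1) cv_atoms by blast
    then show ?thesis unfolding X(2) rel_Union_converse[OF X(1)] by (rule rel_Union_in_rels)
  qed
  have "(\<Union>a\<in>X. \<Union>b\<in>Y. acomp a b) \<subseteq> atoms" using acomp_atoms by blast
  then show "r O s \<in> rels"
    unfolding X(2) Y(2) rel_Union_comp[OF X(1) Y(1)] by (rule rel_Union_in_rels)
next
  show "Id_on pts \<in> rels" using Id_pts rel_Union_in_rels[OF I_atoms] by simp
qed

lemma cyclic_ra_sel:
  "carrier cyclic_ra = rels" "rsum cyclic_ra = (\<union>)" "rcompl cyclic_ra = (\<lambda>r. full - r)"
  "rcomp cyclic_ra = (O)" "rconv cyclic_ra = converse" "rident cyclic_ra = Id_on pts"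
  "rle cyclic_ra = (\<subseteq>)" "rzero cyclic_ra = {}"
proof -
  show "rle cyclic_ra = (\<subseteq>)" by (auto simp: fun_eq_iff rle_def cyclic_ra_eq set_ra_def)
  have "Id_on pts \<subseteq> full" using equiv_full by (auto simp: equiv_def refl_on_def)
  then show "rzero cyclic_ra = {}" by (auto simp: rzero_def runit_def cyclic_ra_eq set_ra_def)
qed (simp_all add: cyclic_ra_eq set_ra_def)

lemma cyclic_ra_Union_is_sum: "F \<subseteq> rels \<Longrightarrow> is_sum cyclic_ra F (\<Union>F)"
  using rels_Union by (auto simp: is_sum_def cyclic_ra_sel)

lemma cyclic_ra_complete: "complete_ra cyclic_ra"
  using cyclic_ra_relation_algebra cyclic_ra_Union_is_sum
  by (auto simp: complete_ra_def cyclic_ra_sel(1))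

end

text \<open>The situation common to the algebra itself and to all of its completions: \<open>e\<close> identifies the
  given atoms with the atoms of an atomic relation algebra \<open>B\<close>.\<close>

locale atom_embedding = atom_network + B: relation_algebra B
  for B :: "('b, 'm) ra_scheme" (structure) +
  fixes e :: "'a \<Rightarrow> 'b"
  assumes e_atom: "a \<in> atoms \<Longrightarrow> ra_atom B (e a)"
    and e_inj: "inj_on e atoms"
    and e_dense: "\<lbrakk>r \<in> carrier B; r \<noteq> rzero B\<rbrakk> \<Longrightarrow> \<exists>a\<in>atoms. e a \<^bold>\<le> r"
    and e_comp: "\<lbrakk>a \<in> atoms; b \<in> atoms; c \<in> atoms\<rbrakk>
      \<Longrightarrow> e c \<^bold>\<le> e a \<Zsemi> e b \<longleftrightarrow> c \<in> acomp a b"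
    and e_conv: "a \<in> atoms \<Longrightarrow> e (cv a) = (e a)\<smile>"
    and e_id: "a \<in> atoms \<Longrightarrow> e a \<^bold>\<le> rident B \<longleftrightarrow> a \<in> I"
begin

definition below :: "'b \<Rightarrow> 'a set" where
  "below b = {a \<in> atoms. e a \<^bold>\<le> b}"

definition rep :: "'b \<Rightarrow> ('a \<times> 'a) set" where
  "rep b = (\<Union>a\<in>below b. rel a)"

lemma below_atoms: "below b \<subseteq> atoms"
  by (auto simp: below_def)

lemma below_mono_iff:
  assumes "r \<in> carrier B" "s \<in> carrier B"
  shows "below r \<subseteq> below s \<longleftrightarrow> r \<^bold>\<le> s"
proof
  assume sub: "below r \<subseteq> below s"
  show "r \<^bold>\<le> s"
  proof (rule ccontr)
    assume "\<not> r \<^bold>\<le> s"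
    then have nz: "r \<^bold>\<cdot> \<^bold>- s \<noteq> rzero B" using B.not_le_iff assms by blast
    have c: "r \<^bold>\<cdot> \<^bold>- s \<in> carrier B" using assms by (simp add: B.closed)
    obtain a where a: "a \<in> atoms" "e a \<^bold>\<le> r \<^bold>\<cdot> \<^bold>- s" using e_dense[OF c nz] by blast
    have ea: "ra_atom B (e a)" "e a \<in> carrier B" using e_atom[OF a(1)] B.atom_closed by auto
    have "r \<^bold>\<cdot> \<^bold>- s \<^bold>\<le> r" "r \<^bold>\<cdot> \<^bold>- s \<^bold>\<le> \<^bold>- s"
      using B.meet_lower1[of r] B.meet_lower2[of r] assms by (simp_all add: B.compl_closed)
    then have "e a \<^bold>\<le> r" "e a \<^bold>\<le> \<^bold>- s"
      using B.le_trans[OF a(2)] ea c assms B.compl_closed by blast+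
    then show False using sub a(1) B.atom_le_compl[OF ea(1) assms(2)] unfolding below_def by blast
  qed
next
  assume rs: "r \<^bold>\<le> s"
  show "below r \<subseteq> below s"
  proof
    fix a assume "a \<in> below r"
    then have a: "a \<in> atoms" "e a \<^bold>\<le> r" by (auto simp: below_def)
    then show "a \<in> below s"
      using B.le_trans[OF a(2) rs] B.atom_closed[OF e_atom] assms by (simp add: below_def)
  qed
qed

lemma below_inj: "inj_on below (carrier B)"
  by (intro inj_onI) (metis B.le_antisym below_mono_iff order_refl)

lemma below_sum:
  assumes "r \<in> carrier B" "s \<in> carrier B"
  shows "below (r \<^bold>+ s) = below r \<union> below s"
  using B.atom_le_sum[OF e_atom assms] by (auto simp: below_def)

lemma below_compl:
  assumes "r \<in> carrier B"
  shows "below (\<^bold>- r) = atoms - below r"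
  using B.atom_le_compl[OF e_atom assms] by (auto simp: below_def)

lemma below_conv:
  assumes "r \<in> carrier B"
  shows "below (r\<smile>) = cv ` below r"
proof -
  have iff: "e (cv a) \<^bold>\<le> r\<smile> \<longleftrightarrow> e a \<^bold>\<le> r" if "a \<in> atoms" for a
    using e_conv[OF that] B.conv_le_iff[OF B.atom_closed[OF e_atom[OF that]] assms] by simp
  show ?thesis
  proof (intro equalityI subsetI)
    fix a assume "a \<in> below (r\<smile>)"
    then have a: "a \<in> atoms" "e (cv (cv a)) \<^bold>\<le> r\<smile>" using cv_atoms by (auto simp: below_def)
    then have "cv a \<in> below r" using iff[of "cv a"] cv_atoms[of a] by (simp add: below_def)
    then show "a \<in> cv ` below r" using cv_atoms[OF a(1)] by force
  next
    fix a assume "a \<in> cv ` below r"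
    then obtain b where "a = cv b" "b \<in> atoms" "e b \<^bold>\<le> r" by (auto simp: below_def)
    then show "a \<in> below (r\<smile>)" using iff cv_atoms by (simp add: below_def)
  qed
qed

text \<open>Composition is completely additive: if an atom lies below \<open>r;s\<close>, the cycle law replaces first \<open>r\<close> and
  then \<open>s\<close> by an atom.\<close>

lemma below_comp:
  assumes r: "r \<in> carrier B" and s: "s \<in> carrier B"
  shows "below (r \<Zsemi> s) = (\<Union>a\<in>below r. \<Union>b\<in>below s. acomp a b)"
proof (intro equalityI subsetI)
  fix c assume "c \<in> below (r \<Zsemi> s)"
  then have c: "c \<in> atoms" "e c \<^bold>\<le> r \<Zsemi> s" by (auto simp: below_def)
  have ec: "ra_atom B (e c)" "e c \<in> carrier B" using e_atom[OF c(1)] B.atom_closed by auto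
  have below_meet: "\<exists>a\<in>below r. e a \<^bold>\<le> t" 
    if nz: "t \<^bold>\<cdot> r \<noteq> rzero B" and tr: "t \<in> carrier B" "r \<in> carrier B" for t r
  proof -
    obtain a where a: "a \<in> atoms" "e a \<^bold>\<le> t \<^bold>\<cdot> r"
      using e_dense[OF B.meet_closed[OF tr] nz] by blast
    have "e a \<in> carrier B" using e_atom[OF a(1)] B.atom_closed by auto
    then have "e a \<^bold>\<le> t" "e a \<^bold>\<le> r"
      using B.le_trans[OF a(2) B.meet_lower1] B.le_trans[OF a(2) B.meet_lower2] tr B.meet_closed
      by simp_all
    then show ?thesis using a(1) by (auto simp: below_def)
  qed
  have "(r \<Zsemi> s) \<^bold>\<cdot> e c \<noteq> rzero B"
    using c(2) B.atom_le_iff'[OF ec(1)] r s B.comp_closed by simp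
  then have "(e c \<Zsemi> s\<smile>) \<^bold>\<cdot> r \<noteq> rzero B" using B.cycle_law' r s ec by simp
  then obtain a where a: "a \<in> below r" "e a \<^bold>\<le> e c \<Zsemi> s\<smile>"
    using below_meet[OF _ B.comp_closed[OF ec(2) B.conv_closed[OF s]] r] by blast
  have aa: "a \<in> atoms" using a(1) below_atoms by blast
  then have ea: "ra_atom B (e a)" "e a \<in> carrier B" using e_atom B.atom_closed by auto
  have "(e c \<Zsemi> s\<smile>) \<^bold>\<cdot> e a \<noteq> rzero B"
    using a(2) B.atom_le_iff'[OF ea(1)] s ec B.comp_closed B.conv_closed by simp
  then have "(e a \<Zsemi> s) \<^bold>\<cdot> e c \<noteq> rzero B"
    using B.cycle_law'[OF ea(2) s ec(2)] by simp
  then have "((e a)\<smile> \<Zsemi> e c) \<^bold>\<cdot> s \<noteq> rzero B"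
    using B.cycle_law[OF ea(2) s ec(2)] by simp
  then obtain b where b: "b \<in> below s" "e b \<^bold>\<le> (e a)\<smile> \<Zsemi> e c"
    using below_meet[OF _ B.comp_closed[OF B.conv_closed[OF ea(2)] ec(2)] s] by blast
  have bb: "b \<in> atoms" using b(1) below_atoms by blast
  have "e c \<^bold>\<le> e a \<Zsemi> e b"
    using B.atom_comp_cycle[OF ea(1) e_atom[OF bb] ec(1)] b(2) by simp
  then have "c \<in> acomp a b" using e_comp[OF aa bb c(1)] by simp
  then show "c \<in> (\<Union>a\<in>below r. \<Union>b\<in>below s. acomp a b)" using a(1) b(1) by blast
next
  fix c assume "c \<in> (\<Union>a\<in>below r. \<Union>b\<in>below s. acomp a b)"
  then obtain a b where ab: "a \<in> below r" "b \<in> below s" "c \<in> acomp a b" by blast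
  have at: "a \<in> atoms" "b \<in> atoms" "c \<in> atoms" using ab below_atoms acomp_atoms by blast+
  then have cl: "e a \<in> carrier B" "e b \<in> carrier B" "e c \<in> carrier B" using e_atom B.atom_closed by auto
  have "e c \<^bold>\<le> e a \<Zsemi> e b" using e_comp[OF at] ab(3) by simp
  moreover have "e a \<Zsemi> e b \<^bold>\<le> r \<Zsemi> s"
    using ab(1,2) cl r s by (intro B.comp_mono) (auto simp: below_def)
  ultimately have "e c \<^bold>\<le> r \<Zsemi> s" 
    by (rule B.le_trans) (use cl r s in \<open>simp_all add: B.comp_closed\<close>)
  then show "c \<in> below (r \<Zsemi> s)" using at by (simp add: below_def)
qed

lemma below_id: "below (rident B) = I"
  using e_id I_atoms by (auto simp: below_def)

lemma below_is_sum:
  assumes "is_sum B X s" "X \<subseteq> carrier B"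
  shows "below s = (\<Union>r\<in>X. below r)"
  using B.atom_le_is_sum[OF e_atom assms] by (auto simp: below_def)

lemma below_atom: "a \<in> atoms \<Longrightarrow> below (e a) = {a}"
  using B.atom_le_atom[OF e_atom e_atom] e_inj B.le_refl[OF B.atom_closed[OF e_atom]]
  by (auto simp: below_def inj_on_def)

lemma rep_hom: "rep \<in> ra_hom B cyclic_ra"
  unfolding ra_hom_def cyclic_ra_sel rep_def
  using below_atoms
  by (auto simp: rel_Union_in_rels below_sum below_compl below_conv below_comp below_id
      compl_rel_Union rel_Union_converse rel_Union_comp Id_pts simp del: UN_simps)

lemma rep_inj: "inj_on rep (carrier B)"
proof (rule inj_onI)
  fix r s assume rs: "r \<in> carrier B" "s \<in> carrier B" "rep r = rep s"
  have "below r = below s"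
    using rs(3) rel_Union_mono_iff[OF below_atoms below_atoms, of r s]
      rel_Union_mono_iff[OF below_atoms below_atoms, of s r] unfolding rep_def by auto
  then show "r = s" using below_inj rs(1,2) by (auto dest: inj_onD)
qed

lemma rep_is_sum:
  assumes "is_sum B X s" "X \<subseteq> carrier B"
  shows "rep s = \<Union> (rep ` X)"
  unfolding rep_def below_is_sum[OF assms] by blast

text \<open>In a complete algebra every set of atoms is the set of atoms below its sum.\<close>

lemma rep_iso:
  assumes "complete_ra B"
  shows "rep \<in> ra_iso B cyclic_ra"
proof -
  have "rels \<subseteq> rep ` carrier B"
  proof
    fix r assume "r \<in> rels"
    then obtain X where X: "X \<subseteq> atoms" "r = (\<Union>a\<in>X. rel a)" by (auto simp: rels_def)
    have eX: "e ` X \<subseteq> carrier B" using X(1) B.atom_closed[OF e_atom] by blast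
    then obtain s where s: "is_sum B (e ` X) s" using assms unfolding complete_ra_def by blast
    have "below s = (\<Union>a\<in>X. below (e a))" using below_is_sum[OF s eX] by simp
    also have "\<dots> = X" using below_atom X(1) by auto
    finally have "rep s = r" using X(2) by (simp add: rep_def)
    then show "r \<in> rep ` carrier B" using s by (auto simp: is_sum_def)
  qed
  moreover have "rep ` carrier B \<subseteq> rels"
    using rel_Union_in_rels[OF below_atoms] by (auto simp: rep_def)
  ultimately show ?thesis
    using rep_hom rep_inj by (simp add: ra_iso_def bij_betw_def cyclic_ra_sel)
qed

lemma rep_completion: "is_completion B cyclic_ra rep"
  unfolding is_completion_def
proof (intro conjI allI impI ballI)
  show "complete_ra cyclic_ra" by (rule cyclic_ra_complete)
  show "rep \<in> ra_hom B cyclic_ra" by (rule rep_hom)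
  show "inj_on rep (carrier B)" by (rule rep_inj)
  show "is_sum cyclic_ra (rep ` X) (rep s)" if "X \<subseteq> carrier B" "is_sum B X s" for X s
  proof -
    have "rep ` X \<subseteq> rels" using rel_Union_in_rels[OF below_atoms] by (auto simp: rep_def)
    then show ?thesis using cyclic_ra_Union_is_sum rep_is_sum[OF that(2,1)] by simp
  qed
  fix b assume "b \<in> carrier cyclic_ra" "b \<noteq> rzero cyclic_ra"
  then obtain X where X: "X \<subseteq> atoms" "b = (\<Union>a\<in>X. rel a)" "b \<noteq> {}"
    by (auto simp: cyclic_ra_sel rels_def)
  then obtain a where a: "a \<in> X" "a \<in> atoms" by blast
  have "rep (e a) \<subseteq> b" using X(2) a below_atom by (auto simp: rep_def)
  then show "\<exists>a\<in>carrier B. a \<noteq> rzero B \<and> rep a \<^bold>\<le>\<^bsub>cyclic_ra\<^esub> b"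
    using e_atom[OF a(2)] B.atom_closed B.atom_nonzero by (auto simp: cyclic_ra_sel)
qed

lemma rep_complete_representation:
  "complete_representation B (set_ra pts full (rep ` carrier B)) rep"
proof -
  let ?S = "set_ra pts full (rep ` carrier B)"
  have sub: "rep ` carrier B \<subseteq> Pow full"
    using rels_full rel_Union_in_rels[OF below_atoms] by (auto simp: rep_def)
  have h: "rep (r \<^bold>+ s) = rep r \<union> rep s" "rep (\<^bold>- r) = full - rep r"
    "rep (r \<Zsemi> s) = rep r O rep s" "rep (r\<smile>) = (rep r)\<inverse>"
    if "r \<in> carrier B" "s \<in> carrier B" for r s
    using rep_hom that by (auto simp: ra_hom_def cyclic_ra_sel)
  have hid: "rep (rident B) = Id_on pts" using rep_hom by (simp add: ra_hom_def cyclic_ra_sel)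
  have ra: "relation_algebra ?S"
  proof (rule set_ra_relation_algebra[OF equiv_full sub])
    fix r s assume "r \<in> rep ` carrier B" "s \<in> rep ` carrier B"
    then obtain u v where uv: "u \<in> carrier B" "v \<in> carrier B" "r = rep u" "s = rep v" by blast
    show "r \<union> s \<in> rep ` carrier B" using uv h(1)[OF uv(1,2)] B.sum_closed by (metis imageI)
    show "full - r \<in> rep ` carrier B" using uv h(2)[OF uv(1,2)] B.compl_closed by (metis imageI)
    show "r O s \<in> rep ` carrier B" using uv h(3)[OF uv(1,2)] B.comp_closed by (metis imageI)
    show "r\<inverse> \<in> rep ` carrier B" using uv h(4)[OF uv(1,2)] B.conv_closed by (metis imageI)
  next
    show "Id_on pts \<in> rep ` carrier B" using hid B.ident_closed by (metis imageI)
  qed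
  have "Id_on pts \<subseteq> full" using equiv_full by (auto simp: equiv_def refl_on_def)
  then have "rep (runit B) = full"
    using h(1)[OF B.ident_closed B.compl_closed[OF B.ident_closed]]
      h(2)[OF B.ident_closed B.ident_closed] hid by (auto simp: runit_def)
  then have "full \<in> rep ` carrier B" using B.unit_closed by (metis imageI)
  then have "set_relation_algebra ?S"
    using set_ra_set_relation_algebra[OF equiv_full ra sub] by blast
  moreover have "rep \<in> ra_iso B ?S"
    using rep_hom rep_inj
    by (auto simp: ra_iso_def ra_hom_def bij_betw_def cyclic_ra_sel set_ra_def)
  ultimately show ?thesis using rep_is_sum by (simp add: complete_representation_def)
qed

end

section \<open>Measurable algebras with finite groups\<close>

locale finite_measurable_algebra = relation_algebra A for A :: "('a, 'm) ra_scheme" (structure) +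
  assumes measurable: "measurable_ra A"
    and finite_groups: "\<And>x. measurable_atom A x \<Longrightarrow> finite (carrier (atom_group A x))"
begin

definition matoms :: "'a set" where "matoms = {x. measurable_atom A x}"

definition comp_atoms :: "'a \<Rightarrow> 'a \<Rightarrow> 'a set" where
  "comp_atoms a b = {c. ra_atom A c \<and> c \<^bold>\<le> a \<Zsemi> b}"

lemma matomsD:
  assumes "x \<in> matoms"
  shows "measurable_atom A x" "subidentity_atom A x" "ra_atom A x" "x \<in> carrier A" "x \<^bold>\<le> rident A"
  using assms measurable_atom_subid subid_atomD by (auto simp: matoms_def)

lemma atomic:
  assumes "b \<in> carrier A" "b \<noteq> \<zero>"
  shows "\<exists>a. ra_atom A a \<and> a \<^bold>\<le> b"
  using measurable_atomic[OF measurable finite_groups assms] by (auto simp: atoms_between_def)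

lemma atom_between:
  assumes "ra_atom A a"
  shows "\<exists>x\<in>matoms. \<exists>y\<in>matoms. a \<in> atoms_between x y"
proof -
  obtain x y b where b: "measurable_atom A x" "measurable_atom A y" "b \<in> atoms_between x y" "b \<^bold>\<le> a"
    using measurable_atomic[OF measurable finite_groups atom_closed[OF assms] atom_nonzero[OF assms]] by blast
  have "b = a" using atom_le_atom[OF _ assms b(4)] b(3) by (simp add: atoms_between_def)
  then show ?thesis using b by (auto simp: matoms_def)
qed

lemma between_facts:
  assumes "x \<in> matoms" "y \<in> matoms" "a \<in> atoms_between x y"
  shows "ra_atom A a" "a \<in> carrier A" "a \<noteq> \<zero>" "x \<Zsemi> a = a" "a \<Zsemi> y = a"
    "a \<^bold>\<le> x \<Zsemi> \<U>" "a \<^bold>\<le> \<U> \<Zsemi> y" "x \<^bold>\<le> a \<Zsemi> \<U>" "y \<^bold>\<le> \<U> \<Zsemi> a"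
proof -
  show at: "ra_atom A a" and c: "a \<in> carrier A" and nz: "a \<noteq> \<zero>"
    using assms(3) atom_closed atom_nonzero by (auto simp: atoms_between_def)
  show s: "a \<^bold>\<le> x \<Zsemi> \<U>" "a \<^bold>\<le> \<U> \<Zsemi> y"
    using le_square_sides[OF matomsD(2)[OF assms(1)] matomsD(2)[OF assms(2)] c] assms(3)
    by (auto simp: atoms_between_def)
  show "x \<Zsemi> a = a" "a \<Zsemi> y = a"
    using square_leI[OF matomsD(2)[OF assms(1)] matomsD(2)[OF assms(2)] c s] by auto
  show "x \<^bold>\<le> a \<Zsemi> \<U>" "y \<^bold>\<le> \<U> \<Zsemi> a"
    using atom_le_unit_side(1)[OF matomsD(2)[OF assms(1)] c nz s(1)]
      atom_le_unit_side(2)[OF matomsD(2)[OF assms(2)] c nz s(2)] by auto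
qed

lemma zero_comp:
  assumes r: "r \<in> carrier A"
  shows "\<zero> \<Zsemi> r = \<zero>"
proof -
  have zr: "\<zero> \<Zsemi> r \<in> carrier A" using r by (simp add: closed)
  have ur: "\<U> \<Zsemi> r\<smile> \<in> carrier A" using r by (simp add: closed)
  have "(\<U> \<Zsemi> r\<smile>) \<^bold>\<cdot> \<zero> = \<zero>"
    using le_zero[OF meet_lower2[OF ur zero_closed]] meet_closed[OF ur zero_closed] by blast
  then have "(\<zero> \<Zsemi> r) \<^bold>\<cdot> \<U> = \<zero>" using cycle_law'[OF zero_closed r unit_closed] by blast
  then show ?thesis
    using meet_greatest[OF le_refl[OF zr] le_unit[OF zr] zr unit_closed zr] le_zero[OF _ zr] by simp
qed

lemma matoms_comp_zero:
  assumes "x \<in> matoms" "y \<in> matoms" "x \<noteq> y"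
  shows "x \<Zsemi> y = \<zero>"
proof -
  note x = matomsD[OF assms(1)] and y = matomsD[OF assms(2)]
  have "x \<Zsemi> y \<^bold>\<le> x"
    using comp_mono_right[OF y(5,4) ident_closed x(4)] comp_ident[OF x(4)] by simp
  moreover have "x \<Zsemi> y \<^bold>\<le> y"
    using comp_mono_left[OF x(5,4) ident_closed y(4)] ident_comp[OF y(4)] by simp
  ultimately show ?thesis
    using x(3) y(3) assms(3) comp_closed[OF x(4) y(4)] unfolding ra_atom_def by metis
qed

lemma hom_left_unique:
  assumes "x \<in> matoms" "x' \<in> matoms" "a \<in> carrier A" "a \<noteq> \<zero>" "x \<Zsemi> a = a" "x' \<Zsemi> a = a"
  shows "x = x'"
proof (rule ccontr)
  assume "x \<noteq> x'"
  then have "x \<Zsemi> x' = \<zero>" using matoms_comp_zero assms by blast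
  then have "a = \<zero>"
    using comp_assoc[of x x' a] matomsD(4)[OF assms(1)] matomsD(4)[OF assms(2)] assms zero_comp by metis
  then show False using assms by simp
qed

lemma between_unique:
  assumes "x \<in> matoms" "y \<in> matoms" "x' \<in> matoms" "y' \<in> matoms"
    "a \<in> atoms_between x y" "a \<in> atoms_between x' y'"
  shows "x = x' \<and> y = y'"
proof -
  note f = between_facts[OF assms(1,2,5)] and f' = between_facts[OF assms(3,4,6)]
  have "x = x'" using hom_left_unique[OF assms(1,3) f(2,3,4) f'(4)] .
  moreover have "y \<Zsemi> a\<smile> = a\<smile>" "y' \<Zsemi> a\<smile> = a\<smile>"
    using f(5) f'(5) conv_comp[OF f(2) matomsD(4)[OF assms(2)]] conv_comp[OF f(2) matomsD(4)[OF assms(4)]]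
      subid_atom_idem(2)[OF matomsD(2)[OF assms(2)]] subid_atom_idem(2)[OF matomsD(2)[OF assms(4)]] by auto
  then have "y = y'"
    using hom_left_unique[OF assms(2,4) conv_closed[OF f(2)]] conv_eq_zero[OF f(2)] f(3) by blast
  ultimately show ?thesis by blast
qed

lemma unit_absorb:
  assumes "x \<in> carrier A" "s \<in> carrier A" "r \<in> carrier A" "r \<^bold>\<le> x \<Zsemi> \<U>" "x \<^bold>\<le> s \<Zsemi> \<U>"
  shows "r \<^bold>\<le> s \<Zsemi> \<U>"
proof -
  have "x \<Zsemi> \<U> \<^bold>\<le> (s \<Zsemi> \<U>) \<Zsemi> \<U>"
    using comp_mono_left[OF assms(5)] assms by (simp add: closed)
  moreover have "(s \<Zsemi> \<U>) \<Zsemi> \<U> = s \<Zsemi> (\<U> \<Zsemi> \<U>)" using comp_assoc assms(2) unit_closed by metis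
  moreover have "s \<Zsemi> (\<U> \<Zsemi> \<U>) \<^bold>\<le> s \<Zsemi> \<U>"
    using assms(2) by (simp add: comp_mono_right le_unit closed)
  ultimately have "x \<Zsemi> \<U> \<^bold>\<le> s \<Zsemi> \<U>"
    using le_trans[of "x \<Zsemi> \<U>" "s \<Zsemi> (\<U> \<Zsemi> \<U>)" "s \<Zsemi> \<U>"] assms by (simp add: closed)
  then show ?thesis using le_trans[OF assms(4)] assms by (simp add: closed)
qed

lemma between_comp_nonzero:
  assumes "x \<in> matoms" "y \<in> matoms" "z \<in> matoms" "a \<in> atoms_between x y" "b \<in> atoms_between y z"
  shows "a \<Zsemi> b \<noteq> \<zero>"
proof -
  note a = between_facts[OF assms(1,2,4)] and b = between_facts[OF assms(2,3,5)]
  have y: "y \<in> carrier A" "subidentity_atom A y" using matomsD assms by auto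
  have "a\<smile> \<in> atoms_between y x" using conv_hom matomsD assms by blast
  then have "y \<^bold>\<le> a\<smile> \<Zsemi> \<U>" using between_facts(8)[OF assms(2,1)] by blast
  then have "b \<^bold>\<le> a\<smile> \<Zsemi> \<U>" using unit_absorb[OF y(1) conv_closed[OF a(2)] b(2,6)] by blast
  then have "(a\<smile> \<Zsemi> \<U>) \<^bold>\<cdot> b \<noteq> \<zero>"
    using atom_le_iff'[OF b(1)] a(2) by (simp add: closed)
  then show ?thesis using comp_zero_iff[OF a(2) b(2)] by blast
qed

lemma between_comp_le:
  assumes "x \<in> matoms" "y \<in> matoms" "z \<in> matoms" "a \<in> atoms_between x y" "b \<in> atoms_between y z"
    "c \<in> carrier A" "c \<^bold>\<le> a \<Zsemi> b"
  shows "c \<^bold>\<le> x \<Zsemi> \<U> \<Zsemi> z"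
proof -
  note a = between_facts[OF assms(1,2,4)] and b = between_facts[OF assms(2,3,5)]
  have x: "x \<in> carrier A" "z \<in> carrier A" using matomsD assms by auto
  have ab: "a \<Zsemi> b \<in> carrier A" using a b comp_closed by blast
  have "x \<Zsemi> (a \<Zsemi> b) = a \<Zsemi> b" using comp_assoc[OF x(1) a(2) b(2)] a(4) by simp
  moreover have "(a \<Zsemi> b) \<Zsemi> z = a \<Zsemi> b" using comp_assoc[OF a(2) b(2) x(2)] b(5) by simp
  ultimately have "a \<Zsemi> b = x \<Zsemi> (a \<Zsemi> b) \<Zsemi> z" by simp
  also have "\<dots> \<^bold>\<le> x \<Zsemi> \<U> \<Zsemi> z"
    using ab x by (intro comp_mono_left comp_mono_right le_unit) (simp_all add: closed)
  finally have "a \<Zsemi> b \<^bold>\<le> x \<Zsemi> \<U> \<Zsemi> z" .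
  then show ?thesis using le_trans[OF assms(7)] assms(6) ab x by (simp add: closed)
qed

lemma between_comp_disconnected:
  assumes "x \<in> matoms" "y \<in> matoms" "y' \<in> matoms" "z \<in> matoms"
    "a \<in> atoms_between x y" "b \<in> atoms_between y' z" "y \<noteq> y'"
  shows "a \<Zsemi> b = \<zero>"
proof -
  note a = between_facts[OF assms(1,2,5)] and b = between_facts[OF assms(3,4,6)]
  have y: "y \<in> carrier A" "y' \<in> carrier A" using matomsD assms by auto
  have "y \<Zsemi> b = y \<Zsemi> (y' \<Zsemi> b)" using b(4) by simp
  also have "\<dots> = \<zero>"
    using comp_assoc[OF y b(2)] matoms_comp_zero[OF assms(2,3,7)] zero_comp[OF b(2)] by simp
  finally have yb: "y \<Zsemi> b = \<zero>" .
  have "a \<Zsemi> b = (a \<Zsemi> y) \<Zsemi> b" using a(5) by simp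
  also have "\<dots> = a \<Zsemi> \<zero>" using comp_assoc[OF a(2) y(1) b(2)] yb by simp
  also have "\<dots> = \<zero>"
    using zero_comp[OF conv_closed[OF a(2)]] conv_comp[OF a(2) zero_closed] conv_zero
      conv_eq_zero[OF comp_closed[OF a(2) zero_closed]] by simp
  finally show ?thesis .
qed

lemma atom_le_comp:
  assumes c: "ra_atom A c" and r: "r \<in> carrier A" and s: "s \<in> carrier A" and le: "c \<^bold>\<le> r \<Zsemi> s"
  shows "\<exists>a. ra_atom A a \<and> a \<^bold>\<le> r \<and> c \<^bold>\<le> a \<Zsemi> s"
proof -
  have cc: "c \<in> carrier A" using atom_closed c by blast
  have "(r \<Zsemi> s) \<^bold>\<cdot> c \<noteq> \<zero>" using le atom_le_iff'[OF c comp_closed[OF r s]] by blast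
  then have "(c \<Zsemi> s\<smile>) \<^bold>\<cdot> r \<noteq> \<zero>" using cycle_law'[OF r s cc] by blast
  moreover have m: "(c \<Zsemi> s\<smile>) \<^bold>\<cdot> r \<in> carrier A" using cc r s by (simp add: closed)
  ultimately obtain a where a: "ra_atom A a" "a \<^bold>\<le> (c \<Zsemi> s\<smile>) \<^bold>\<cdot> r" using atomic by blast
  have ac: "a \<in> carrier A" using atom_closed a by blast
  have t: "c \<Zsemi> s\<smile> \<in> carrier A" using cc s by (simp add: closed)
  have "a \<^bold>\<le> c \<Zsemi> s\<smile>" "a \<^bold>\<le> r"
    using le_trans[OF a(2) meet_lower1[OF t r] ac m t] le_trans[OF a(2) meet_lower2[OF t r] ac m r] by auto
  moreover from this have "(c \<Zsemi> s\<smile>) \<^bold>\<cdot> a \<noteq> \<zero>" using atom_le_iff'[OF a(1) t] by blast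
  then have "(a \<Zsemi> s) \<^bold>\<cdot> c \<noteq> \<zero>" using cycle_law'[OF ac s cc] by blast
  then have "c \<^bold>\<le> a \<Zsemi> s" using atom_le_iff'[OF c comp_closed[OF ac s]] by blast
  ultimately show ?thesis using a(1) by blast
qed

lemma atom_le_comp_right:
  assumes c: "ra_atom A c" and r: "r \<in> carrier A" and s: "s \<in> carrier A" and le: "c \<^bold>\<le> r \<Zsemi> s"
  shows "\<exists>b. ra_atom A b \<and> b \<^bold>\<le> s \<and> c \<^bold>\<le> r \<Zsemi> b"
proof -
  have cc: "c \<in> carrier A" using atom_closed c by blast
  have "c\<smile> \<^bold>\<le> s\<smile> \<Zsemi> r\<smile>"
    using conv_mono[OF le cc comp_closed[OF r s]] conv_comp[OF r s] by simp
  then obtain b where b: "ra_atom A b" "b \<^bold>\<le> s\<smile>" "c\<smile> \<^bold>\<le> b \<Zsemi> r\<smile>"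
    using atom_le_comp[OF conv_atom[OF c] conv_closed[OF s] conv_closed[OF r]] by blast
  have bc: "b \<in> carrier A" using atom_closed b by blast
  have "b\<smile> \<^bold>\<le> s" using b(2) conv_le_swap[OF bc s] by simp
  moreover have "c \<^bold>\<le> r \<Zsemi> b\<smile>"
    using conv_mono[OF b(3)] conv_comp[OF bc conv_closed[OF r]] cc bc r
    by (simp add: conv_conv closed)
  ultimately show ?thesis using conv_atom[OF b(1)] by blast
qed

text \<open>The product of functional elements is functional.\<close>

lemma square_comp_atom:
  assumes "x \<in> matoms" "p \<in> atoms_between x x" "q \<in> atoms_between x x"
  shows "ra_atom A (p \<Zsemi> q)"
proof (rule functional_in_square_atom[OF matomsD(2)[OF assms(1)]])
  note p = between_facts[OF assms(1,1,2)] and q = between_facts[OF assms(1,1,3)]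
  have f: "functional A p" "functional A q"
    using assms square_atom_functional[OF matomsD(1)[OF assms(1)]] by (auto simp: atom_group_def)
  show "p \<Zsemi> q \<noteq> \<zero>" using between_comp_nonzero assms by blast
  show "p \<Zsemi> q \<^bold>\<le> x \<Zsemi> \<U> \<Zsemi> x"
    using between_comp_le[OF assms(1,1,1,2,3)] p(2) q(2) comp_closed le_refl by blast
  have "p\<smile> \<Zsemi> p \<^bold>\<le> rident A" using f(1) by (simp add: functional_def)
  then have "q\<smile> \<Zsemi> (p\<smile> \<Zsemi> p) \<Zsemi> q \<^bold>\<le> q\<smile> \<Zsemi> rident A \<Zsemi> q"
    using p(2) q(2) by (intro comp_mono_left comp_mono_right) (simp_all add: closed)
  also have "q\<smile> \<Zsemi> rident A \<Zsemi> q = q\<smile> \<Zsemi> q" using q(2) by (simp add: comp_ident conv_closed)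
  finally have 1: "q\<smile> \<Zsemi> (p\<smile> \<Zsemi> p) \<Zsemi> q \<^bold>\<le> q\<smile> \<Zsemi> q" .
  have "(p \<Zsemi> q)\<smile> \<Zsemi> (p \<Zsemi> q) = q\<smile> \<Zsemi> (p\<smile> \<Zsemi> p) \<Zsemi> q"
    using p(2) q(2) by (simp add: conv_comp comp_assoc closed)
  then have "(p \<Zsemi> q)\<smile> \<Zsemi> (p \<Zsemi> q) \<^bold>\<le> rident A"
    using le_trans[OF 1] f(2) p(2) q(2) by (simp add: functional_def closed)
  then show "functional A (p \<Zsemi> q)" using p(2) q(2) by (simp add: functional_def closed)
qed

lemma measured_atoms:
  "measured_atoms matoms atoms_between comp_atoms (rconv A) (atom_group A)"
proof
  fix x y z a b c
  assume I: "x \<in> matoms" "y \<in> matoms" "z \<in> matoms" and a: "a \<in> atoms_between x y"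
    and b: "b \<in> atoms_between y z"
  note fa = between_facts[OF I(1,2) a] and fb = between_facts[OF I(2,3) b]
  show "comp_atoms a b \<noteq> {}"
    using atomic[OF comp_closed[OF fa(2) fb(2)] between_comp_nonzero[OF I a b]]
    by (auto simp: comp_atoms_def)
  assume "c \<in> comp_atoms a b"
  then have c: "ra_atom A c" "c \<^bold>\<le> a \<Zsemi> b" by (auto simp: comp_atoms_def)
  show "c \<in> atoms_between x z"
    using between_comp_le[OF I a b atom_closed[OF c(1)] c(2)] c(1) by (simp add: atoms_between_def)
  show "a \<in> comp_atoms c (b\<smile>)"
    using atom_comp_cycle'[OF fa(1) fb(1) c(1)] c fa(1) by (simp add: comp_atoms_def)
  show "b \<in> comp_atoms (a\<smile>) c"
    using atom_comp_cycle[OF fa(1) fb(1) c(1)] c fb(1) by (simp add: comp_atoms_def)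
next
  fix x y a assume I: "x \<in> matoms" "y \<in> matoms" and a: "a \<in> atoms_between x y"
  note fa = between_facts[OF I a]
  show "a\<smile> \<in> atoms_between y x" using conv_hom matomsD I a by blast
  show "(a\<smile>)\<smile> = a" using conv_conv fa by blast
  show "comp_atoms x a = {a}" using fa atom_le_atom le_refl by (auto simp: comp_atoms_def)
  show "comp_atoms a y = {a}" using fa atom_le_atom le_refl by (auto simp: comp_atoms_def)
next
  fix x assume x: "x \<in> matoms"
  note fx = matomsD[OF x]
  have "x \<Zsemi> x = x" using subid_atom_idem[OF fx(2)] by simp
  then have "x \<^bold>\<le> x \<Zsemi> \<U>" "x \<^bold>\<le> \<U> \<Zsemi> x"
    using comp_mono_right[OF le_unit[OF fx(4)] fx(4) unit_closed fx(4)]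
      comp_mono_left[OF le_unit[OF fx(4)] fx(4) unit_closed fx(4)] by auto
  then show "x \<in> atoms_between x x"
    using square_leI(3)[OF fx(2,2,4)] fx(3) by (simp add: atoms_between_def)
  show "carrier (atom_group A x) = atoms_between x x" using square_atom_functional[OF fx(1)] by simp
  then show "finite (atoms_between x x)" using finite_groups[OF fx(1)] by simp
  show "\<one>\<^bsub>atom_group A x\<^esub> = x" by (simp add: atom_group_def)
  fix p q assume pq: "p \<in> atoms_between x x" "q \<in> atoms_between x x"
  have "ra_atom A (p \<Zsemi> q)" using square_comp_atom[OF x pq] .
  then show "comp_atoms p q = {p \<otimes>\<^bsub>atom_group A x\<^esub> q}"
    using atom_le_atom le_refl atom_closed by (auto simp: comp_atoms_def atom_group_def)
next
  fix x y z w a b c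
  assume I: "x \<in> matoms" "y \<in> matoms" "z \<in> matoms" "w \<in> matoms" and a: "a \<in> atoms_between x y"
    and b: "b \<in> atoms_between y z" and c: "c \<in> atoms_between z w"
  have cl: "a \<in> carrier A" "b \<in> carrier A" "c \<in> carrier A" using between_facts(2) I a b c by blast+
  have ab: "a \<Zsemi> b \<in> carrier A" and bc: "b \<Zsemi> c \<in> carrier A" using cl comp_closed by auto
  have eq: "a \<Zsemi> (b \<Zsemi> c) = (a \<Zsemi> b) \<Zsemi> c" using comp_assoc[OF cl] .
  have l: "d \<in> (\<Union>e\<in>comp_atoms a b. comp_atoms e c) \<longleftrightarrow> ra_atom A d \<and> d \<^bold>\<le> (a \<Zsemi> b) \<Zsemi> c" for d
  proof
    assume "d \<in> (\<Union>e\<in>comp_atoms a b. comp_atoms e c)"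
    then obtain e where e: "ra_atom A e" "e \<^bold>\<le> a \<Zsemi> b" "ra_atom A d" "d \<^bold>\<le> e \<Zsemi> c"
      by (auto simp: comp_atoms_def)
    have ec: "e \<in> carrier A" "d \<in> carrier A" using atom_closed e by auto
    have "d \<^bold>\<le> (a \<Zsemi> b) \<Zsemi> c"
      using le_trans[OF e(4) comp_mono_left[OF e(2) ec(1) ab cl(3)] ec(2)] ec cl ab by (simp add: closed)
    then show "ra_atom A d \<and> d \<^bold>\<le> (a \<Zsemi> b) \<Zsemi> c" using e by blast
  next
    assume "ra_atom A d \<and> d \<^bold>\<le> (a \<Zsemi> b) \<Zsemi> c"
    then show "d \<in> (\<Union>e\<in>comp_atoms a b. comp_atoms e c)"
      using atom_le_comp[of d, OF _ ab cl(3)] by (auto simp: comp_atoms_def)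
  qed
  have r: "d \<in> (\<Union>e\<in>comp_atoms b c. comp_atoms a e) \<longleftrightarrow> ra_atom A d \<and> d \<^bold>\<le> a \<Zsemi> (b \<Zsemi> c)" for d
  proof
    assume "d \<in> (\<Union>e\<in>comp_atoms b c. comp_atoms a e)"
    then obtain e where e: "ra_atom A e" "e \<^bold>\<le> b \<Zsemi> c" "ra_atom A d" "d \<^bold>\<le> a \<Zsemi> e"
      by (auto simp: comp_atoms_def)
    have ec: "e \<in> carrier A" "d \<in> carrier A" using atom_closed e by auto
    have "d \<^bold>\<le> a \<Zsemi> (b \<Zsemi> c)"
      using le_trans[OF e(4) comp_mono_right[OF e(2) ec(1) bc cl(1)] ec(2)] ec cl bc by (simp add: closed)
    then show "ra_atom A d \<and> d \<^bold>\<le> a \<Zsemi> (b \<Zsemi> c)" using e by blast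
  next
    assume "ra_atom A d \<and> d \<^bold>\<le> a \<Zsemi> (b \<Zsemi> c)"
    then show "d \<in> (\<Union>e\<in>comp_atoms b c. comp_atoms a e)"
      using atom_le_comp_right[of d, OF _ cl(1) bc] by (auto simp: comp_atoms_def)
  qed
  show "(\<Union>e\<in>comp_atoms a b. comp_atoms e c) = (\<Union>e\<in>comp_atoms b c. comp_atoms a e)"
    unfolding set_eq_iff l r eq by blast
next
  fix x y x' y' a
  assume "x \<in> matoms" "y \<in> matoms" "x' \<in> matoms" "y' \<in> matoms"
    "a \<in> atoms_between x y" "a \<in> atoms_between x' y'"
  then show "x = x' \<and> y = y'" by (rule between_unique)
qed

lemma identity_atom_measurable:
  assumes "ra_atom A a" "a \<^bold>\<le> rident A"
  shows "a \<in> matoms"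
proof -
  obtain M where M: "\<forall>x\<in>M. measurable_atom A x" "is_sum A M (rident A)"
    using measurable by (auto simp: measurable_ra_def)
  then have x: "M \<subseteq> matoms" by (auto simp: matoms_def)
  then have "M \<subseteq> carrier A" using matomsD by blast
  then obtain x where "x \<in> M" "a \<^bold>\<le> x" using atom_le_is_sum[OF assms(1) M(2)] assms(2) by blast
  then show ?thesis using atom_le_atom[OF assms(1)] x matomsD(3) by blast
qed

lemma atom_network_exists:
  assumes cyc: "\<And>x. measurable_atom A x \<Longrightarrow> cyclic_group (atom_group A x)"
  shows "\<exists>g base. atom_network matoms atoms_between comp_atoms (rconv A) (atom_group A) g base"
proof -
  interpret M: measured_atoms matoms atoms_between comp_atoms "rconv A" "atom_group A"
    by (rule measured_atoms)
  have "\<exists>p. M.generator x p" if x: "x \<in> matoms" for x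
    using group.cyclic_group[OF M.group_G[OF x]] cyc matomsD(1)[OF x] M.G_carrier[OF x]
    unfolding M.generator_def by blast
  then obtain g where g: "\<And>x. x \<in> matoms \<Longrightarrow> M.generator x (g x)" by metis
  interpret gen: generated_atoms matoms atoms_between comp_atoms "rconv A" "atom_group A" g
    using g by unfold_locales
  obtain h where h: "\<forall>x\<in>matoms. M.generator x (h x)"
    "\<forall>x\<in>matoms. \<forall>y\<in>matoms. M.compatible x y (h x) (h y)"
    using gen.compatible_generators by blast
  interpret C: compatible_atoms matoms atoms_between comp_atoms "rconv A" "atom_group A" h
    using h by unfold_locales auto
  obtain base where b: "\<forall>x\<in>matoms. \<forall>y\<in>matoms. atoms_between x y \<noteq> {} \<longrightarrow> base x y \<in> atoms_between x y"
    "\<forall>x\<in>matoms. \<forall>y\<in>matoms. \<forall>z\<in>matoms. atoms_between x y \<noteq> {} \<longrightarrow> atoms_between y z \<noteq> {} \<longrightarrow>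
      base x z \<in> comp_atoms (base x y) (base y z)"
    using C.network_exists by blast
  have "atom_network matoms atoms_between comp_atoms (rconv A) (atom_group A) h base"
    using b by unfold_locales auto
  then show ?thesis by blast
qed

text \<open>The image of an atom is an atom of \<open>B\<close>, because by density any smaller non-zero element contains the
  image of a non-zero element below that atom. Since \<open>e\<close> reflects the order, products of atoms can
  be compared in the smaller algebra.\<close>

lemma completion_atom_embedding:
  assumes net: "atom_network matoms atoms_between comp_atoms (rconv A) (atom_group A) g base"
    and B: "relation_algebra B" and e: "e \<in> ra_hom A B" "inj_on e (carrier A)"
    and dense: "\<And>b. \<lbrakk>b \<in> carrier B; b \<noteq> rzero B\<rbrakk> \<Longrightarrow> \<exists>a\<in>carrier A. a \<noteq> \<zero> \<and> e a \<^bold>\<le>\<^bsub>B\<^esub> b"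
  shows "atom_embedding matoms atoms_between comp_atoms (rconv A) (atom_group A) g base B e"
proof -
  interpret N: atom_network matoms atoms_between comp_atoms "rconv A" "atom_group A" g base by fact
  interpret B: relation_algebra B by fact
  have at: "a \<in> N.atoms \<longleftrightarrow> ra_atom A a" for a
    using atom_between N.atomsI N.atomsE[of a] between_facts(1) by blast
  have hom: "e (r \<^bold>+ s) = e r \<^bold>+\<^bsub>B\<^esub> e s" "e (\<^bold>- r) = \<^bold>-\<^bsub>B\<^esub> e r" "e (r \<Zsemi> s) = e r \<Zsemi>\<^bsub>B\<^esub> e s"
    "e (r\<smile>) = (e r)\<smile>\<^bsub>B\<^esub>" "e r \<in> carrier B" if "r \<in> carrier A" "s \<in> carrier A" for r s
    using e(1) that by (auto simp: ra_hom_def)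
  have hid: "e (rident A) = rident B" using e(1) by (simp add: ra_hom_def)
  have le: "e r \<^bold>\<le>\<^bsub>B\<^esub> e s \<longleftrightarrow> r \<^bold>\<le> s" if "r \<in> carrier A" "s \<in> carrier A" for r s
    using that hom(1)[OF that, symmetric] inj_on_eq_iff[OF e(2), of "r \<^bold>+ s" s]
    by (simp add: rle_def sum_closed)
  have hz: "e \<zero> = rzero B"
    using hom(2)[OF unit_closed unit_closed] hom(1)[OF ident_closed compl_closed[OF ident_closed]]
      hom(2)[OF ident_closed ident_closed] hid by (simp add: rzero_def runit_def)
  show ?thesis
  proof unfold_locales
    fix a assume a: "a \<in> N.atoms"
    then have aa: "ra_atom A a" "a \<in> carrier A" using at atom_closed by auto
    show "ra_atom B (e a)" unfolding ra_atom_def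
    proof (intro conjI ballI impI)
      show "e a \<in> carrier B" using hom(5)[OF aa(2,2)] .
      show "e a \<noteq> rzero B"
        using hz inj_on_eq_iff[OF e(2) aa(2) zero_closed] atom_nonzero[OF aa(1)] by simp
      fix b assume b: "b \<in> carrier B" "b \<^bold>\<le>\<^bsub>B\<^esub> e a"
      show "b = rzero B \<or> b = e a"
      proof (rule disjCI)
        assume "b \<noteq> e a" 
        show "b = rzero B"
        proof (rule ccontr)
          assume "b \<noteq> rzero B"
          then obtain c where c: "c \<in> carrier A" "c \<noteq> \<zero>" "e c \<^bold>\<le>\<^bsub>B\<^esub> b" using dense b(1) by blast
          have "e c \<^bold>\<le>\<^bsub>B\<^esub> e a" using B.le_trans[OF c(3) b(2)] hom(5) c(1) b(1) aa(2) by blast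
          then have "c = a" using le[OF c(1) aa(2)] aa(1) c unfolding ra_atom_def by blast
          then show False using c(3) b B.le_antisym hom(5) aa(2) \<open>b \<noteq> e a\<close> by blast
        qed
      qed
    qed
    show "e (a\<smile>) = (e a)\<smile>\<^bsub>B\<^esub>" using hom(4)[OF aa(2,2)] .
    have "a \<^bold>\<le> rident A \<longleftrightarrow> a \<in> matoms" using identity_atom_measurable[OF aa(1)] matomsD(5) by blast
    then show "e a \<^bold>\<le>\<^bsub>B\<^esub> rident B \<longleftrightarrow> a \<in> matoms" using le[OF aa(2) ident_closed] hid by simp
  next
    show "inj_on e N.atoms" using at atom_closed by (intro inj_on_subset[OF e(2)]) blast
  next
    fix b assume b: "b \<in> carrier B" "b \<noteq> rzero B"
    then obtain c where c: "c \<in> carrier A" "c \<noteq> \<zero>" "e c \<^bold>\<le>\<^bsub>B\<^esub> b" using dense by blast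
    obtain a where a: "ra_atom A a" "a \<^bold>\<le> c" using atomic[OF c(1,2)] by blast
    have ac: "a \<in> carrier A" using atom_closed a by blast
    have "e a \<^bold>\<le>\<^bsub>B\<^esub> e c" using le[OF ac c(1)] a(2) by blast
    then have "e a \<^bold>\<le>\<^bsub>B\<^esub> b" using B.le_trans[OF _ c(3)] hom(5) ac c(1) b(1) by blast
    then show "\<exists>a\<in>N.atoms. e a \<^bold>\<le>\<^bsub>B\<^esub> b" using a(1) at by blast
  next
    fix a b c assume abc: "a \<in> N.atoms" "b \<in> N.atoms" "c \<in> N.atoms"
    then have cl: "a \<in> carrier A" "b \<in> carrier A" "c \<in> carrier A" using at atom_closed by auto
    have "e c \<^bold>\<le>\<^bsub>B\<^esub> e a \<Zsemi>\<^bsub>B\<^esub> e b \<longleftrightarrow> c \<^bold>\<le> a \<Zsemi> b"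
      using le[OF cl(3) comp_closed[OF cl(1,2)]] hom(3)[OF cl(1,2)] by simp
    also have "\<dots> \<longleftrightarrow> c \<in> N.acomp a b"
    proof
      assume "c \<in> N.acomp a b"
      then show "c \<^bold>\<le> a \<Zsemi> b" by (auto simp: N.acomp_def comp_atoms_def)
    next
      assume c: "c \<^bold>\<le> a \<Zsemi> b"
      obtain x y where a: "x \<in> matoms" "y \<in> matoms" "a \<in> atoms_between x y" using abc(1) by (rule N.atomsE)
      obtain y' z where b: "y' \<in> matoms" "z \<in> matoms" "b \<in> atoms_between y' z" using abc(2) by (rule N.atomsE)
      have "y = y'"
      proof (rule ccontr)
        assume "y \<noteq> y'"
        then have "a \<Zsemi> b = \<zero>" using between_comp_disconnected[OF a(1,2) b(1,2) a(3) b(3)] by blast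
        then have "c = \<zero>" using c le_zero cl(3) by simp
        then show False using abc(3) at atom_nonzero by blast
      qed
      moreover have "c \<in> comp_atoms a b" using c abc(3) at by (simp add: comp_atoms_def)
      ultimately show "c \<in> N.acomp a b" using a b unfolding N.acomp_def by blast
    qed
    finally show "e c \<^bold>\<le>\<^bsub>B\<^esub> e a \<Zsemi>\<^bsub>B\<^esub> e b \<longleftrightarrow> c \<in> N.acomp a b" .
  qed
qed

end

section \<open>The representation theorem\<close>

theorem theorem5p7:
  fixes A :: "'a ra"
  assumes "measurable_ra A"
    and "\<And>x. measurable_atom A x \<Longrightarrow>
          finite (carrier (atom_group A x)) \<and> cyclic_group (atom_group A x)"
  shows "(\<exists>(I :: 'a set) E (G :: 'a \<Rightarrow> 'a monoid) g m.
            equiv I E \<and> cyclic_group_system I G g \<and> index_conditions E G m \<and>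
            (\<exists>(B :: ('a \<times> 'a) set ra) e.
               is_completion A B e \<and> ra_isomorphic B (cyclic_group_ra I E G g m)) \<and>
            (\<forall>(B :: 'b ra) e.
               is_completion A B e \<longrightarrow> ra_isomorphic B (cyclic_group_ra I E G g m))) \<and>
         (\<exists>(S :: ('a \<times> 'a) set ra) f. complete_representation A S f)"
proof -
  interpret finite_measurable_algebra A
    using assms by (auto simp: finite_measurable_algebra_def finite_measurable_algebra_axioms_def
        measurable_ra_def)
  obtain g base where "atom_network matoms atoms_between comp_atoms (rconv A) (atom_group A) g base"
    using atom_network_exists assms(2) by blast
  then interpret N: atom_network matoms atoms_between comp_atoms "rconv A" "atom_group A" g base .
  \<comment> \<open>The algebra itself satisfies the density condition of a completion trivially.\<close>
  interpret E: atom_embedding matoms atoms_between comp_atoms "rconv A" "atom_group A" g base A "\<lambda>a. a"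
  proof (rule completion_atom_embedding[OF N.atom_network_axioms])
    show "relation_algebra A" by unfold_locales
    show "(\<lambda>a. a) \<in> ra_hom A A" by (auto simp: ra_hom_def)
    show "\<exists>a\<in>carrier A. a \<noteq> \<zero> \<and> a \<^bold>\<le>\<^bsub>A\<^esub> b" if "b \<in> carrier A" "b \<noteq> \<zero>" for b
      using that le_refl by blast
  qed simp
  have "(\<lambda>r. r) \<in> ra_iso N.cyclic_ra N.cyclic_ra"
  proof -
    interpret C: relation_algebra N.cyclic_ra by (rule N.cyclic_ra_relation_algebra)
    show ?thesis by (auto simp: ra_iso_def ra_hom_def bij_betw_def)
  qed
  then have "is_completion A N.cyclic_ra E.rep \<and> ra_isomorphic N.cyclic_ra N.cyclic_ra"
    using E.rep_completion by (auto simp: ra_isomorphic_def)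
  moreover have "ra_isomorphic B N.cyclic_ra" if c: "is_completion A B e" for B :: "'b ra" and e
  proof -
    have B: "relation_algebra B" "complete_ra B" using c by (auto simp: is_completion_def complete_ra_def)
    interpret F: atom_embedding matoms atoms_between comp_atoms "rconv A" "atom_group A" g base B e
      using c B(1) by (intro completion_atom_embedding[OF N.atom_network_axioms]) (auto simp: is_completion_def)
    show ?thesis using F.rep_iso[OF B(2)] by (auto simp: ra_isomorphic_def)
  qed
  moreover have "complete_representation A (set_ra N.pts N.full (E.rep ` carrier A)) E.rep"
    by (rule E.rep_complete_representation)
  ultimately show ?thesis
    using N.equiv_conn N.cyclic_group_system N.index_conditions by blast
qed

end
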